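(* Let $N\ge 2$, let $\Omega\subseteq\mathbb{R}^N$ be a bounded domain with Lipschitz boundary $\partial\Omega$, let $2=p<q<N$ with $$\frac{q}{p}<1+\frac1N,$$ and let $\mu\colon\overline{\Omega}\to[0,\infty)$ be Lipschitz continuous. Let $p^*=\frac{Np}{N-p}$ (with $p=2$) and let $\lambda_{1,2}$ be the first eigenvalue of the Dirichlet Laplacian on $\Omega$. Let $f\colon\Omega\times\mathbb{R}\times\mathbb{R}^N\to\mathbb{R}$ be a Carathéodory function satisfying all of the following conditions: (H)(i) there exist $q_1$ with $1<q_1<p^*$, a function $\alpha\in L^{\frac{q_1}{q_1-1}}(\Omega)$ and constants $a_1,a_2\ge 0$ such that $$|f(x,s,\xi)|\le a_1|\xi|^{p\frac{q_1-1}{q_1}}+a_2|s|^{q_1-1}+\alpha(x)$$ for a.a. $x\in\Omega$, all $s\in\mathbb{R}$ and all $\xi\in\mathbb{R}^N$; (H)(ii) there exist $\omega\in L^1(\Omega)$ and constants $b_1,b_2\ge 0$ such that $$f(x,s,\xi)\,s\le b_1|\xi|^p+b_2|s|^p+\omega(x)$$ for a.a. $x\in\Omega$, all $s\in\mathbb{R}$ and all $\xi\in\mathbb{R}^N$, and moreover $b_1+b_2\lambda_{1,2}^{-1}<1$; (U1) there exists $c_1\ge 0$ such that $$(f(x,s,\xi)-f(x,t,\xi))(s-t)\le c_1|s-t|^2$$ for a.a. $x\in\Omega$, all $s,t\in\mathbb{R}$ and all $\xi\in\mathbb{R}^N$; (U2) there exist $\rho\in L^{r'}(\Omega)$ with $1<r'<p^*$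 and $c_2\ge 0$ such that $\xi\mapsto f(x,s,\xi)-\rho(x)$ is linear for a.a. $x\in\Omega$ and all $s\in\mathbb{R}$, and $$|f(x,s,\xi)-\rho(x)|\le c_2|\xi|$$ for a.a. $x\in\Omega$, all $s\in\mathbb{R}$ and all $\xi\in\mathbb{R}^N$; moreover, with $c_1$ from (U1), $$c_1\lambda_{1,2}^{-1}+c_2\lambda_{1,2}^{-\frac12}<1.$$ Then the problem $$-\operatorname{div}\left(|\nabla u|^{p-2}\nabla u+\mu(x)|\nabla u|^{q-2}\nabla u\right)=f(x,u,\nabla u)\ \text{ in }\Omega,\qquad u=0\ \text{ on }\partial\Omega$$ (with $p=2$) admits a unique weak solution.
   Context: Carathéodory function: $x\mapsto f(x,s,\xi)$ is measurable for all $(s,\xi)\in\mathbb{R}\times\mathbb{R}^N$, and $(s,\xi)\mapsto f(x,s,\xi)$ is continuous for a.a. $x\in\Omega$. Function spaces: let $\mathcal{H}\colon\Omega\times[0,\infty)\to[0,\infty)$, $\mathcal{H}(x,t)=t^p+\mu(x)t^q$. The Musielak–Orlicz space is $$L^{\mathcal{H}}(\Omega)=\Big\{u\colon\Omega\to\mathbb{R}\text{ measurable}: \rho_{\mathcal{H}}(u):=\int_\Omega\mathcal{H}(x,|u|)\,dx<+\infty\Big\},$$ with the Luxemburg norm $\|u\|_{\mathcal{H}}=\inf\{\tau>0:\rho_{\mathcal{H}}(u/\tau)\le 1\}$ (functions equal a.e. are identified). The Sobolev space is $W^{1,\mathcal{H}}(\Omega)=\{u\in L^{\mathcal{H}}(\Omega):|\nabla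 u|\in L^{\mathcal{H}}(\Omega)\}$ ($\nabla u$ the weak gradient), with norm $\|u\|_{1,\mathcal{H}}=\|\,|\nabla u|\,\|_{\mathcal{H}}+\|u\|_{\mathcal{H}}$. $W^{1,\mathcal{H}}_0(\Omega)$ is the completion (closure) of $C_0^\infty(\Omega)$ in $W^{1,\mathcal{H}}(\Omega)$. Weak solution: $u\in W^{1,\mathcal{H}}_0(\Omega)$ is a weak solution of the problem if $$\int_\Omega\left(|\nabla u|^{p-2}\nabla u+\mu(x)|\nabla u|^{q-2}\nabla u\right)\cdot\nabla\varphi\,dx=\int_\Omega f(x,u,\nabla u)\,\varphi\,dx\quad\text{for all }\varphi\in W^{1,\mathcal{H}}_0(\Omega).$$ First eigenvalue: for $1<r<\infty$, $\lambda_{1,r}$ denotes the first eigenvalue of $-\Delta_r u=\lambda|u|^{r-2}u$ in $\Omega$, $u=0$ on $\partial\Omega$; it is positive and $$\lambda_{1,r}=\inf\Big\{\int_\Omega|\nabla u|^r\,dx: u\in W^{1,r}_0(\Omega),\ \int_\Omega|u|^r\,dx=1\Big\}.$$ *)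

theory Defs
  imports "HOL-Analysis.Analysis"
begin

section \<open>Domains\<close>

definition domain_set :: "'a::topological_space set \<Rightarrow> bool" where
  "domain_set \<Omega> \<longleftrightarrow> open \<Omega> \<and> connected \<Omega> \<and> \<Omega> \<noteq> {}"

text \<open>Near each boundary point, \<open>\<Omega>\<close> is the part of a ball lying strictly above the graph, in some
  unit direction \<open>e\<close>, of a Lipschitz function \<open>\<gamma>\<close> on the hyperplane orthogonal to \<open>e\<close>.\<close>

definition lipschitz_boundary :: "'a::euclidean_space set \<Rightarrow> bool" where
  "lipschitz_boundary \<Omega> \<longleftrightarrow>
    (\<forall>x\<in>frontier \<Omega>. \<exists>e r \<gamma> L. norm e = 1 \<and> r > 0 \<and> L-lipschitz_on {z. z \<bullet> e = 0} (\<gamma> :: 'a \<Rightarrow> real) \<and>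
       \<Omega> \<inter> ball x r = {y \<in> ball x r. \<gamma> (y - (y \<bullet> e) *\<^sub>R e) < y \<bullet> e})"


section \<open>Test functions and weak gradients\<close>

definition partial_deriv :: "'n::finite \<Rightarrow> (real^'n \<Rightarrow> real) \<Rightarrow> real^'n \<Rightarrow> real" where
  "partial_deriv i \<phi> x = frechet_derivative \<phi> (at x) (axis i 1)"

primrec C_n :: "nat \<Rightarrow> (real^'n::finite \<Rightarrow> real) \<Rightarrow> bool" where
  "C_n 0 \<phi> \<longleftrightarrow> continuous_on UNIV \<phi>"
| "C_n (Suc k) \<phi> \<longleftrightarrow> (\<forall>x. \<phi> differentiable (at x)) \<and> (\<forall>i. C_n k (partial_deriv i \<phi>))"

text \<open>\<open>C\<^sub>0\<^sup>\<infinity>(\<Omega>)\<close>; its members are extended by \<open>0\<close> to the whole space.\<close>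

definition test_functions :: "(real^'n::finite) set \<Rightarrow> (real^'n \<Rightarrow> real) set" where
  "test_functions \<Omega> =
    {\<phi>. (\<forall>k. C_n k \<phi>) \<and> compact (closure {x. \<phi> x \<noteq> 0}) \<and> closure {x. \<phi> x \<noteq> 0} \<subseteq> \<Omega>}"

definition locally_integrable :: "'a::euclidean_space set \<Rightarrow> ('a \<Rightarrow> 'b::euclidean_space) \<Rightarrow> bool" where
  "locally_integrable \<Omega> u \<longleftrightarrow> (\<forall>K. compact K \<and> K \<subseteq> \<Omega> \<longrightarrow> integrable (lebesgue_on K) u)"

definition is_weak_gradient ::
    "(real^'n::finite) set \<Rightarrow> (real^'n \<Rightarrow> real) \<Rightarrow> (real^'n \<Rightarrow> real^'n) \<Rightarrow> bool" where
  "is_weak_gradient \<Omega> u g \<longleftrightarrow>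
    locally_integrable \<Omega> u \<and> locally_integrable \<Omega> g \<and>
    (\<forall>\<phi>\<in>test_functions \<Omega>. \<forall>i.
       (LINT x|lebesgue_on \<Omega>. u x * partial_deriv i \<phi> x) = - (LINT x|lebesgue_on \<Omega>. g x $ i * \<phi> x))"

text \<open>A weak gradient is determined only almost everywhere in \<open>\<Omega>\<close>; this picks one representative.\<close>

definition weak_grad :: "(real^'n::finite) set \<Rightarrow> (real^'n \<Rightarrow> real) \<Rightarrow> real^'n \<Rightarrow> real^'n" where
  "weak_grad \<Omega> u = (SOME g. is_weak_gradient \<Omega> u g)"


section \<open>Musielak--Orlicz and Musielak--Orlicz--Sobolev spaces\<close>

text \<open>Elements of the spaces are represented by functions on the whole space. Only their values on
  \<open>\<Omega>\<close> matter, and functions that agree almost everywhere in \<open>\<Omega>\<close> represent the same element.\<close>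

definition modular :: "('a::euclidean_space \<Rightarrow> real \<Rightarrow> real) \<Rightarrow> 'a set \<Rightarrow> ('a \<Rightarrow> real) \<Rightarrow> ennreal" where
  "modular H \<Omega> u = (\<integral>\<^sup>+ x. ennreal (H x \<bar>u x\<bar>) \<partial>lebesgue_on \<Omega>)"

definition musielak_space :: "('a::euclidean_space \<Rightarrow> real \<Rightarrow> real) \<Rightarrow> 'a set \<Rightarrow> ('a \<Rightarrow> real) set" where
  "musielak_space H \<Omega> = {u \<in> borel_measurable (lebesgue_on \<Omega>). modular H \<Omega> u < \<infinity>}"

definition luxemburg_norm :: "('a::euclidean_space \<Rightarrow> real \<Rightarrow> real) \<Rightarrow> 'a set \<Rightarrow> ('a \<Rightarrow> real) \<Rightarrow> real" where
  "luxemburg_norm H \<Omega> u = Inf {\<tau>. \<tau> > 0 \<and> modular H \<Omega> (\<lambda>x. u x / \<tau>) \<le> 1}"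

definition sobolev_space ::
    "(real^'n::finite \<Rightarrow> real \<Rightarrow> real) \<Rightarrow> (real^'n) set \<Rightarrow> (real^'n \<Rightarrow> real) set" where
  "sobolev_space H \<Omega> =
    {u \<in> musielak_space H \<Omega>. (\<exists>g. is_weak_gradient \<Omega> u g) \<and>
       (\<lambda>x. norm (weak_grad \<Omega> u x)) \<in> musielak_space H \<Omega>}"

definition sobolev_norm ::
    "(real^'n::finite \<Rightarrow> real \<Rightarrow> real) \<Rightarrow> (real^'n) set \<Rightarrow> (real^'n \<Rightarrow> real) \<Rightarrow> real" where
  "sobolev_norm H \<Omega> u =
    luxemburg_norm H \<Omega> (\<lambda>x. norm (weak_grad \<Omega> u x)) + luxemburg_norm H \<Omega> u"

definition sobolev_space0 ::
    "(real^'n::finite \<Rightarrow> real \<Rightarrow> real) \<Rightarrow> (real^'n) set \<Rightarrow> (real^'n \<Rightarrow> real) set" where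
  "sobolev_space0 H \<Omega> =
    {u \<in> sobolev_space H \<Omega>.
       \<forall>\<epsilon>>0. \<exists>\<phi>\<in>test_functions \<Omega>. sobolev_norm H \<Omega> (\<lambda>x. u x - \<phi> x) < \<epsilon>}"

definition double_phase :: "real \<Rightarrow> real \<Rightarrow> ('a \<Rightarrow> real) \<Rightarrow> 'a \<Rightarrow> real \<Rightarrow> real" where
  "double_phase p q \<mu> x t = t powr p + \<mu> x * t powr q"

text \<open>With this choice the Musielak--Orlicz space is \<open>L\<^sup>r(\<Omega>)\<close>, the Luxemburg norm is the usual
  \<open>L\<^sup>r\<close> norm (for \<open>r \<ge> 1\<close>), and \<^const>\<open>sobolev_space0\<close> is \<open>W\<^sub>0\<^bsup>1,r\<^esup>(\<Omega>)\<close>.\<close>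

definition pure_power :: "real \<Rightarrow> 'a \<Rightarrow> real \<Rightarrow> real" where
  "pure_power r x t = t powr r"

abbreviation Lr_space :: "real \<Rightarrow> 'a::euclidean_space set \<Rightarrow> ('a \<Rightarrow> real) set" where
  "Lr_space r \<equiv> musielak_space (pure_power r)"


section \<open>The Dirichlet \<open>r\<close>-Laplacian and its first eigenvalue\<close>

definition sobolev_conjugate :: "real \<Rightarrow> real \<Rightarrow> real" where
  "sobolev_conjugate N p = N * p / (N - p)"

text \<open>Here and below \<open>\<bar>\<xi>\<bar>\<^bsup>r-2\<^esup> \<xi>\<close> is read as \<open>0\<close> for \<open>\<xi> = 0\<close>, which the convention
  \<open>0 powr a = 0\<close> respects.\<close>

definition is_eigenvalue :: "real \<Rightarrow> (real^'n::finite) set \<Rightarrow> real \<Rightarrow> bool" where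
  "is_eigenvalue r \<Omega> l \<longleftrightarrow>
    (\<exists>u\<in>sobolev_space0 (pure_power r) \<Omega>. \<not> (AE x in lebesgue_on \<Omega>. u x = 0) \<and>
      (\<forall>\<phi>\<in>sobolev_space0 (pure_power r) \<Omega>.
        (LINT x|lebesgue_on \<Omega>.
           (norm (weak_grad \<Omega> u x) powr (r - 2) *\<^sub>R weak_grad \<Omega> u x) \<bullet> weak_grad \<Omega> \<phi> x)
        = l * (LINT x|lebesgue_on \<Omega>. \<bar>u x\<bar> powr (r - 2) * u x * \<phi> x)))"

definition first_eigenvalue :: "real \<Rightarrow> (real^'n::finite) set \<Rightarrow> real" where
  "first_eigenvalue r \<Omega> = (LEAST l. is_eigenvalue r \<Omega> l)"


section \<open>The double phase problem with convection\<close>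

definition caratheodory :: "(real^'n::finite) set \<Rightarrow> (real^'n \<Rightarrow> real \<Rightarrow> real^'n \<Rightarrow> real) \<Rightarrow> bool" where
  "caratheodory \<Omega> f \<longleftrightarrow>
    (\<forall>s \<xi>. (\<lambda>x. f x s \<xi>) \<in> borel_measurable (lebesgue_on \<Omega>)) \<and>
    (AE x in lebesgue_on \<Omega>. continuous_on UNIV (\<lambda>(s, \<xi>). f x s \<xi>))"

definition double_phase_flux ::
    "real \<Rightarrow> real \<Rightarrow> ('a \<Rightarrow> real) \<Rightarrow> 'a \<Rightarrow> 'b::real_normed_vector \<Rightarrow> 'b" where
  "double_phase_flux p q \<mu> x \<xi> = norm \<xi> powr (p - 2) *\<^sub>R \<xi> + (\<mu> x * norm \<xi> powr (q - 2)) *\<^sub>R \<xi>"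

text \<open>The Bochner integral of a non-integrable function is \<open>0\<close>, so the existence of the integrals
  in the weak formulation is required explicitly.\<close>

definition weak_solution ::
    "real \<Rightarrow> real \<Rightarrow> (real^'n::finite \<Rightarrow> real) \<Rightarrow> (real^'n) set \<Rightarrow>
     (real^'n \<Rightarrow> real \<Rightarrow> real^'n \<Rightarrow> real) \<Rightarrow> (real^'n \<Rightarrow> real) \<Rightarrow> bool" where
  "weak_solution p q \<mu> \<Omega> f u \<longleftrightarrow>
    u \<in> sobolev_space0 (double_phase p q \<mu>) \<Omega> \<and>
    (\<forall>\<phi>\<in>sobolev_space0 (double_phase p q \<mu>) \<Omega>.
      integrable (lebesgue_on \<Omega>)
        (\<lambda>x. double_phase_flux p q \<mu> x (weak_grad \<Omega> u x) \<bullet> weak_grad \<Omega> \<phi> x) \<and>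
      integrable (lebesgue_on \<Omega>) (\<lambda>x. f x (u x) (weak_grad \<Omega> u x) * \<phi> x) \<and>
      (LINT x|lebesgue_on \<Omega>. double_phase_flux p q \<mu> x (weak_grad \<Omega> u x) \<bullet> weak_grad \<Omega> \<phi> x)
      = (LINT x|lebesgue_on \<Omega>. f x (u x) (weak_grad \<Omega> u x) * \<phi> x))"

end

theory Submission
  imports Defs "HOL-Complex_Analysis.Great_Picard" "HOL-Library.Diagonal_Subsequence"
begin

text \<open>
  The key observation is that the nonlinearity is affine in the gradient and does not depend on the solution.
  By the linearity assumption \<open>f x s \<xi> - \<rho> x\<close> is linear in \<open>\<xi>\<close>; inserting \<open>k \<xi>\<close> for all real \<open>k\<close> into the
  one-sided Lipschitz condition then forces \<open>f x s \<xi> = f x t \<xi>\<close>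
  (\<open>convection_independent_of_value\<close>).  Hence \<open>f x s \<xi> = \<rho> x + c x \<bullet> \<xi>\<close> with \<open>\<bar>c\<bar> \<le> c2\<close> almost everywhere,
  and the smallness condition gives \<open>c2\<^sup>2 < \<lambda>\<close>, where \<open>\<lambda>\<close> is the first Dirichlet eigenvalue.  At \<open>\<xi> = 0\<close> the
  growth condition gives \<open>\<rho> s \<le> b2 s\<^sup>2 + \<omega>\<close> for all \<open>s\<close>, so \<open>\<rho>\<close> is square integrable.

  For a fixed square integrable right-hand side the problem is the Euler--Lagrange equation of a strictly convex
  functional.  Clarkson's inequality makes every minimizing sequence Cauchy, so the minimum is attained
  (\<open>ex_solution\<close>).  The flux is strongly monotone: \<open>\<bar>a - b\<bar>\<^sup>2 \<le> (flux a - flux b) \<bullet> (a - b)\<close>.  Together with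
  Poincare's inequality with the sharp constant \<open>\<lambda>\<close> this shows that the map which freezes the convection term at a vector
  field \<open>k\<close> and returns the gradient of the solution is a contraction in the square norm, with factor
  \<open>c2 / sqrt \<lambda>\<close> (\<open>solves_contraction\<close>).  Its fixed point is the solution (\<open>ex_fixed_point\<close>), and the same estimate
  gives uniqueness (\<open>solves_unique\<close>).

  Three facts about function spaces are needed on the way, all of them for test functions first.  They rest on one
  estimate, \<open>\<parallel>\<phi>(\<cdot> + z) - \<phi>\<parallel> \<le> \<bar>z\<bar> \<parallel>\<nabla>\<phi>\<parallel>\<close> in the square norm (\<open>translation_estimate\<close>): a long translation gives
  Poincare's inequality with some constant; averaging over small balls gives Rellich's compactness theorem via
  Arzela--Ascoli; and choosing the radius of the ball according to the level gives the embedding into \<open>L\<^sup>q\<close> for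
  \<open>q < 2 + 4/N\<close>.  Rellich's theorem is what identifies the infimum of the Rayleigh quotient as the least eigenvalue
  (\<open>first_eigenvalue_eq\<close>).  The embedding controls the term \<open>\<mu> \<bar>u\<bar>\<^sup>q\<close> of the Musielak--Orlicz norm, so that the solution
  space is the closure of the test functions in an energy that involves only \<open>u\<^sup>2\<close> and the gradient
  (\<open>sobolev_space0_if_W0\<close>, \<open>W0_if_sobolev_space0\<close>).
\<close>

section \<open>Smooth functions\<close>

lemma C_n_imp_continuous_on: "C_n k \<phi> \<Longrightarrow> continuous_on UNIV \<phi>"
  by (cases k) (auto intro!: continuous_at_imp_continuous_on differentiable_imp_continuous_within)

lemma C_n_Suc_imp_C_n: "C_n (Suc k) \<phi> \<Longrightarrow> C_n k \<phi>"
proof (induction k arbitrary: \<phi>)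
  case 0
  then show ?case using C_n_imp_continuous_on[OF 0] by simp
next
  case (Suc k)
  then show ?case by (metis C_n.simps(2))
qed

lemma partial_deriv_eqI: "(\<phi> has_derivative D) (at x) \<Longrightarrow> partial_deriv i \<phi> x = D (axis i 1)"
  by (metis frechet_derivative_at partial_deriv_def)

lemma C_n_const: "C_n k (\<lambda>x::real^'n::finite. c)"
proof (induction k arbitrary: c)
  case (Suc k)
  have "partial_deriv i (\<lambda>x::real^'n. c) = (\<lambda>x. 0)" for i :: 'n
    by (rule ext, subst partial_deriv_eqI[where D = "\<lambda>_. 0"]) auto
  then show ?case using Suc by simp
qed simp

lemma C_n_add: "C_n k \<phi> \<Longrightarrow> C_n k \<psi> \<Longrightarrow> C_n k (\<lambda>x. \<phi> x + \<psi> x)"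
proof (induction k arbitrary: \<phi> \<psi>)
  case (Suc k)
  have "partial_deriv i (\<lambda>x. \<phi> x + \<psi> x) = (\<lambda>x. partial_deriv i \<phi> x + partial_deriv i \<psi> x)" for i
    using Suc.prems
    by (intro ext, subst partial_deriv_eqI[OF has_derivative_add])
      (auto simp: frechet_derivative_works[symmetric] partial_deriv_def)
  then show ?case using Suc by (simp add: differentiable_add)
qed (auto intro: continuous_intros)

lemma C_n_mult: "C_n k \<phi> \<Longrightarrow> C_n k \<psi> \<Longrightarrow> C_n k (\<lambda>x. \<phi> x * \<psi> x)"
proof (induction k arbitrary: \<phi> \<psi>)
  case (Suc k)
  have "partial_deriv i (\<lambda>x. \<phi> x * \<psi> x) =
      (\<lambda>x. \<phi> x * partial_deriv i \<psi> x + partial_deriv i \<phi> x * \<psi> x)" for i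
    using Suc.prems
    by (intro ext, subst partial_deriv_eqI[OF has_derivative_mult])
      (auto simp: frechet_derivative_works[symmetric] partial_deriv_def)
  moreover have "C_n k \<phi>" "C_n k \<psi>" using Suc.prems by (auto intro: C_n_Suc_imp_C_n)
  ultimately show ?case using Suc by (auto intro!: C_n_add differentiable_mult)
qed (auto intro: continuous_intros)

lemma C_n_prod: "(\<And>i. i \<in> I \<Longrightarrow> C_n k (F i)) \<Longrightarrow> C_n k (\<lambda>x. \<Prod>i\<in>I. F i x)"
  by (induction I rule: infinite_finite_induct) (auto intro: C_n_const C_n_mult)

lemma C_n_coordinate:
  assumes D: "\<And>m t. (D m has_real_derivative D (Suc m) t) (at t)"
  shows "C_n k (\<lambda>x. D m (x $ i))"
proof (induction k arbitrary: m)
  case 0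
  have "continuous_on UNIV (D m)"
    using D by (meson DERIV_isCont continuous_at_imp_continuous_on)
  then show ?case
    by (auto intro!: continuous_intros continuous_on_compose2[of UNIV "D m"])
next
  case (Suc k)
  have der: "((\<lambda>x. D m (x $ i)) has_derivative (\<lambda>v. D (Suc m) (x $ i) * v $ i)) (at x)" for x :: "real^'a"
  proof -
    have "((\<lambda>x. x $ i) has_derivative (\<lambda>v. v $ i)) (at x)"
      by (simp add: bounded_linear_imp_has_derivative bounded_linear_vec_nth)
    from DERIV_compose_FDERIV[OF D this] show ?thesis by (simp add: mult.commute)
  qed
  have "partial_deriv j (\<lambda>x. D m (x $ i)) = (\<lambda>x. D (Suc m) (x $ i) * (if i = j then 1 else 0))" for j
    by (rule ext, subst partial_deriv_eqI[OF der]) (auto simp: axis_def)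
  then show ?case using Suc der
    by (auto simp: differentiable_def intro!: C_n_mult C_n_const)
qed

text \<open>The family of flat functions \<open>poly p (1/t) exp (-1/t)\<close>, continued by zero, is closed under
  differentiation; this makes each of them smooth.\<close>

definition flat :: "real poly \<Rightarrow> real \<Rightarrow> real" where
  "flat p t = (if t > 0 then poly p (1 / t) * exp (- 1 / t) else 0)"

definition flat_step :: "real poly \<Rightarrow> real poly" where
  "flat_step p = [:0, 0, 1:] * (p - pderiv p)"

text \<open>The additional power of \<open>x\<close> is what the induction over the coefficients of \<open>p\<close> produces.\<close>

lemma poly_times_exp_minus_tendsto_0: "((\<lambda>x::real. x ^ k * poly p x * exp (- x)) \<longlongrightarrow> 0) at_top"
proof (induction p arbitrary: k)
  case (pCons a p)
  have "((\<lambda>x. a * (x ^ k / exp x) + x ^ Suc k * poly p x * exp (- x)) \<longlongrightarrow> a * 0 + 0) at_top"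
    by (intro tendsto_intros tendsto_power_div_exp_0 pCons.IH)
  then show ?case by (simp add: field_simps exp_minus)
qed simp

text \<open>Near zero \<open>flat (pCons 0 p)\<close> is the difference quotient of \<open>flat p\<close>, so this limit for all \<open>p\<close> also gives the
  derivative at zero.\<close>

lemma flat_tendsto_0: "(flat p \<longlongrightarrow> 0) (at 0)"
proof -
  have "((\<lambda>t. poly p (1 / t) * exp (- (1 / t))) \<longlongrightarrow> 0) (at_right 0)"
    using filterlim_compose[OF poly_times_exp_minus_tendsto_0[of 0 p] filterlim_inverse_at_top_right]
    by (simp add: inverse_eq_divide)
  then have "(flat p \<longlongrightarrow> 0) (at_right 0)"
    by (rule Lim_transform_eventually) (auto simp: flat_def eventually_at_right_less eventually_at intro!: exI[of _ 1])
  moreover have "(flat p \<longlongrightarrow> 0) (at_left 0)"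
    by (rule Lim_transform_eventually[OF tendsto_const]) (auto simp: flat_def eventually_at intro!: exI[of _ 1])
  ultimately show ?thesis by (simp add: filterlim_split_at)
qed

lemma flat_has_derivative: "(flat p has_real_derivative flat (flat_step p) t) (at t)"
proof (cases t "0 :: real" rule: linorder_cases)
  case less
  have "(flat p has_real_derivative 0) (at t)"
    by (rule DERIV_cong_ev[THEN iffD1, OF refl _ refl DERIV_const[of 0]])
      (use less in \<open>auto simp: flat_def eventually_nhds intro!: exI[of _ "{..<0}"]\<close>)
  then show ?thesis using less by (simp add: flat_def)
next
  case greater
  have "((\<lambda>t. poly p (1 / t) * exp (- 1 / t)) has_real_derivative
      poly p (1 / t) * (exp (- 1 / t) * (1 / t\<^sup>2)) + poly (pderiv p) (1 / t) * (- (1 / t\<^sup>2)) * exp (- 1 / t)) (at t)"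
    using greater by (auto intro!: derivative_eq_intros DERIV_chain2[OF poly_DERIV] simp: power2_eq_square field_simps)
  also have "poly p (1 / t) * (exp (- 1 / t) * (1 / t\<^sup>2)) + poly (pderiv p) (1 / t) * (- (1 / t\<^sup>2)) * exp (- 1 / t)
      = flat (flat_step p) t"
    using greater by (simp add: flat_def flat_step_def power2_eq_square field_simps)
  finally show ?thesis
    by (rule DERIV_cong_ev[THEN iffD1, OF refl _ refl, rotated])
      (use greater in \<open>auto simp: flat_def eventually_nhds intro!: exI[of _ "{0<..}"]\<close>)
next
  case equal
  have "(flat (pCons 0 p) \<longlongrightarrow> 0) (at 0)"
    by (rule flat_tendsto_0)
  then have "((\<lambda>h. flat p (0 + h) / h) \<longlongrightarrow> 0) (at 0)"
    by (rule Lim_transform_eventually) (auto simp: flat_def intro!: always_eventually)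
  then show ?thesis
    unfolding equal by (simp add: DERIV_def flat_def[of _ 0])
qed

lemma C_n_flat_affine: "C_n n (\<lambda>x. flat p (k * (x $ i - c)))"
proof -
  define D where "D m t = k ^ m * flat ((flat_step ^^ m) p) (k * (t - c))" for m t
  have "(D m has_real_derivative D (Suc m) t) (at t)" for m t
    unfolding D_def
    by (auto intro!: derivative_eq_intros DERIV_chain2[OF flat_has_derivative])
  from C_n_coordinate[of D, OF this, of n 0 i] show ?thesis by (simp add: D_def)
qed

text \<open>As \<open>k\<close> grows, these smooth functions increase to the indicator of an open box.\<close>

definition box_bump :: "real^'n::finite \<Rightarrow> real^'n \<Rightarrow> real \<Rightarrow> real^'n \<Rightarrow> real" where
  "box_bump a b k x = (\<Prod>i\<in>UNIV. flat 1 (k * (x $ i - a $ i)) * flat 1 ((- k) * (x $ i - b $ i)))"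

lemma box_bump_nonneg: "0 \<le> box_bump a b k x"
  by (auto simp: box_bump_def flat_def intro!: prod_nonneg)

lemma box_bump_le_1: "box_bump a b k x \<le> 1"
  unfolding box_bump_def by (intro prod_le_1) (auto simp: flat_def intro!: mult_le_one)

lemma box_bump_eq_0: "k > 0 \<Longrightarrow> x \<notin> box a b \<Longrightarrow> box_bump a b k x = 0"
proof -
  assume k: "k > 0" and "x \<notin> box a b"
  then obtain i where "\<not> (a $ i < x $ i \<and> x $ i < b $ i)" by (auto simp: mem_box_cart)
  then have "flat 1 (k * (x $ i - a $ i)) * flat 1 ((- k) * (x $ i - b $ i)) = 0"
    using k by (auto simp: flat_def zero_less_mult_iff mult_less_0_iff)
  then show ?thesis unfolding box_bump_def by (intro prod_zero) auto
qed

lemma box_bump_pos: "k > 0 \<Longrightarrow> x \<in> box a b \<Longrightarrow> box_bump a b k x > 0"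
  by (auto simp: box_bump_def flat_def mem_box_cart mult_pos_neg intro!: prod_pos)

lemma box_bump_tendsto_indicator:
  "(\<lambda>n. box_bump a b (real (Suc n)) x) \<longlonglongrightarrow> indicator (box a b) x"
proof (cases "x \<in> box a b")
  case True
  have flat_lim: "(\<lambda>n. flat 1 (real (Suc n) * t)) \<longlonglongrightarrow> 1" if "t > 0" for t
  proof -
    have "(\<lambda>n. exp (- ((1 / t) * inverse (real (Suc n))))) \<longlonglongrightarrow> exp (- ((1 / t) * 0))"
      by (intro tendsto_intros LIMSEQ_inverse_real_of_nat)
    moreover have "flat 1 (real (Suc n) * t) = exp (- ((1 / t) * inverse (real (Suc n))))" for n
    proof -
      have "real (Suc n) * t > 0" using that by simp
      then show ?thesis by (simp add: flat_def field_simps del: of_nat_Suc)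
    qed
    ultimately show ?thesis by simp
  qed
  have "(\<lambda>n. box_bump a b (real (Suc n)) x) \<longlonglongrightarrow> (\<Prod>i\<in>(UNIV::'a set). 1 * 1)"
    unfolding box_bump_def
  proof (intro tendsto_prod tendsto_mult)
    fix i :: 'a
    show "(\<lambda>n. flat 1 (real (Suc n) * (x $ i - a $ i))) \<longlonglongrightarrow> 1"
      using True by (intro flat_lim) (auto simp: mem_box_cart)
    show "(\<lambda>n. flat 1 (- real (Suc n) * (x $ i - b $ i))) \<longlonglongrightarrow> 1"
      using True flat_lim[of "b $ i - x $ i"] by (auto simp: mem_box_cart algebra_simps)
  qed
  then show ?thesis using True by simp
qed (simp add: box_bump_eq_0)

lemma box_bump_test_function:
  assumes "cbox a b \<subseteq> \<Omega>" "k > 0"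
  shows "box_bump a b k \<in> test_functions \<Omega>"
proof -
  have "C_n n (box_bump a b k)" for n
    unfolding box_bump_def by (intro C_n_prod C_n_mult C_n_flat_affine)
  moreover have "{x. box_bump a b k x \<noteq> 0} \<subseteq> cbox a b"
    using box_bump_eq_0[OF assms(2)] box_subset_cbox by blast
  then have "closure {x. box_bump a b k x \<noteq> 0} \<subseteq> cbox a b"
    by (rule closure_minimal) (rule closed_cbox)
  moreover from this have "compact (closure {x. box_bump a b k x \<noteq> 0})"
    by (meson bounded_cbox bounded_subset closed_closure compact_eq_bounded_closed)
  ultimately show ?thesis using assms(1) by (auto simp: test_functions_def)
qed

section \<open>Test functions\<close>

definition grad :: "(real^'n::finite \<Rightarrow> real) \<Rightarrow> real^'n \<Rightarrow> real^'n" where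
  "grad \<phi> x = (\<chi> i. partial_deriv i \<phi> x)"

lemma grad_nth [simp]: "grad \<phi> x $ i = partial_deriv i \<phi> x"
  by (simp add: grad_def)

lemma test_function_zero: "(\<lambda>x. 0) \<in> test_functions \<Omega>"
  by (simp add: test_functions_def C_n_const)

lemma test_function_add:
  assumes "\<phi> \<in> test_functions \<Omega>" "\<psi> \<in> test_functions \<Omega>"
  shows "(\<lambda>x. \<phi> x + \<psi> x) \<in> test_functions \<Omega>"
proof -
  have "closure {x. \<phi> x + \<psi> x \<noteq> 0} \<subseteq> closure ({x. \<phi> x \<noteq> 0} \<union> {x. \<psi> x \<noteq> 0})"
    by (rule closure_mono) auto
  then have sub: "closure {x. \<phi> x + \<psi> x \<noteq> 0} \<subseteq> closure {x. \<phi> x \<noteq> 0} \<union> closure {x. \<psi> x \<noteq> 0}"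
    by simp
  moreover have "compact (closure {x. \<phi> x \<noteq> 0} \<union> closure {x. \<psi> x \<noteq> 0})"
    using assms by (auto simp: test_functions_def)
  then have "compact (closure {x. \<phi> x + \<psi> x \<noteq> 0})"
    using sub by (meson bounded_subset closed_closure compact_eq_bounded_closed)
  ultimately show ?thesis using assms by (auto simp: test_functions_def C_n_add)
qed

lemma test_function_mult:
  assumes "\<phi> \<in> test_functions \<Omega>" "\<And>k. C_n k c"
  shows "(\<lambda>x. c x * \<phi> x) \<in> test_functions \<Omega>"
proof -
  have sub: "closure {x. c x * \<phi> x \<noteq> 0} \<subseteq> closure {x. \<phi> x \<noteq> 0}"
    by (rule closure_mono) auto
  then have "compact (closure {x. c x * \<phi> x \<noteq> 0})"
    using assms by (metis (mono_tags, lifting) bounded_subset closed_closure compact_eq_bounded_closed mem_Collect_eq test_functions_def)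
  with sub show ?thesis using assms by (auto simp: test_functions_def C_n_mult C_n_const)
qed

lemma test_function_cmult: "\<phi> \<in> test_functions \<Omega> \<Longrightarrow> (\<lambda>x. c * \<phi> x) \<in> test_functions \<Omega>"
  by (rule test_function_mult) (auto intro: C_n_const)

lemma test_function_diff:
  "\<phi> \<in> test_functions \<Omega> \<Longrightarrow> \<psi> \<in> test_functions \<Omega> \<Longrightarrow> (\<lambda>x. \<phi> x - \<psi> x) \<in> test_functions \<Omega>"
  using test_function_add[OF _ test_function_cmult[of \<psi> \<Omega> "-1"]] by simp

context
  fixes \<phi> :: "real^'n::finite \<Rightarrow> real" and \<Omega>
  assumes test: "\<phi> \<in> test_functions \<Omega>"
begin

lemma test_function_C_n: "C_n k \<phi>"
  using test by (simp add: test_functions_def)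

lemma test_function_has_derivative: "(\<phi> has_derivative (\<lambda>v. grad \<phi> x \<bullet> v)) (at x)"
proof -
  have "\<phi> differentiable (at x)" using test_function_C_n[of 1] by simp
  then obtain D where D: "(\<phi> has_derivative D) (at x)" by (auto simp: differentiable_def)
  interpret D: bounded_linear D using D by (rule has_derivative_bounded_linear)
  have "D v = grad \<phi> x \<bullet> v" for v
  proof -
    have "D v = D (\<Sum>i\<in>UNIV. v $ i *\<^sub>R axis i 1)"
      by (simp add: basis_expansion[where 'a = real, unfolded scalar_mult_eq_scaleR])
    also have "\<dots> = (\<Sum>i\<in>UNIV. v $ i * partial_deriv i \<phi> x)"
      by (simp add: D.sum D.scaleR partial_deriv_eqI[OF D])
    finally show ?thesis by (simp add: inner_vec_def mult.commute)
  qed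
  then have "D = (\<lambda>v. grad \<phi> x \<bullet> v)" by auto
  then show ?thesis using D by simp
qed

lemma test_function_continuous: "continuous_on A \<phi>"
  using C_n_imp_continuous_on[OF test_function_C_n] continuous_on_subset by blast

lemma partial_deriv_C_n: "C_n k (partial_deriv i \<phi>)"
  using test_function_C_n[of "Suc k"] by simp

lemma grad_continuous: "continuous_on A (grad \<phi>)"
  using C_n_imp_continuous_on[OF partial_deriv_C_n] unfolding grad_def
  by (intro continuous_on_vec_lambda) (metis continuous_on_subset subset_UNIV)

lemma test_function_eq_0: "x \<notin> \<Omega> \<Longrightarrow> \<phi> x = 0"
  using test closure_subset[of "{x. \<phi> x \<noteq> 0}"] by (auto simp: test_functions_def)

lemma grad_eq_0_outside_support: "x \<notin> closure {x. \<phi> x \<noteq> 0} \<Longrightarrow> grad \<phi> x = 0"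
proof -
  assume x: "x \<notin> closure {x. \<phi> x \<noteq> 0}"
  have "(\<phi> has_derivative (\<lambda>_. 0)) (at x)"
  proof (rule has_derivative_transform_within_open[where f = "\<lambda>_. 0"])
    show "x \<in> - closure {x. \<phi> x \<noteq> 0}" using x by simp
  qed (use closure_subset[of "{x. \<phi> x \<noteq> 0}"] in auto)
  then show ?thesis
    by (simp add: vec_eq_iff partial_deriv_eqI)
qed

lemma grad_eq_0: "x \<notin> \<Omega> \<Longrightarrow> grad \<phi> x = 0"
  using test grad_eq_0_outside_support by (auto simp: test_functions_def)

lemma test_function_compact_support: "compact (closure {x. \<phi> x \<noteq> 0})"
  using test by (simp add: test_functions_def)

lemma test_function_eq_0_outside_support: "x \<notin> closure {x. \<phi> x \<noteq> 0} \<Longrightarrow> \<phi> x = 0"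
  using closure_subset[of "{x. \<phi> x \<noteq> 0}"] by auto

lemma test_function_bounded: "\<exists>B\<ge>0. \<forall>x. \<bar>\<phi> x\<bar> \<le> B"
proof -
  have "bounded (\<phi> ` closure {x. \<phi> x \<noteq> 0})"
    using compact_continuous_image[OF test_function_continuous test_function_compact_support] compact_imp_bounded by blast
  then obtain B where B: "\<And>x. x \<in> closure {x. \<phi> x \<noteq> 0} \<Longrightarrow> norm (\<phi> x) \<le> B" and "B > 0"
    by (auto simp: bounded_pos)
  then show ?thesis using test_function_eq_0_outside_support
    by (intro exI[of _ B]) (metis abs_0 less_imp_le real_norm_def)
qed

lemma grad_bounded: "\<exists>B\<ge>0. \<forall>x. norm (grad \<phi> x) \<le> B"
proof -
  have "bounded (grad \<phi> ` closure {x. \<phi> x \<noteq> 0})"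
    using compact_continuous_image[OF grad_continuous test_function_compact_support] compact_imp_bounded by blast
  then obtain B where B: "\<And>x. x \<in> closure {x. \<phi> x \<noteq> 0} \<Longrightarrow> norm (grad \<phi> x) \<le> B" and "B > 0"
    by (auto simp: bounded_pos)
  then show ?thesis using grad_eq_0_outside_support
    by (intro exI[of _ B]) (metis norm_zero less_imp_le)
qed

end

lemma partial_deriv_add:
  assumes "\<phi> \<in> test_functions \<Omega>" "\<psi> \<in> test_functions \<Omega>"
  shows "partial_deriv i (\<lambda>x. \<phi> x + \<psi> x) x = partial_deriv i \<phi> x + partial_deriv i \<psi> x"
  using partial_deriv_eqI[OF has_derivative_add[OF assms[THEN test_function_has_derivative]]]
  by (simp add: inner_axis)

lemma partial_deriv_mult:
  assumes "\<phi> \<in> test_functions \<Omega>" "\<psi> \<in> test_functions \<Omega>"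
  shows "partial_deriv i (\<lambda>x. \<phi> x * \<psi> x) x = \<phi> x * partial_deriv i \<psi> x + partial_deriv i \<phi> x * \<psi> x"
  using partial_deriv_eqI[OF has_derivative_mult[OF assms[THEN test_function_has_derivative]]]
  by (simp add: inner_axis)

lemma partial_deriv_cmult:
  assumes "\<phi> \<in> test_functions \<Omega>"
  shows "partial_deriv i (\<lambda>x. c * \<phi> x) x = c * partial_deriv i \<phi> x"
  using partial_deriv_eqI[OF has_derivative_mult_right[OF test_function_has_derivative[OF assms]]]
  by (simp add: inner_axis)

lemma grad_add:
  "\<phi> \<in> test_functions \<Omega> \<Longrightarrow> \<psi> \<in> test_functions \<Omega> \<Longrightarrow> grad (\<lambda>x. \<phi> x + \<psi> x) = (\<lambda>x. grad \<phi> x + grad \<psi> x)"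
  by (auto simp: fun_eq_iff vec_eq_iff partial_deriv_add)

lemma grad_cmult: "\<phi> \<in> test_functions \<Omega> \<Longrightarrow> grad (\<lambda>x. c * \<phi> x) = (\<lambda>x. c *\<^sub>R grad \<phi> x)"
  by (auto simp: fun_eq_iff vec_eq_iff partial_deriv_cmult)

section \<open>Integrals of test functions\<close>

lemma integrable_compact_support:
  fixes f :: "'a::euclidean_space \<Rightarrow> 'b::euclidean_space"
  assumes "continuous_on UNIV f" "compact K" "\<And>x. x \<notin> K \<Longrightarrow> f x = 0"
  shows "integrable lborel f"
proof -
  have "integrable lborel (\<lambda>x. indicator K x *\<^sub>R f x)"
    using assms(1,2) by (intro borel_integrable_compact) (auto intro: continuous_on_subset)
  also have "(\<lambda>x. indicator K x *\<^sub>R f x) = f" using assms(3) by (auto simp: indicator_def fun_eq_iff)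
  finally show ?thesis .
qed

lemma test_function_integrable:
  fixes f :: "real^'n::finite \<Rightarrow> 'b::euclidean_space"
  assumes "\<phi> \<in> test_functions \<Omega>" "continuous_on UNIV f" "\<And>x. \<phi> x = 0 \<Longrightarrow> grad \<phi> x = 0 \<Longrightarrow> f x = 0"
  shows "integrable lborel f"
  using assms(2)
proof (rule integrable_compact_support)
  show "compact (closure {x. \<phi> x \<noteq> 0})" using assms(1) by (rule test_function_compact_support)
  show "f x = 0" if "x \<notin> closure {x. \<phi> x \<noteq> 0}" for x
    by (rule assms(3)[OF test_function_eq_0_outside_support[OF assms(1) that] grad_eq_0_outside_support[OF assms(1) that]])
qed

lemma integral_shift:
  fixes f :: "'a::euclidean_space \<Rightarrow> 'b::{banach, second_countable_topology}"
  assumes [measurable]: "f \<in> borel_measurable borel"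
  shows "(\<integral>x. f (x + z) \<partial>lborel) = (\<integral>x. f x \<partial>lborel)"
proof -
  have "(\<integral>x. f x \<partial>lborel) = (\<integral>x. f x \<partial>distr lborel borel ((+) z))" by (simp add: lborel_distr_plus)
  also have "\<dots> = (\<integral>x. f (z + x) \<partial>lborel)" by (intro integral_distr) auto
  finally show ?thesis by (simp add: add.commute)
qed

lemma integrable_shift:
  fixes f :: "'a::euclidean_space \<Rightarrow> 'b::{banach, second_countable_topology}"
  assumes [measurable]: "f \<in> borel_measurable borel" and "integrable lborel f"
  shows "integrable lborel (\<lambda>x. f (x + z))"
proof -
  have "integrable (distr lborel borel ((+) z)) f" using assms by (simp add: lborel_distr_plus)
  then have "integrable lborel (\<lambda>x. f (z + x))" by (subst (asm) integrable_distr_eq) auto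
  then show ?thesis by (simp add: add.commute)
qed

lemma test_function_lipschitz:
  assumes "\<phi> \<in> test_functions \<Omega>" "\<And>x. norm (grad \<phi> x) \<le> B"
  shows "\<bar>\<phi> x - \<phi> y\<bar> \<le> B * norm (x - y)"
proof -
  have "norm (\<phi> x - \<phi> y) \<le> B * norm (x - y)"
  proof (rule differentiable_bound[of UNIV \<phi> "\<lambda>x v. grad \<phi> x \<bullet> v"])
    fix u
    have "norm (grad \<phi> u \<bullet> v) \<le> B * norm v" for v
      using Cauchy_Schwarz_ineq2[of "grad \<phi> u" v] mult_right_mono[OF assms(2)[of u] norm_ge_zero[of v]] by simp
    then show "onorm (\<lambda>v. grad \<phi> u \<bullet> v) \<le> B"
      using order_trans[OF norm_ge_zero assms(2)] by (intro onorm_bound) auto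
  qed (auto intro: test_function_has_derivative[OF assms(1)])
  then show ?thesis by simp
qed

definition diff_quot :: "(real^'n::finite \<Rightarrow> real) \<Rightarrow> real^'n \<Rightarrow> nat \<Rightarrow> real^'n \<Rightarrow> real" where
  "diff_quot \<phi> z m x = real (Suc m) * (\<phi> (x + (1 / real (Suc m)) *\<^sub>R z) - \<phi> x)"

lemma diff_quot_tendsto:
  assumes "\<phi> \<in> test_functions \<Omega>"
  shows "(\<lambda>m. diff_quot \<phi> z m x) \<longlonglongrightarrow> grad \<phi> x \<bullet> z"
proof -
  have "((\<lambda>t. x + t *\<^sub>R z) has_derivative (\<lambda>t. t *\<^sub>R z)) (at 0)"
    by (auto intro!: derivative_eq_intros)
  from has_derivative_compose[OF this, of \<phi> "\<lambda>v. grad \<phi> x \<bullet> v"] 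
  have "((\<lambda>t. \<phi> (x + t *\<^sub>R z)) has_derivative (\<lambda>t. grad \<phi> x \<bullet> (t *\<^sub>R z))) (at 0)"
    using test_function_has_derivative[OF assms] by simp
  then have "((\<lambda>t. \<phi> (x + t *\<^sub>R z)) has_real_derivative (grad \<phi> x \<bullet> z)) (at 0)"
    by (rule has_derivative_imp_has_field_derivative) simp
  then have lim: "((\<lambda>h. (\<phi> (x + h *\<^sub>R z) - \<phi> x) / h) \<longlongrightarrow> grad \<phi> x \<bullet> z) (at 0)"
    by (simp add: DERIV_def)
  have "filterlim (\<lambda>m. 1 / real (Suc m)) (at 0) sequentially"
    using LIMSEQ_inverse_real_of_nat by (auto simp: filterlim_at inverse_eq_divide)
  from filterlim_compose[OF lim this] show ?thesis
    by (simp add: diff_quot_def mult.commute del: of_nat_Suc)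
qed

text \<open>A test function is Lipschitz continuous with compact support and the steps have length at most \<open>\<bar>z\<bar>\<close>, so one
  multiple of the indicator of a ball dominates all difference quotients.\<close>

lemma diff_quot_dominated:
  fixes \<phi> :: "real^'n::finite \<Rightarrow> real"
  assumes "\<phi> \<in> test_functions \<Omega>"
  obtains w where "integrable lborel w" "integrable lborel (\<lambda>x. (w x)\<^sup>2)" "\<And>m x. \<bar>diff_quot \<phi> z m x\<bar> \<le> w x"
proof -
  obtain B where B: "B \<ge> 0" "\<And>x. norm (grad \<phi> x) \<le> B" using grad_bounded[OF assms] by auto
  obtain R where R: "\<And>x. x \<in> closure {x. \<phi> x \<noteq> 0} \<Longrightarrow> norm x \<le> R"
    using compact_imp_bounded[OF test_function_compact_support[OF assms]] by (auto simp: bounded_iff)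
  have out: "\<phi> x = 0" if "norm x > R" for x
    using R[of x] that test_function_eq_0_outside_support[OF assms, of x] by fastforce
  define w where "w x = indicator (cball 0 (R + norm z)) x * (B * norm z)" for x :: "real^'n"
  have fin: "emeasure lborel (cball (0::real^'n) (R + norm z)) < \<infinity>" by (rule emeasure_lborel_cball_finite)
  show thesis
  proof (rule that[of w])
    show "integrable lborel w" unfolding w_def
      using fin by (auto intro!: integrable_mult_left integrable_real_indicator)
    have "(\<lambda>x. (w x)\<^sup>2) = (\<lambda>x. indicator (cball 0 (R + norm z)) x * (B * norm z)\<^sup>2)"
      by (auto simp: w_def indicator_def)
    then show "integrable lborel (\<lambda>x. (w x)\<^sup>2)"
      using fin by (auto intro!: integrable_mult_left integrable_real_indicator)
    fix m x
    have small: "norm ((1 / real (Suc m)) *\<^sub>R z) \<le> norm z"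
      by (simp add: divide_le_eq mult_left_le_one_le mult_le_cancel_left1 del: of_nat_Suc)
    show "\<bar>diff_quot \<phi> z m x\<bar> \<le> w x"
    proof (cases "norm x \<le> R + norm z")
      case True
      have "\<bar>\<phi> (x + (1 / real (Suc m)) *\<^sub>R z) - \<phi> x\<bar> \<le> B * norm ((1 / real (Suc m)) *\<^sub>R z)"
        using test_function_lipschitz[OF assms B(2), of "x + (1 / real (Suc m)) *\<^sub>R z" x] by simp
      then have "real (Suc m) * \<bar>\<phi> (x + (1 / real (Suc m)) *\<^sub>R z) - \<phi> x\<bar> \<le> B * norm z"
        by (simp add: field_simps del: of_nat_Suc)
      then show ?thesis using True by (simp add: w_def diff_quot_def abs_mult del: of_nat_Suc)
    next
      case False
      have "norm x \<le> norm (x + (1 / real (Suc m)) *\<^sub>R z) + norm ((1 / real (Suc m)) *\<^sub>R z)"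
        using norm_triangle_ineq4[of "x + (1 / real (Suc m)) *\<^sub>R z" "(1 / real (Suc m)) *\<^sub>R z"] by simp
      then have "norm (x + (1 / real (Suc m)) *\<^sub>R z) > R" "norm x > R"
        using False small norm_ge_zero[of z] by linarith+
      then show ?thesis using out[of x] out[of "x + (1 / real (Suc m)) *\<^sub>R z"] B(1)
        by (simp add: diff_quot_def w_def)
    qed
  qed
qed

lemma test_function_borel: "\<phi> \<in> test_functions \<Omega> \<Longrightarrow> \<phi> \<in> borel_measurable borel"
  by (intro borel_measurable_continuous_onI test_function_continuous)

lemma grad_borel: "\<phi> \<in> test_functions \<Omega> \<Longrightarrow> grad \<phi> \<in> borel_measurable borel"
  by (intro borel_measurable_continuous_onI grad_continuous)

lemma diff_quot_borel: "\<phi> \<in> test_functions \<Omega> \<Longrightarrow> diff_quot \<phi> z m \<in> borel_measurable borel"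
  unfolding diff_quot_def
  by (intro borel_measurable_continuous_onI continuous_intros
      continuous_on_compose2[OF test_function_continuous[of _ _ UNIV]]) auto

text \<open>The difference quotients have integral zero by translation invariance.\<close>

lemma integral_grad_eq_0:
  assumes "\<phi> \<in> test_functions \<Omega>"
  shows "(\<integral>x. grad \<phi> x \<bullet> z \<partial>lborel) = 0"
proof -
  note [measurable] = diff_quot_borel[OF assms] grad_borel[OF assms] test_function_borel[OF assms]
  obtain w where w: "integrable lborel w" "\<And>m x. \<bar>diff_quot \<phi> z m x\<bar> \<le> w x"
    using diff_quot_dominated[OF assms] by blast
  have "(\<lambda>m. \<integral>x. diff_quot \<phi> z m x \<partial>lborel) \<longlonglongrightarrow> (\<integral>x. grad \<phi> x \<bullet> z \<partial>lborel)"
    using w diff_quot_tendsto[OF assms]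
    by (intro integral_dominated_convergence[where w = w]) auto
  moreover have "(\<integral>x. diff_quot \<phi> z m x \<partial>lborel) = 0" for m
  proof -
    have "integrable lborel \<phi>" by (rule test_function_integrable[OF assms test_function_continuous[OF assms]])
    then show ?thesis
      unfolding diff_quot_def
      by (simp add: integral_shift integrable_shift Bochner_Integration.integral_diff del: of_nat_Suc)
  qed
  ultimately show ?thesis by (simp add: LIMSEQ_const_iff)
qed

section \<open>Translations, averages, and the inequalities of Poincare, Rellich and Sobolev\<close>

text \<open>Moving along \<open>z\<close> in \<open>m\<close> equal steps and letting \<open>m\<close> grow replaces the fundamental theorem of
  calculus: the steps all have the same norm by translation invariance.\<close>

lemma translation_estimate:
  assumes "\<phi> \<in> test_functions \<Omega>"
  shows "(\<integral>x. (\<phi> (x + z) - \<phi> x)\<^sup>2 \<partial>lborel) \<le> (norm z)\<^sup>2 * (\<integral>x. (norm (grad \<phi> x))\<^sup>2 \<partial>lborel)"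
proof -
  note [measurable] = diff_quot_borel[OF assms] grad_borel[OF assms] test_function_borel[OF assms]
  obtain w where w: "integrable lborel (\<lambda>x. (w x)\<^sup>2)" "\<And>m x. \<bar>diff_quot \<phi> z m x\<bar> \<le> w x"
    using diff_quot_dominated[OF assms] by blast
  have w': "(diff_quot \<phi> z m x)\<^sup>2 \<le> (w x)\<^sup>2" for m x
    using w(2)[of m x] by (simp add: abs_le_square_iff[symmetric])
  have sq_int: "integrable lborel (\<lambda>x. (diff_quot \<phi> z m x)\<^sup>2)" for m
    by (rule Bochner_Integration.integrable_bound[OF w(1)]) (use w' in auto)
  have lim: "(\<lambda>m. \<integral>x. (diff_quot \<phi> z m x)\<^sup>2 \<partial>lborel) \<longlonglongrightarrow> (\<integral>x. (grad \<phi> x \<bullet> z)\<^sup>2 \<partial>lborel)"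
    by (intro integral_dominated_convergence[where w = "\<lambda>x. (w x)\<^sup>2"])
      (use w' w(1) in \<open>auto intro!: tendsto_power diff_quot_tendsto[OF assms]\<close>)
  have step: "(\<integral>x. (\<phi> (x + z) - \<phi> x)\<^sup>2 \<partial>lborel) \<le> (\<integral>x. (diff_quot \<phi> z m x)\<^sup>2 \<partial>lborel)" for m
  proof -
    define h where "h = (1 / real (Suc m)) *\<^sub>R z"
    have qh: "diff_quot \<phi> z m x = real (Suc m) * (\<phi> (x + h) - \<phi> x)" for x
      by (simp add: diff_quot_def h_def)
    have "(\<phi> (x + z) - \<phi> x)\<^sup>2 \<le> (\<Sum>j<Suc m. (diff_quot \<phi> z m (x + real j *\<^sub>R h))\<^sup>2) / real (Suc m)" for x
    proof -
      have "\<phi> (x + z) - \<phi> x = (\<Sum>j<Suc m. \<phi> (x + real (Suc j) *\<^sub>R h) - \<phi> (x + real j *\<^sub>R h))"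
        by (subst sum_lessThan_telescope) (simp add: h_def del: of_nat_Suc)
      also have "\<dots> = (\<Sum>j<Suc m. diff_quot \<phi> z m (x + real j *\<^sub>R h)) / real (Suc m)"
        unfolding sum_divide_distrib
      proof (intro sum.cong refl)
        fix j
        have "x + real (Suc j) *\<^sub>R h = x + real j *\<^sub>R h + h" by (simp add: algebra_simps)
        then show "\<phi> (x + real (Suc j) *\<^sub>R h) - \<phi> (x + real j *\<^sub>R h)
            = diff_quot \<phi> z m (x + real j *\<^sub>R h) / real (Suc m)"
          unfolding qh by (simp add: add.assoc del: of_nat_Suc)
      qed
      finally have eq: "\<phi> (x + z) - \<phi> x = (\<Sum>j<Suc m. diff_quot \<phi> z m (x + real j *\<^sub>R h)) / real (Suc m)" .
      have "(\<Sum>j<Suc m. diff_quot \<phi> z m (x + real j *\<^sub>R h))\<^sup>2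
          \<le> (\<Sum>j<Suc m. (diff_quot \<phi> z m (x + real j *\<^sub>R h))\<^sup>2) * real (card {..<Suc m})"
        by (rule sum_squared_le_sum_of_squares) 
      then show ?thesis
        unfolding eq by (simp add: power_divide power2_eq_square[of "real (Suc m)"] field_simps del: of_nat_Suc sum.lessThan_Suc)
    qed
    then have "(\<integral>x. (\<phi> (x + z) - \<phi> x)\<^sup>2 \<partial>lborel)
        \<le> (\<integral>x. (\<Sum>j<Suc m. (diff_quot \<phi> z m (x + real j *\<^sub>R h))\<^sup>2) / real (Suc m) \<partial>lborel)"
      by (intro integral_mono_AE' Bochner_Integration.integrable_divide Bochner_Integration.integrable_sum
          integrable_shift[where f = "\<lambda>x. (diff_quot \<phi> z m x)\<^sup>2"] sq_int)
        (auto simp del: sum.lessThan_Suc intro!: AE_I2 divide_nonneg_nonneg sum_nonneg)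
    also have "\<dots> = (\<Sum>j<Suc m. (\<integral>x. (diff_quot \<phi> z m (x + real j *\<^sub>R h))\<^sup>2 \<partial>lborel)) / real (Suc m)"
      by (simp add: Bochner_Integration.integral_sum integrable_shift[where f = "\<lambda>x. (diff_quot \<phi> z m x)\<^sup>2"]
          sq_int del: sum.lessThan_Suc of_nat_Suc)
    also have "\<dots> = (\<integral>x. (diff_quot \<phi> z m x)\<^sup>2 \<partial>lborel)"
      by (subst integral_shift[where f = "\<lambda>x. (diff_quot \<phi> z m x)\<^sup>2"]) (auto simp del: of_nat_Suc)
    finally show ?thesis .
  qed
  have "(\<integral>x. (\<phi> (x + z) - \<phi> x)\<^sup>2 \<partial>lborel) \<le> (\<integral>x. (grad \<phi> x \<bullet> z)\<^sup>2 \<partial>lborel)"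
    by (rule LIMSEQ_le_const[OF lim]) (use step in auto)
  also have "\<dots> \<le> (\<integral>x. (norm z)\<^sup>2 * (norm (grad \<phi> x))\<^sup>2 \<partial>lborel)"
  proof (rule integral_mono)
    show "integrable lborel (\<lambda>x. (grad \<phi> x \<bullet> z)\<^sup>2)"
      by (rule test_function_integrable[OF assms]) (auto intro!: continuous_intros grad_continuous[OF assms])
    show "integrable lborel (\<lambda>x. (norm z)\<^sup>2 * (norm (grad \<phi> x))\<^sup>2)"
      by (rule test_function_integrable[OF assms]) (auto intro!: continuous_intros grad_continuous[OF assms])
    show "(grad \<phi> x \<bullet> z)\<^sup>2 \<le> (norm z)\<^sup>2 * (norm (grad \<phi> x))\<^sup>2" for x
      using Cauchy_Schwarz_ineq[of "grad \<phi> x" z] by (simp add: power2_norm_eq_inner mult.commute)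
  qed
  finally show ?thesis by simp
qed

lemma Cauchy_Schwarz_integral:
  fixes f g :: "'a \<Rightarrow> real"
  assumes [measurable]: "f \<in> borel_measurable M" "g \<in> borel_measurable M"
    and f: "integrable M (\<lambda>x. (f x)\<^sup>2)" and g: "integrable M (\<lambda>x. (g x)\<^sup>2)"
  shows "integrable M (\<lambda>x. f x * g x)"
    and "(\<integral>x. f x * g x \<partial>M)\<^sup>2 \<le> (\<integral>x. (f x)\<^sup>2 \<partial>M) * (\<integral>x. (g x)\<^sup>2 \<partial>M)"
proof -
  show fg: "integrable M (\<lambda>x. f x * g x)"
  proof (rule Bochner_Integration.integrable_bound[OF Bochner_Integration.integrable_add[OF f g]])
    have "\<bar>a * b\<bar> \<le> a\<^sup>2 + b\<^sup>2" for a b :: real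
    proof -
      have "2 * (\<bar>a\<bar> * \<bar>b\<bar>) \<le> a\<^sup>2 + b\<^sup>2" using sum_squares_bound[of "\<bar>a\<bar>" "\<bar>b\<bar>"] by (simp add: mult.assoc)
      moreover have "0 \<le> \<bar>a\<bar> * \<bar>b\<bar>" by simp
      ultimately show ?thesis unfolding abs_mult by linarith
    qed
    then show "AE x in M. norm (f x * g x) \<le> norm ((f x)\<^sup>2 + (g x)\<^sup>2)" by simp
  qed simp
  let ?A = "\<integral>x. (f x)\<^sup>2 \<partial>M" and ?B = "\<integral>x. (g x)\<^sup>2 \<partial>M" and ?C = "\<integral>x. f x * g x \<partial>M"
  have quad: "0 \<le> ?A - 2 * t * ?C + t\<^sup>2 * ?B" for t
  proof -
    have "0 \<le> (\<integral>x. (f x - t * g x)\<^sup>2 \<partial>M)" by simp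
    also have "(\<lambda>x. (f x - t * g x)\<^sup>2) = (\<lambda>x. (f x)\<^sup>2 - 2 * t * (f x * g x) + t\<^sup>2 * (g x)\<^sup>2)"
      by (auto simp: power2_eq_square algebra_simps)
    finally show ?thesis using f g fg by simp
  qed
  show "?C\<^sup>2 \<le> ?A * ?B"
  proof (cases "?B = 0")
    case True
    then have "AE x in M. (g x)\<^sup>2 = 0" using g by (subst (asm) integral_nonneg_eq_0_iff_AE) auto
    then have "?C = 0" by (intro integral_eq_zero_AE) auto
    then show ?thesis using True by simp
  next
    case False
    then have "?B > 0" using integral_nonneg_AE[of "\<lambda>x. (g x)\<^sup>2" M] by (simp add: order_less_le)
    then show ?thesis using quad[of "?C / ?B"] by (simp add: field_simps power2_eq_square)
  qed
qed

definition dirichlet :: "(real^'n::finite \<Rightarrow> real) \<Rightarrow> real" where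
  "dirichlet \<phi> = (\<integral>x. (norm (grad \<phi> x))\<^sup>2 \<partial>lborel)"

lemma dirichlet_nonneg: "dirichlet \<phi> \<ge> 0"
  by (simp add: dirichlet_def)

lemma test_function_sq_integrable: "\<phi> \<in> test_functions \<Omega> \<Longrightarrow> integrable lborel (\<lambda>x. (\<phi> x)\<^sup>2)"
  using test_function_continuous[of \<phi> \<Omega> UNIV]
  by (intro test_function_integrable[of \<phi> \<Omega>]) (auto intro!: continuous_intros)

text \<open>A translation by more than the diameter of the domain makes \<open>\<phi>\<close> and its translate orthogonal, so
  the translation estimate bounds \<open>\<phi>\<close> itself.\<close>

lemma poincare_test_function:
  fixes \<Omega> :: "(real^'n::finite) set"
  assumes "bounded \<Omega>"
  shows "\<exists>K>0. \<forall>\<phi>\<in>test_functions \<Omega>. (\<integral>x. (\<phi> x)\<^sup>2 \<partial>lborel) \<le> K * dirichlet \<phi>"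
proof -
  obtain R where R: "R > 0" "\<And>x. x \<in> \<Omega> \<Longrightarrow> norm x \<le> R" using assms by (auto simp: bounded_pos)
  define z :: "real^'n" where "z = (3 * R) *\<^sub>R axis (SOME i. True) 1"
  have nz: "norm z = 3 * R" using R(1) by (simp add: z_def)
  have "(\<integral>x. (\<phi> x)\<^sup>2 \<partial>lborel) \<le> (3 * R)\<^sup>2 * dirichlet \<phi>" if \<phi>: "\<phi> \<in> test_functions \<Omega>" for \<phi>
  proof -
    note [measurable] = test_function_borel[OF \<phi>]
    have orth: "(\<phi> (x + z) - \<phi> x)\<^sup>2 = (\<phi> (x + z))\<^sup>2 + (\<phi> x)\<^sup>2" for x
    proof -
      have "\<phi> x = 0 \<or> \<phi> (x + z) = 0"
      proof (rule ccontr)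
        assume "\<not> ?thesis"
        then have "x \<in> \<Omega>" "x + z \<in> \<Omega>" using test_function_eq_0[OF \<phi>] by auto
        then have "norm x \<le> R" "norm (x + z) \<le> R" using R by auto
        moreover have "norm z \<le> norm (x + z) + norm x" using norm_triangle_ineq4[of "x + z" x] by simp
        ultimately show False using nz R(1) by simp
      qed
      then show ?thesis by auto
    qed
    note sq = test_function_sq_integrable[OF \<phi>]
    have "(\<integral>x. (\<phi> x)\<^sup>2 \<partial>lborel) \<le> (\<integral>x. (\<phi> (x + z))\<^sup>2 \<partial>lborel) + (\<integral>x. (\<phi> x)\<^sup>2 \<partial>lborel)" by simp
    also have "\<dots> = (\<integral>x. (\<phi> (x + z) - \<phi> x)\<^sup>2 \<partial>lborel)"
      unfolding orth using sq by (subst Bochner_Integration.integral_add) (auto intro: integrable_shift[where f = "\<lambda>x. (\<phi> x)\<^sup>2"])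
    also have "\<dots> \<le> (norm z)\<^sup>2 * dirichlet \<phi>"
      unfolding dirichlet_def by (rule translation_estimate[OF \<phi>])
    finally show ?thesis by (simp add: nz)
  qed
  then show ?thesis using R(1) by (intro exI[of _ "(3 * R)\<^sup>2"]) auto
qed

definition ball_avg :: "real \<Rightarrow> (real^'n::finite \<Rightarrow> real) \<Rightarrow> real^'n \<Rightarrow> real" where
  "ball_avg r \<phi> x = (\<integral>y. \<phi> (x + y) * indicator (ball 0 r) y \<partial>lborel) / measure lborel (ball (0::real^'n) r)"

lemma test_function_ball_integrable:
  assumes \<phi>: "\<phi> \<in> test_functions \<Omega>"
  shows "integrable lborel (\<lambda>y. \<phi> (x + y) * indicator (ball 0 r) y)"
proof -
  have "integrable lborel (\<lambda>y. indicator (ball 0 r) y *\<^sub>R \<phi> (y + x))"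
    by (intro integrable_mult_indicator integrable_shift)
      (auto intro!: test_function_integrable[OF \<phi>] test_function_continuous[OF \<phi>] test_function_borel[OF \<phi>])
  then show ?thesis by (simp add: mult.commute add.commute)
qed

lemma measure_ball_pos: "r > 0 \<Longrightarrow> measure lborel (ball (0::'a::euclidean_space) r) > 0"
  by simp

lemma sq_integrable_shift_test:
  assumes "\<phi> \<in> test_functions \<Omega>"
  shows "integrable lborel (\<lambda>x. (\<phi> (x + z))\<^sup>2)"
    and "integrable lborel (\<lambda>x. (\<phi> (x + z) - \<phi> x)\<^sup>2)"
    and "integrable lborel (\<lambda>x. (\<phi> (y + x) - \<phi> (z + x))\<^sup>2)"
proof -
  note [measurable] = test_function_borel[OF assms]
  note sq = test_function_sq_integrable[OF assms]
  have sh: "integrable lborel (\<lambda>x. (\<phi> (x + z))\<^sup>2)" for z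
    using sq by (intro integrable_shift[where f = "\<lambda>x. (\<phi> x)\<^sup>2"]) auto
  have diff: "integrable lborel (\<lambda>x. (\<phi> (x + y) - \<phi> (x + z))\<^sup>2)" for y z
  proof (rule Bochner_Integration.integrable_bound)
    show "integrable lborel (\<lambda>x. 2 * (\<phi> (x + y))\<^sup>2 + 2 * (\<phi> (x + z))\<^sup>2)" using sh by auto
    have "(a - b)\<^sup>2 \<le> 2 * a\<^sup>2 + 2 * b\<^sup>2" for a b :: real
      using sum_squares_bound[of a "- b"] by (simp add: power2_diff)
    then show "AE x in lborel. norm ((\<phi> (x + y) - \<phi> (x + z))\<^sup>2) \<le> norm (2 * (\<phi> (x + y))\<^sup>2 + 2 * (\<phi> (x + z))\<^sup>2)"
      by simp
  qed simp
  show "integrable lborel (\<lambda>x. (\<phi> (x + z))\<^sup>2)" by (rule sh)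
  show "integrable lborel (\<lambda>x. (\<phi> (x + z) - \<phi> x)\<^sup>2)" using diff[of z 0] by simp
  show "integrable lborel (\<lambda>x. (\<phi> (y + x) - \<phi> (z + x))\<^sup>2)" using diff[of y z] by (simp add: add.commute)
qed

text \<open>Cauchy--Schwarz against the indicator of the ball.\<close>

lemma ball_average_sq_le:
  fixes f :: "'a::euclidean_space \<Rightarrow> real"
  assumes [measurable]: "f \<in> borel_measurable borel" and f: "integrable lborel (\<lambda>y. (f y)\<^sup>2)" and r: "r > 0"
  shows "((\<integral>y. f y * indicator (ball 0 r) y \<partial>lborel) / measure lborel (ball (0::'a) r))\<^sup>2
    \<le> (\<integral>y. (f y)\<^sup>2 * indicator (ball 0 r) y \<partial>lborel) / measure lborel (ball (0::'a) r)"
proof -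
  have [measurable]: "ball (0::'a) r \<in> sets borel" by simp
  let ?I = "indicator (ball 0 r) :: 'a \<Rightarrow> real" and ?c = "measure lborel (ball (0::'a) r)"
  have c: "?c > 0" using r by (rule measure_ball_pos)
  have fin: "emeasure lborel (ball (0::'a) r) < \<infinity>" by (rule emeasure_lborel_ball_finite)
  have I2: "(\<lambda>y. (?I y)\<^sup>2) = ?I" by (auto simp: indicator_def)
  have If: "(\<lambda>y. (f y * ?I y)\<^sup>2) = (\<lambda>y. (f y)\<^sup>2 * ?I y)" by (auto simp: indicator_def)
  have "(\<integral>y. (f y * ?I y) * ?I y \<partial>lborel)\<^sup>2 \<le> (\<integral>y. (f y * ?I y)\<^sup>2 \<partial>lborel) * (\<integral>y. (?I y)\<^sup>2 \<partial>lborel)"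
  proof (rule Cauchy_Schwarz_integral(2))
    show "integrable lborel (\<lambda>y. (f y * ?I y)\<^sup>2)" unfolding If
      using integrable_mult_indicator[OF _ f, of "ball 0 r"] by (simp add: mult.commute)
    show "integrable lborel (\<lambda>y. (?I y)\<^sup>2)" unfolding I2 using fin by (intro integrable_real_indicator) auto
  qed auto
  also have "(\<lambda>y. (f y * ?I y) * ?I y) = (\<lambda>y. f y * ?I y)" by (auto simp: indicator_def)
  finally have "(\<integral>y. f y * ?I y \<partial>lborel)\<^sup>2 \<le> (\<integral>y. (f y)\<^sup>2 * ?I y \<partial>lborel) * ?c"
    unfolding I2 If by simp
  then show ?thesis using c by (simp add: power_divide power2_eq_square[of ?c] field_simps)
qed

lemma ball_average_sq_le_total:
  fixes f :: "'a::euclidean_space \<Rightarrow> real"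
  assumes [measurable]: "f \<in> borel_measurable borel" and f: "integrable lborel (\<lambda>y. (f y)\<^sup>2)" and r: "r > 0"
  shows "((\<integral>y. f y * indicator (ball 0 r) y \<partial>lborel) / measure lborel (ball (0::'a) r))\<^sup>2
    \<le> (\<integral>y. (f y)\<^sup>2 \<partial>lborel) / measure lborel (ball (0::'a) r)"
proof -
  have "(\<integral>y. (f y)\<^sup>2 * indicator (ball 0 r) y \<partial>lborel) \<le> (\<integral>y. (f y)\<^sup>2 \<partial>lborel)"
    using f by (intro integral_mono_AE') (auto simp: indicator_def)
  then show ?thesis
    using ball_average_sq_le[OF assms] divide_right_mono[OF _ measure_nonneg] order_trans by meson
qed

lemma
  fixes \<phi> :: "real^'n::finite \<Rightarrow> real"
  assumes \<phi>: "\<phi> \<in> test_functions \<Omega>" and r: "r > 0"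
  shows ball_avg_sq_le: "(ball_avg r \<phi> x)\<^sup>2 \<le> (\<integral>y. (\<phi> y)\<^sup>2 \<partial>lborel) / measure lborel (ball (0::real^'n) r)"
    and ball_avg_lipschitz: "(ball_avg r \<phi> x - ball_avg r \<phi> y)\<^sup>2
      \<le> (norm (x - y))\<^sup>2 * dirichlet \<phi> / measure lborel (ball (0::real^'n) r)"
proof -
  note [measurable] = test_function_borel[OF \<phi>]
  let ?c = "measure lborel (ball (0::real^'n) r)"
  note loc = test_function_ball_integrable[OF \<phi>, of _ r]
  have "(ball_avg r \<phi> x)\<^sup>2 \<le> (\<integral>y. (\<phi> (x + y))\<^sup>2 \<partial>lborel) / ?c"
    unfolding ball_avg_def using sq_integrable_shift_test(1)[OF \<phi>, of x]
    by (intro ball_average_sq_le_total[where f = "\<lambda>y. \<phi> (x + y)", OF _ _ r]) (auto simp: add.commute)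
  also have "(\<integral>y. (\<phi> (x + y))\<^sup>2 \<partial>lborel) = (\<integral>y. (\<phi> y)\<^sup>2 \<partial>lborel)"
    using integral_shift[of "\<lambda>y. (\<phi> y)\<^sup>2" x] by (simp add: add.commute)
  finally show "(ball_avg r \<phi> x)\<^sup>2 \<le> (\<integral>y. (\<phi> y)\<^sup>2 \<partial>lborel) / ?c" .
  have "ball_avg r \<phi> x - ball_avg r \<phi> y = (\<integral>v. (\<phi> (x + v) - \<phi> (y + v)) * indicator (ball 0 r) v \<partial>lborel) / ?c"
    unfolding ball_avg_def diff_divide_distrib[symmetric] left_diff_distrib using loc by simp
  also have "\<dots>\<^sup>2 \<le> (\<integral>v. (\<phi> (x + v) - \<phi> (y + v))\<^sup>2 \<partial>lborel) / ?c"
    using sq_integrable_shift_test(3)[OF \<phi>]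
    by (intro ball_average_sq_le_total[where f = "\<lambda>v. \<phi> (x + v) - \<phi> (y + v)", OF _ _ r]) auto
  also have "(\<integral>v. (\<phi> (x + v) - \<phi> (y + v))\<^sup>2 \<partial>lborel) = (\<integral>v. (\<phi> (v + (x - y)) - \<phi> v)\<^sup>2 \<partial>lborel)"
    using integral_shift[of "\<lambda>v. (\<phi> (v + (x - y)) - \<phi> v)\<^sup>2" y] by (simp add: algebra_simps)
  also have "\<dots> / ?c \<le> (norm (x - y))\<^sup>2 * dirichlet \<phi> / ?c"
    unfolding dirichlet_def by (intro divide_right_mono translation_estimate[OF \<phi>]) auto
  finally show "(ball_avg r \<phi> x - ball_avg r \<phi> y)\<^sup>2 \<le> (norm (x - y))\<^sup>2 * dirichlet \<phi> / ?c" .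
qed

lemma ball_avg_continuous:
  fixes \<phi> :: "real^'n::finite \<Rightarrow> real"
  assumes \<phi>: "\<phi> \<in> test_functions \<Omega>" and r: "r > 0"
  shows "continuous_on UNIV (ball_avg r \<phi>)"
proof -
  define L where "L = sqrt (dirichlet \<phi> / measure lborel (ball (0::real^'n) r))"
  have "L-lipschitz_on UNIV (ball_avg r \<phi>)"
  proof (rule lipschitz_onI)
    fix x y
    have "sqrt ((ball_avg r \<phi> x - ball_avg r \<phi> y)\<^sup>2) \<le> sqrt ((norm (x - y))\<^sup>2 * dirichlet \<phi> / measure lborel (ball (0::real^'n) r))"
      by (rule real_sqrt_le_mono[OF ball_avg_lipschitz[OF assms]])
    then show "dist (ball_avg r \<phi> x) (ball_avg r \<phi> y) \<le> L * dist x y"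
      by (simp add: dist_norm L_def real_sqrt_mult real_sqrt_divide field_simps)
  qed (simp add: L_def dirichlet_nonneg)
  then show ?thesis by (rule lipschitz_on_continuous_on)
qed

text \<open>Averaging over balls of radius \<open>r\<close> moves a test function by at most \<open>r\<close> times its Dirichlet norm:
  the square of the mean is at most the mean of the squares, and each translate is close.\<close>

lemma ball_avg_close:
  fixes \<phi> :: "real^'n::finite \<Rightarrow> real"
  assumes \<phi>: "\<phi> \<in> test_functions \<Omega>" and r: "r > 0"
  shows "integrable lborel (\<lambda>x. (\<phi> x - ball_avg r \<phi> x)\<^sup>2)"
    and "(\<integral>x. (\<phi> x - ball_avg r \<phi> x)\<^sup>2 \<partial>lborel) \<le> r\<^sup>2 * dirichlet \<phi>"
proof -
  note [measurable] = test_function_borel[OF \<phi>]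
  have [measurable]: "ball_avg r \<phi> \<in> borel_measurable borel"
    by (intro borel_measurable_continuous_onI ball_avg_continuous[OF assms])
  have [measurable]: "ball (0::real^'n) r \<in> sets borel" by simp
  let ?B = "ball (0::real^'n) r"
  let ?c = "measure lborel ?B"
  have c: "?c > 0" using r by (rule measure_ball_pos)
  have fin: "emeasure lborel ?B < \<infinity>" by (rule emeasure_lborel_ball_finite)
  note loc = test_function_ball_integrable[OF \<phi>, of _ r]
  have int: "integrable lborel (\<lambda>y. (\<phi> x - \<phi> (x + y))\<^sup>2 * indicator ?B y)" for x
  proof -
    obtain C where C: "\<And>x. \<bar>\<phi> x\<bar> \<le> C" using test_function_bounded[OF \<phi>] by auto
    show ?thesis
    proof (rule Bochner_Integration.integrable_bound)
      show "integrable lborel (\<lambda>y. (2 * C)\<^sup>2 * indicator ?B y)"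
        using fin by (auto intro!: integrable_real_indicator)
      have "(\<phi> x - \<phi> (x + y))\<^sup>2 \<le> (2 * C)\<^sup>2" for y
        using C[of x] C[of "x + y"] by (intro abs_le_square_iff[THEN iffD1]) linarith
      then show "AE y in lborel. norm ((\<phi> x - \<phi> (x + y))\<^sup>2 * indicator ?B y) \<le> norm ((2 * C)\<^sup>2 * indicator ?B y)"
        by (auto simp: indicator_def)
    qed simp
  qed
  have pt: "(\<phi> x - ball_avg r \<phi> x)\<^sup>2 \<le> (\<integral>y. (\<phi> x - \<phi> (x + y))\<^sup>2 * indicator ?B y \<partial>lborel) / ?c" for x
  proof -
    define f where "f y = (\<phi> x - \<phi> (x + y)) * indicator ?B y" for y
    have [measurable]: "f \<in> borel_measurable borel" unfolding f_def by measurable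
    have f2: "(\<lambda>y. (f y)\<^sup>2) = (\<lambda>y. (\<phi> x - \<phi> (x + y))\<^sup>2 * indicator ?B y)" by (auto simp: f_def indicator_def)
    have "\<phi> x - ball_avg r \<phi> x = (\<integral>y. \<phi> x * indicator ?B y \<partial>lborel) / ?c - ball_avg r \<phi> x"
      using c by simp
    also have "\<dots> = (\<integral>y. \<phi> x * indicator ?B y - \<phi> (x + y) * indicator ?B y \<partial>lborel) / ?c"
      unfolding ball_avg_def diff_divide_distrib[symmetric]
      using loc[of x] fin by (subst Bochner_Integration.integral_diff) (auto intro!: integrable_real_indicator)
    also have "(\<lambda>y. \<phi> x * indicator ?B y - \<phi> (x + y) * indicator ?B y) = (\<lambda>y. f y * indicator ?B y)"
      by (auto simp: f_def indicator_def)
    also have "((\<integral>y. f y * indicator ?B y \<partial>lborel) / ?c)\<^sup>2 \<le> (\<integral>y. (f y)\<^sup>2 \<partial>lborel) / ?c"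
      using int by (intro ball_average_sq_le_total[where f = f, OF _ _ r]) (auto simp: f2)
    finally show ?thesis by (simp add: f2)
  qed
  have "(\<integral>\<^sup>+x. ennreal ((\<phi> x - ball_avg r \<phi> x)\<^sup>2) \<partial>lborel)
      \<le> (\<integral>\<^sup>+x. (\<integral>\<^sup>+y. ennreal ((\<phi> x - \<phi> (x + y))\<^sup>2 * indicator ?B y / ?c) \<partial>lborel) \<partial>lborel)"
  proof (intro nn_integral_mono)
    fix x
    have "ennreal ((\<phi> x - ball_avg r \<phi> x)\<^sup>2) \<le> ennreal (\<integral>y. (\<phi> x - \<phi> (x + y))\<^sup>2 * indicator ?B y / ?c \<partial>lborel)"
      using pt[of x] by (intro ennreal_leI) simp
    also have "\<dots> = (\<integral>\<^sup>+y. ennreal ((\<phi> x - \<phi> (x + y))\<^sup>2 * indicator ?B y / ?c) \<partial>lborel)"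
      using int by (intro nn_integral_eq_integral[symmetric]) auto
    finally show "ennreal ((\<phi> x - ball_avg r \<phi> x)\<^sup>2) \<le> (\<integral>\<^sup>+y. ennreal ((\<phi> x - \<phi> (x + y))\<^sup>2 * indicator ?B y / ?c) \<partial>lborel)" .
  qed
  also have "\<dots> = (\<integral>\<^sup>+y. (\<integral>\<^sup>+x. ennreal ((\<phi> x - \<phi> (x + y))\<^sup>2 * indicator ?B y / ?c) \<partial>lborel) \<partial>lborel)"
    by (rule lborel_pair.Fubini'[symmetric]) (unfold case_prod_beta', measurable)
  also have "\<dots> \<le> (\<integral>\<^sup>+y. ennreal (r\<^sup>2 * dirichlet \<phi> / ?c * indicator ?B y) \<partial>lborel)"
  proof (intro nn_integral_mono)
    fix y :: "real^'n"
    show "(\<integral>\<^sup>+x. ennreal ((\<phi> x - \<phi> (x + y))\<^sup>2 * indicator ?B y / ?c) \<partial>lborel) \<le> ennreal (r\<^sup>2 * dirichlet \<phi> / ?c * indicator ?B y)"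
    proof (cases "y \<in> ?B")
      case True
      have "(\<integral>\<^sup>+x. ennreal ((\<phi> x - \<phi> (x + y))\<^sup>2 / ?c) \<partial>lborel) = ennreal (\<integral>x. (\<phi> (x + y) - \<phi> x)\<^sup>2 / ?c \<partial>lborel)"
        using sq_integrable_shift_test(2)[OF \<phi>] by (subst nn_integral_eq_integral) (auto simp: power2_commute)
      also have "\<dots> \<le> ennreal (r\<^sup>2 * dirichlet \<phi> / ?c)"
      proof (rule ennreal_leI)
        have "(\<integral>x. (\<phi> (x + y) - \<phi> x)\<^sup>2 \<partial>lborel) \<le> (norm y)\<^sup>2 * dirichlet \<phi>"
          unfolding dirichlet_def by (rule translation_estimate[OF \<phi>])
        also have "\<dots> \<le> r\<^sup>2 * dirichlet \<phi>"
          using True by (intro mult_right_mono power_mono dirichlet_nonneg) auto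
        finally show "(\<integral>x. (\<phi> (x + y) - \<phi> x)\<^sup>2 / ?c \<partial>lborel) \<le> r\<^sup>2 * dirichlet \<phi> / ?c"
          by (simp add: divide_right_mono)
      qed
      finally show ?thesis using True by simp
    qed simp
  qed
  also have "\<dots> = ennreal (\<integral>y. r\<^sup>2 * dirichlet \<phi> / ?c * indicator ?B y \<partial>lborel)"
    using fin c by (intro nn_integral_eq_integral)
      (auto intro!: integrable_real_indicator AE_I2 mult_nonneg_nonneg divide_nonneg_nonneg dirichlet_nonneg)
  also have "(\<integral>y. r\<^sup>2 * dirichlet \<phi> / ?c * indicator ?B y \<partial>lborel) = r\<^sup>2 * dirichlet \<phi>"
    using c by simp
  finally have le: "(\<integral>\<^sup>+x. ennreal ((\<phi> x - ball_avg r \<phi> x)\<^sup>2) \<partial>lborel) \<le> ennreal (r\<^sup>2 * dirichlet \<phi>)" .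
  then show int: "integrable lborel (\<lambda>x. (\<phi> x - ball_avg r \<phi> x)\<^sup>2)"
    by (intro integrableI_nonneg) (auto intro: le_less_trans)
  show "(\<integral>x. (\<phi> x - ball_avg r \<phi> x)\<^sup>2 \<partial>lborel) \<le> r\<^sup>2 * dirichlet \<phi>"
    using le dirichlet_nonneg[of \<phi>] by (subst (asm) nn_integral_eq_integral[OF int]) (auto simp: ennreal_le_iff)
qed

text \<open>The averages of a sequence bounded in the Dirichlet norm are bounded and equicontinuous, hence have a
  uniformly convergent subsequence, and the averages are uniformly close to the sequence.\<close>

lemma rellich_step:
  fixes \<phi> :: "nat \<Rightarrow> real^'n::finite \<Rightarrow> real"
  assumes bdd: "bounded \<Omega>" and \<phi>: "\<And>n. \<phi> n \<in> test_functions \<Omega>" and C: "\<And>n. dirichlet (\<phi> n) \<le> C" and \<epsilon>: "\<epsilon> > 0"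
  shows "\<exists>s :: nat \<Rightarrow> nat. strict_mono s \<and> (\<exists>N. \<forall>i\<ge>N. \<forall>j\<ge>N. (\<integral>x. (\<phi> (s i) x - \<phi> (s j) x)\<^sup>2 \<partial>lborel) < \<epsilon>)"
proof -
  note [measurable] = test_function_borel[OF \<phi>]
  obtain R where R: "R > 0" "\<And>x. x \<in> \<Omega> \<Longrightarrow> norm x \<le> R" using bdd by (auto simp: bounded_pos)
  obtain K where K: "K > 0" "\<And>\<phi>. \<phi> \<in> test_functions \<Omega> \<Longrightarrow> (\<integral>x. (\<phi> x)\<^sup>2 \<partial>lborel) \<le> K * dirichlet \<phi>"
    using poincare_test_function[OF bdd] by auto
  have C0: "C \<ge> 0" using dirichlet_nonneg C order_trans by blast
  \<comment> \<open>The averaging error will enter as \<open>6 r\<^sup>2 C\<close> and the distance of the averages as \<open>3 e\<^sup>2 \<bar>S\<bar>\<close>; each is to stay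
    below \<open>\<epsilon>/2\<close>.\<close>
  define r where "r = sqrt (\<epsilon> / (12 * (C + 1)))"
  have r: "r > 0" "6 * r\<^sup>2 * C < \<epsilon> / 2" using C0 \<epsilon> by (auto simp: r_def field_simps)
  define c where "c = measure lborel (ball (0::real^'n) r)"
  have c: "c > 0" unfolding c_def by (rule measure_ball_pos[OF r(1)])
  define S where "S = cball (0::real^'n) R"
  have S: "compact S" "\<Omega> \<subseteq> S" using R by (auto simp: S_def)
  have Sfin: "emeasure lborel S < \<infinity>" unfolding S_def by (rule emeasure_lborel_cball_finite)
  define F where "F n = ball_avg r (\<phi> n)" for n
  define L where "L = sqrt (C / c)"
  have L0: "L \<ge> 0" using C0 c by (simp add: L_def)
  have Fb: "norm (F n x) \<le> sqrt (K * C / c)" for n x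
  proof -
    have "(F n x)\<^sup>2 \<le> (\<integral>y. (\<phi> n y)\<^sup>2 \<partial>lborel) / c"
      unfolding F_def c_def by (rule ball_avg_sq_le[OF \<phi> r(1)])
    also have "\<dots> \<le> K * C / c"
      using order_trans[OF K(2)[OF \<phi>[of n]] mult_left_mono[OF C[of n]]] K(1) c by (intro divide_right_mono) auto
    finally show ?thesis using real_le_rsqrt[of "\<bar>F n x\<bar>"] by simp
  qed
  have Fl: "norm (F n x - F n y) \<le> L * norm (x - y)" for n x y
  proof -
    have "(F n x - F n y)\<^sup>2 \<le> (norm (x - y))\<^sup>2 * dirichlet (\<phi> n) / c"
      unfolding F_def c_def by (rule ball_avg_lipschitz[OF \<phi> r(1)])
    also have "\<dots> \<le> (norm (x - y))\<^sup>2 * C / c"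
      using c C by (intro divide_right_mono mult_left_mono) auto
    also have "\<dots> = (L * norm (x - y))\<^sup>2" using c C0 by (simp add: L_def power_mult_distrib)
    finally show ?thesis using L0 by (simp add: abs_le_square_iff[symmetric])
  qed
  obtain g k where k: "strict_mono (k :: nat \<Rightarrow> nat)"
    and g: "\<And>e. 0 < e \<Longrightarrow> \<exists>N. \<forall>n x. n \<ge> N \<and> x \<in> S \<longrightarrow> norm (F (k n) x - g x) < e"
  proof (rule Arzela_Ascoli[of S F "sqrt (K * C / c)"])
    fix x and e :: real assume "0 < e"
    show "\<exists>d>0. \<forall>n y. y \<in> S \<and> norm (x - y) < d \<longrightarrow> norm (F n x - F n y) < e"
    proof (intro exI[of _ "e / (L + 1)"] conjI allI impI)
      show "e / (L + 1) > 0" using \<open>0 < e\<close> L0 by simp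
      fix n y assume "y \<in> S \<and> norm (x - y) < e / (L + 1)"
      then have "(L + 1) * norm (x - y) < e" using L0 by (simp add: field_simps)
      moreover have "(L + 1) * norm (x - y) = L * norm (x - y) + norm (x - y)" by (simp add: algebra_simps)
      ultimately show "norm (F n x - F n y) < e" using Fl[of n x y] norm_ge_zero[of "x - y"] by linarith
    qed
  qed (use S Fb in auto)
  define e where "e = sqrt (\<epsilon> / (6 * (measure lborel S + 1)))"
  have Sp: "measure lborel S + 1 > 0" by (simp add: add_nonneg_pos)
  have e: "e > 0" "3 * e\<^sup>2 * measure lborel S < \<epsilon> / 2"
    using Sp \<epsilon> by (auto simp: e_def field_simps)
  obtain N where N: "\<And>n x. n \<ge> N \<Longrightarrow> x \<in> S \<Longrightarrow> \<bar>F (k n) x - g x\<bar> < e / 2"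
    using g[of "e / 2"] e(1) by auto
  have "(\<integral>x. (\<phi> (k i) x - \<phi> (k j) x)\<^sup>2 \<partial>lborel) < \<epsilon>" if ij: "i \<ge> N" "j \<ge> N" for i j
  proof -
    note close = ball_avg_close[OF \<phi> r(1), folded F_def]
    have pt: "(\<phi> (k i) x - \<phi> (k j) x)\<^sup>2 \<le> 3 * (\<phi> (k i) x - F (k i) x)\<^sup>2 + 3 * (\<phi> (k j) x - F (k j) x)\<^sup>2
        + 3 * e\<^sup>2 * indicator S x" for x
    proof (cases "x \<in> S")
      case True
      have "\<bar>F (k i) x - F (k j) x\<bar> \<le> e" using N[OF ij(1) True] N[OF ij(2) True] by linarith
      then have "(F (k i) x - F (k j) x)\<^sup>2 \<le> e\<^sup>2" by (metis abs_ge_zero power2_abs power_mono)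
      moreover have "(a + b + c)\<^sup>2 \<le> 3 * a\<^sup>2 + 3 * c\<^sup>2 + 3 * b\<^sup>2" for a b c :: real
        using sum_squares_bound[of a b] sum_squares_bound[of a c] sum_squares_bound[of b c]
        by (simp add: power2_eq_square algebra_simps)
      from this[of "\<phi> (k i) x - F (k i) x" "F (k i) x - F (k j) x" "F (k j) x - \<phi> (k j) x"]
      have "(\<phi> (k i) x - \<phi> (k j) x)\<^sup>2 \<le> 3 * (\<phi> (k i) x - F (k i) x)\<^sup>2 + 3 * (\<phi> (k j) x - F (k j) x)\<^sup>2
        + 3 * (F (k i) x - F (k j) x)\<^sup>2" by (simp add: power2_commute)
      ultimately show ?thesis using True by simp
    next
      case False
      then have "\<phi> (k i) x = 0" "\<phi> (k j) x = 0" using S test_function_eq_0[OF \<phi>] by auto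
      then show ?thesis by simp
    qed
    have "(\<integral>x. (\<phi> (k i) x - \<phi> (k j) x)\<^sup>2 \<partial>lborel) \<le>
        (\<integral>x. 3 * (\<phi> (k i) x - F (k i) x)\<^sup>2 + 3 * (\<phi> (k j) x - F (k j) x)\<^sup>2 + 3 * e\<^sup>2 * indicator S x \<partial>lborel)"
      using pt close(1) Sfin
      by (intro integral_mono_AE' Bochner_Integration.integrable_add integrable_mult_right integrable_real_indicator)
        (auto simp: S_def)
    also have "\<dots> = 3 * (\<integral>x. (\<phi> (k i) x - F (k i) x)\<^sup>2 \<partial>lborel) + 3 * (\<integral>x. (\<phi> (k j) x - F (k j) x)\<^sup>2 \<partial>lborel)
        + 3 * e\<^sup>2 * measure lborel S"
    proof -
      have i3: "integrable lborel (\<lambda>x. 3 * e\<^sup>2 * indicator S x)"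
        using Sfin by (intro integrable_mult_right integrable_real_indicator) (auto simp: S_def)
      have i1: "integrable lborel (\<lambda>x. 3 * (\<phi> (k n) x - F (k n) x)\<^sup>2)" for n using close(1) by simp
      show ?thesis
        by (simp only: Bochner_Integration.integral_add[OF Bochner_Integration.integrable_add[OF i1 i1] i3]
            Bochner_Integration.integral_add[OF i1 i1] integral_mult_right_zero) (simp add: S_def)
    qed
    also have "\<dots> \<le> 3 * (r\<^sup>2 * C) + 3 * (r\<^sup>2 * C) + 3 * e\<^sup>2 * measure lborel S"
      using order_trans[OF close(2) mult_left_mono[OF C]] by (intro add_mono mult_left_mono) auto
    also have "\<dots> < \<epsilon>"
    proof -
      have "3 * (r\<^sup>2 * C) + 3 * (r\<^sup>2 * C) = 6 * r\<^sup>2 * C" by simp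
      then show ?thesis using r(2) e(2) by linarith
    qed
    finally show ?thesis .
  qed
  then show ?thesis using k by blast
qed

text \<open>A diagonal sequence turns the closeness up to a fixed \<open>\<epsilon>\<close> into the Cauchy property.\<close>

theorem rellich_test_functions:
  fixes \<phi> :: "nat \<Rightarrow> real^'n::finite \<Rightarrow> real"
  assumes bdd: "bounded \<Omega>" and \<phi>: "\<And>n. \<phi> n \<in> test_functions \<Omega>" and C: "\<And>n. dirichlet (\<phi> n) \<le> C"
  obtains s :: "nat \<Rightarrow> nat" where "strict_mono s"
    "\<And>\<epsilon>. \<epsilon> > 0 \<Longrightarrow> \<exists>N. \<forall>i\<ge>N. \<forall>j\<ge>N. (\<integral>x. (\<phi> (s i) x - \<phi> (s j) x)\<^sup>2 \<partial>lborel) < \<epsilon>"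
proof -
  define P where "P n s \<longleftrightarrow> (\<exists>N. \<forall>i\<ge>N. \<forall>j\<ge>N. (\<integral>x. (\<phi> (s i) x - \<phi> (s j) x)\<^sup>2 \<partial>lborel) < 1 / real (Suc n))"
    for n and s :: "nat \<Rightarrow> nat"
  interpret subseqs P
  proof
    fix n and s :: "nat \<Rightarrow> nat"
    show "\<exists>r'. strict_mono r' \<and> P n (s \<circ> r')"
      using rellich_step[OF bdd, of "\<lambda>n. \<phi> (s n)" C "1 / real (Suc n)"] \<phi> C by (auto simp: P_def)
  qed
  show thesis
  proof (rule that[OF subseq_diagseq])
    fix \<epsilon> :: real assume "\<epsilon> > 0"
    then obtain n where n: "1 / real (Suc n) < \<epsilon>" using nat_approx_posE by blast
    obtain N where N: "\<And>i j. i \<ge> N \<Longrightarrow> j \<ge> N \<Longrightarrow>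
        (\<integral>x. (\<phi> (seqseq (Suc n) i) x - \<phi> (seqseq (Suc n) j) x)\<^sup>2 \<partial>lborel) < 1 / real (Suc n)"
      using seqseq_holds[of n] unfolding P_def by blast
    have idx: "\<exists>i'\<ge>N. diagseq i = seqseq (Suc n) i'" if "i \<ge> max N (Suc n)" for i
      using diagseq_sub[of "Suc n" i] that seq_suble[OF subseq_fold_reduce[of "Suc n" "i - Suc n"], of i]
      by (intro exI[of _ "fold_reduce (Suc n) (i - Suc n) i"]) auto
    show "\<exists>N. \<forall>i\<ge>N. \<forall>j\<ge>N. (\<integral>x. (\<phi> (diagseq i) x - \<phi> (diagseq j) x)\<^sup>2 \<partial>lborel) < \<epsilon>"
    proof (intro exI[of _ "max N (Suc n)"] allI impI)
      fix i j assume "i \<ge> max N (Suc n)" "j \<ge> max N (Suc n)"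
      then obtain i' j' where "i' \<ge> N" "j' \<ge> N" "diagseq i = seqseq (Suc n) i'" "diagseq j = seqseq (Suc n) j'"
        using idx by meson
      then show "(\<integral>x. (\<phi> (diagseq i) x - \<phi> (diagseq j) x)\<^sup>2 \<partial>lborel) < \<epsilon>" using N n by fastforce
    qed
  qed
qed

text \<open>At level \<open>t\<close> choose the radius so large that the average stays below \<open>t/2\<close>; then \<open>\<bar>\<phi>\<bar> > t\<close> forces
  \<open>\<phi>\<close> to differ from its average by \<open>t/2\<close>, and Chebyshev's inequality applies.\<close>

lemma level_set_estimate:
  fixes \<Omega> :: "(real^'n::finite) set"
  assumes bdd: "bounded \<Omega>"
  shows "\<exists>A\<ge>0. \<forall>\<phi>\<in>test_functions \<Omega>. dirichlet \<phi> \<le> 1 \<longrightarrow>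
    (\<forall>t>0. emeasure lborel {x. \<bar>\<phi> x\<bar> > t} \<le> ennreal (A * t powr (- (2 + 4 / real CARD('n)))))"
proof -
  obtain K where K: "K > 0" "\<And>\<phi>. \<phi> \<in> test_functions \<Omega> \<Longrightarrow> (\<integral>x. (\<phi> x)\<^sup>2 \<partial>lborel) \<le> K * dirichlet \<phi>"
    using poincare_test_function[OF bdd] by auto
  let ?N = "real CARD('n)"
  have N0: "?N > 0" by simp
  define v where "v = unit_ball_vol ?N"
  have v: "v > 0" by (simp add: v_def)
  have "emeasure lborel {x. \<bar>\<phi> x\<bar> > t} \<le> ennreal (4 * (4 * K / v) powr (2 / ?N) * t powr (- (2 + 4 / ?N)))"
    if \<phi>: "\<phi> \<in> test_functions \<Omega>" and D: "dirichlet \<phi> \<le> 1" and t: "t > 0" for \<phi> t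
  proof -
    note [measurable] = test_function_borel[OF \<phi>]
    \<comment> \<open>With this radius the ball has volume \<open>4 K / t\<^sup>2\<close>, which bounds the average by \<open>t/2\<close>.\<close>
    define r where "r = (4 * K / (v * t\<^sup>2)) powr (1 / ?N)"
    have r: "r > 0" using K(1) v t by (simp add: r_def)
    have [measurable]: "ball_avg r \<phi> \<in> borel_measurable borel"
      by (intro borel_measurable_continuous_onI ball_avg_continuous[OF \<phi> r])
    have "r ^ CARD('n) = r powr ?N" using r by (simp only: powr_realpow)
    also have "\<dots> = 4 * K / (v * t\<^sup>2)" unfolding r_def powr_powr using K(1) v t by simp
    finally have "r ^ CARD('n) = 4 * K / (v * t\<^sup>2)" .
    then have ball: "measure lborel (ball (0::real^'n) r) = 4 * K / t\<^sup>2"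
      using r v by (simp add: content_ball v_def[symmetric])
    have tm2: "t powr (- 2) = 1 / t\<^sup>2" using t by (simp add: powr_minus_divide)
    have r2: "r\<^sup>2 = (4 * K / v) powr (2 / ?N) * t powr (- (4 / ?N))"
    proof -
      have "r\<^sup>2 = r powr 2" using r by simp
      also have "\<dots> = (4 * K / (v * t\<^sup>2)) powr (2 / ?N)" unfolding r_def powr_powr by simp
      also have "4 * K / (v * t\<^sup>2) = 4 * K / v * t powr (- 2)" unfolding tm2 by simp
      also have "(4 * K / v * t powr (- 2)) powr (2 / ?N) = (4 * K / v) powr (2 / ?N) * (t powr (- 2)) powr (2 / ?N)"
        using K(1) v by (intro powr_mult)
      finally show ?thesis by (simp add: powr_powr)
    qed
    have avg: "\<bar>ball_avg r \<phi> x\<bar> \<le> t / 2" for x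
    proof -
      have "(ball_avg r \<phi> x)\<^sup>2 \<le> (\<integral>y. (\<phi> y)\<^sup>2 \<partial>lborel) / (4 * K / t\<^sup>2)"
        using ball_avg_sq_le[OF \<phi> r, of x] unfolding ball .
      also have "\<dots> \<le> K / (4 * K / t\<^sup>2)"
        using order_trans[OF K(2)[OF \<phi>] mult_left_mono[OF D, of K]] K(1) t by (intro divide_right_mono) auto
      also have "\<dots> = (t / 2)\<^sup>2" using K(1) t by (simp add: field_simps power2_eq_square)
      finally show ?thesis using t by (simp add: abs_le_square_iff[symmetric])
    qed
    have "emeasure lborel {x. \<bar>\<phi> x\<bar> > t} = (\<integral>\<^sup>+x. indicator {x. \<bar>\<phi> x\<bar> > t} x \<partial>lborel)"
      by simp
    also have "\<dots> \<le> (\<integral>\<^sup>+x. ennreal (4 / t\<^sup>2 * (\<phi> x - ball_avg r \<phi> x)\<^sup>2) \<partial>lborel)"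
    proof (intro nn_integral_mono)
      fix x
      show "indicator {x. \<bar>\<phi> x\<bar> > t} x \<le> ennreal (4 / t\<^sup>2 * (\<phi> x - ball_avg r \<phi> x)\<^sup>2)"
      proof (cases "\<bar>\<phi> x\<bar> > t")
        case True
        then have "t / 2 \<le> \<bar>\<phi> x - ball_avg r \<phi> x\<bar>" using avg[of x] by linarith
        then have "(t / 2)\<^sup>2 \<le> (\<phi> x - ball_avg r \<phi> x)\<^sup>2" using t by (simp add: abs_le_square_iff[symmetric])
        then have "1 \<le> 4 / t\<^sup>2 * (\<phi> x - ball_avg r \<phi> x)\<^sup>2" using t by (simp add: field_simps)
        then show ?thesis using True by (simp add: ennreal_ge_1)
      qed simp
    qed
    also have "\<dots> = ennreal (4 / t\<^sup>2 * (\<integral>x. (\<phi> x - ball_avg r \<phi> x)\<^sup>2 \<partial>lborel))"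
      using ball_avg_close(1)[OF \<phi> r] by (subst nn_integral_eq_integral) auto
    also have "\<dots> \<le> ennreal (4 / t\<^sup>2 * r\<^sup>2)"
      using ball_avg_close(2)[OF \<phi> r] mult_left_mono[OF D, of "r\<^sup>2"]
      by (intro ennreal_leI mult_left_mono) auto
    also have "4 / t\<^sup>2 * r\<^sup>2 = 4 * (4 * K / v) powr (2 / ?N) * t powr (- (2 + 4 / ?N))"
    proof -
      have "t powr (- (2 + 4 / ?N)) = 1 / t\<^sup>2 * t powr (- (4 / ?N))"
        unfolding tm2[symmetric] powr_add[symmetric] by simp
      then show ?thesis by (simp add: r2)
    qed
    finally show ?thesis .
  qed
  then show ?thesis by (intro exI[of _ "4 * (4 * K / v) powr (2 / ?N)"]) auto
qed

lemma ennreal_le_suminf: "f k \<le> (\<Sum>k. f k :: ennreal)"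
  using sum_le_suminf[OF summableI, of "{k}" f] by simp

text \<open>Summing the level estimate over dyadic levels gives all exponents below \<open>2 + 4/N\<close>.\<close>

theorem sobolev_test_function:
  fixes \<Omega> :: "(real^'n::finite) set"
  assumes bdd: "bounded \<Omega>" and q: "0 < q" "q < 2 + 4 / real CARD('n)"
  shows "\<exists>C\<ge>0. \<forall>\<phi>\<in>test_functions \<Omega>. \<forall>\<delta>>0. dirichlet \<phi> \<le> \<delta>\<^sup>2 \<longrightarrow>
    (\<integral>\<^sup>+x. ennreal (\<bar>\<phi> x\<bar> powr q) \<partial>lborel) \<le> ennreal (C * \<delta> powr q)"
proof -
  let ?s = "2 + 4 / real CARD('n)"
  obtain A where A: "A \<ge> 0" "\<And>\<phi> t. \<phi> \<in> test_functions \<Omega> \<Longrightarrow> dirichlet \<phi> \<le> 1 \<Longrightarrow> t > 0 \<Longrightarrow>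
      emeasure lborel {x. \<bar>\<phi> x\<bar> > t} \<le> ennreal (A * t powr (- ?s))"
    using level_set_estimate[OF bdd] by blast
  obtain R where R: "R > 0" "\<And>x. x \<in> \<Omega> \<Longrightarrow> norm x \<le> R" using bdd by (auto simp: bounded_pos)
  define S where "S = cball (0::real^'n) R"
  have S: "\<Omega> \<subseteq> S" "S \<in> sets borel" using R by (auto simp: S_def)
  have Sfin: "emeasure lborel S < \<infinity>" unfolding S_def by (rule emeasure_lborel_cball_finite)
  define \<rho> where "\<rho> = 2 powr (q - ?s)"
  have \<rho>: "0 < \<rho>" "\<rho> < 1" using q(2) powr_less_mono[of "q - ?s" 0 2] by (auto simp: \<rho>_def)
  define C where "C = measure lborel S + A * 2 powr q * (1 / (1 - \<rho>))"
  have C0: "C \<ge> 0" using A(1) \<rho> by (simp add: C_def)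
  have unit: "(\<integral>\<^sup>+x. ennreal (\<bar>\<phi> x\<bar> powr q) \<partial>lborel) \<le> ennreal C"
    if \<phi>: "\<phi> \<in> test_functions \<Omega>" and D: "dirichlet \<phi> \<le> 1" for \<phi>
  proof -
    note [measurable] = test_function_borel[OF \<phi>] S(2)
    let ?E = "\<lambda>k. {x. \<bar>\<phi> x\<bar> > 2 ^ k}"
    have pt: "ennreal (\<bar>\<phi> x\<bar> powr q) \<le> indicator S x + (\<Sum>k. ennreal (2 powr (real (Suc k) * q)) * indicator (?E k) x)" for x
    proof (cases "\<bar>\<phi> x\<bar> \<le> 1")
      case True
      have "ennreal (\<bar>\<phi> x\<bar> powr q) \<le> indicator S x"
      proof (cases "\<phi> x = 0")
        case False
        then have "x \<in> S" using test_function_eq_0[OF \<phi>] S(1) by auto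
        moreover have "\<bar>\<phi> x\<bar> powr q \<le> 1" using True q(1) powr_mono2[of q "\<bar>\<phi> x\<bar>" 1] by simp
        ultimately show ?thesis by (simp add: ennreal_le_1)
      qed simp
      then show ?thesis by (simp add: add_increasing2)
    next
      case False
      define m where "m = (LEAST m. \<bar>\<phi> x\<bar> \<le> 2 ^ m)"
      obtain m0 where "\<bar>\<phi> x\<bar> \<le> 2 ^ m0" using real_arch_pow[of 2 "\<bar>\<phi> x\<bar>"] by (auto intro: less_imp_le)
      then have m: "\<bar>\<phi> x\<bar> \<le> 2 ^ m" unfolding m_def by (rule LeastI)
      then have "m \<noteq> 0" using False by (metis power_0)
      then obtain k where k: "m = Suc k" using not0_implies_Suc by blast
      have "\<not> \<bar>\<phi> x\<bar> \<le> 2 ^ k" using not_less_Least[of k "\<lambda>m. \<bar>\<phi> x\<bar> \<le> 2 ^ m"] k m_def by simp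
      then have kx: "x \<in> ?E k" by simp
      have "\<bar>\<phi> x\<bar> powr q \<le> (2 powr real (Suc k)) powr q"
        using m q(1) unfolding k by (intro powr_mono2) (auto simp: powr_realpow simp del: of_nat_Suc power_Suc)
      then have "ennreal (\<bar>\<phi> x\<bar> powr q) \<le> ennreal (2 powr (real (Suc k) * q)) * indicator (?E k) x"
        using kx by (simp add: powr_powr ennreal_leI)
      also have "\<dots> \<le> (\<Sum>k. ennreal (2 powr (real (Suc k) * q)) * indicator (?E k) x)"
        by (rule ennreal_le_suminf)
      finally show ?thesis by (simp add: add_increasing)
    qed
    have "(\<integral>\<^sup>+x. ennreal (\<bar>\<phi> x\<bar> powr q) \<partial>lborel)
        \<le> (\<integral>\<^sup>+x. indicator S x + (\<Sum>k. ennreal (2 powr (real (Suc k) * q)) * indicator (?E k) x) \<partial>lborel)"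
      using pt by (intro nn_integral_mono)
    also have "\<dots> = emeasure lborel S + (\<Sum>k. ennreal (2 powr (real (Suc k) * q)) * emeasure lborel (?E k))"
      by (subst nn_integral_add) (auto simp: nn_integral_suminf nn_integral_cmult_indicator)
    also have "\<dots> \<le> ennreal (measure lborel S) + (\<Sum>k. ennreal (A * 2 powr q * \<rho> ^ k))"
    proof (intro add_mono suminf_le allI summableI)
      show "emeasure lborel S \<le> ennreal (measure lborel S)"
        using Sfin by (simp add: emeasure_eq_ennreal_measure)
      fix k
      have "ennreal (2 powr (real (Suc k) * q)) * emeasure lborel (?E k)
          \<le> ennreal (2 powr (real (Suc k) * q)) * ennreal (A * (2 ^ k) powr (- ?s))"
        by (intro mult_left_mono A(2)[OF \<phi> D]) auto
      also have "\<dots> = ennreal (2 powr (real (Suc k) * q) * (A * (2 ^ k) powr (- ?s)))"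
        using A(1) by (intro ennreal_mult[symmetric]) auto
      also have "2 powr (real (Suc k) * q) * (A * (2 ^ k) powr (- ?s)) = A * 2 powr q * \<rho> ^ k"
      proof -
        have "\<rho> ^ k = 2 powr ((q - ?s) * real k)" by (simp add: \<rho>_def powr_powr flip: powr_realpow)
        moreover have "(2 ^ k) powr (- ?s) = 2 powr (- ?s * real k)" by (simp add: powr_powr mult.commute flip: powr_realpow)
        moreover have "2 powr (real (Suc k) * q) * 2 powr (- ?s * real k) = 2 powr q * 2 powr ((q - ?s) * real k)"
          by (simp add: powr_add[symmetric] algebra_simps)
        ultimately show ?thesis by (simp add: algebra_simps)
      qed
      finally show "ennreal (2 powr (real (Suc k) * q)) * emeasure lborel (?E k) \<le> ennreal (A * 2 powr q * \<rho> ^ k)" .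
    qed
    also have "(\<Sum>k. ennreal (A * 2 powr q * \<rho> ^ k)) = ennreal (A * 2 powr q * (1 / (1 - \<rho>)))"
      using \<rho> A(1) by (intro suminf_ennreal_eq sums_mult geometric_sums) auto
    also have "ennreal (measure lborel S) + \<dots> = ennreal C"
      unfolding C_def using A(1) \<rho> by (intro ennreal_plus[symmetric]) auto
    finally show ?thesis .
  qed
  have "(\<integral>\<^sup>+x. ennreal (\<bar>\<phi> x\<bar> powr q) \<partial>lborel) \<le> ennreal (C * \<delta> powr q)"
    if \<phi>: "\<phi> \<in> test_functions \<Omega>" and D: "dirichlet \<phi> \<le> \<delta>\<^sup>2" and \<delta>: "\<delta> > 0" for \<phi> \<delta>
  proof -
    note [measurable] = test_function_borel[OF \<phi>]
    have "dirichlet (\<lambda>x. (1 / \<delta>) * \<phi> x) = (1 / \<delta>)\<^sup>2 * dirichlet \<phi>"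
      unfolding dirichlet_def grad_cmult[OF \<phi>] by (simp add: power_mult_distrib power_divide)
    also have "\<dots> \<le> 1" using D \<delta> by (simp add: power_divide)
    finally have u: "(\<integral>\<^sup>+x. ennreal (\<bar>(1 / \<delta>) * \<phi> x\<bar> powr q) \<partial>lborel) \<le> ennreal C"
      by (rule unit[OF test_function_cmult[OF \<phi>]])
    have "(\<integral>\<^sup>+x. ennreal (\<bar>\<phi> x\<bar> powr q) \<partial>lborel) = (\<integral>\<^sup>+x. ennreal (\<delta> powr q) * ennreal (\<bar>(1 / \<delta>) * \<phi> x\<bar> powr q) \<partial>lborel)"
      using \<delta> by (intro nn_integral_cong) (simp add: abs_mult powr_divide flip: ennreal_mult)
    also have "\<dots> = ennreal (\<delta> powr q) * (\<integral>\<^sup>+x. ennreal (\<bar>(1 / \<delta>) * \<phi> x\<bar> powr q) \<partial>lborel)"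
      by (intro nn_integral_cmult) simp
    also have "\<dots> \<le> ennreal (\<delta> powr q) * ennreal C" by (intro mult_left_mono u) simp
    also have "\<dots> = ennreal (C * \<delta> powr q)" using C0 by (simp add: mult.commute flip: ennreal_mult)
    finally show ?thesis .
  qed
  then show ?thesis using C0 by blast
qed

section \<open>Uniqueness of weak gradients\<close>

lemma
  fixes f :: "'a::euclidean_space \<Rightarrow> 'b::euclidean_space"
  assumes \<Omega>: "\<Omega> \<in> sets lebesgue" and f: "f \<in> borel_measurable borel" and 0: "\<And>x. x \<notin> \<Omega> \<Longrightarrow> f x = 0"
  shows integral_lebesgue_on_eq: "integral\<^sup>L (lebesgue_on \<Omega>) f = integral\<^sup>L lborel f"
    and integrable_lebesgue_on_eq: "integrable (lebesgue_on \<Omega>) f \<longleftrightarrow> integrable lborel f"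
proof -
  have "(\<lambda>x. indicator \<Omega> x *\<^sub>R f x) = f" using 0 by (auto simp: indicator_def fun_eq_iff)
  then show "integral\<^sup>L (lebesgue_on \<Omega>) f = integral\<^sup>L lborel f"
    and "integrable (lebesgue_on \<Omega>) f \<longleftrightarrow> integrable lborel f"
    using \<Omega> f by (simp_all add: integral_restrict_space integrable_restrict_space integral_completion integrable_completion)
qed

lemma nn_integral_lebesgue_on_le: "\<Omega> \<in> sets lebesgue \<Longrightarrow> nn_integral (lebesgue_on \<Omega>) f \<le> nn_integral lborel f"
  unfolding nn_integral_completion[of lborel, symmetric]
  by (subst nn_integral_restrict_space) (auto intro!: nn_integral_mono simp: indicator_def)

lemma locally_integrable_measurable:
  fixes u :: "'a::euclidean_space \<Rightarrow> 'b::euclidean_space"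
  assumes "open \<Omega>" "locally_integrable \<Omega> u"
  shows "u \<in> borel_measurable (lebesgue_on \<Omega>)"
proof -
  obtain C where C: "\<And>n. compact (C n)" "\<And>n. C n \<subseteq> \<Omega>" "\<And>n. C n \<subseteq> interior (C (Suc n))" "\<Union>(range C) = \<Omega>"
    using open_Union_compact_subsets[OF assms(1)] by metis
  have mono: "C m \<subseteq> C n" if "m \<le> n" for m n
    using that C(3) interior_subset by (induction rule: dec_induct) blast+
  have "(\<lambda>x. if x \<in> \<Omega> then u x else 0) \<in> borel_measurable lebesgue"
  proof (rule borel_measurable_LIMSEQ_metric)
    fix n
    have "integrable (lebesgue_on (C n)) u" using assms(2) C by (auto simp: locally_integrable_def)
    then show "(\<lambda>x. if x \<in> C n then u x else 0) \<in> borel_measurable lebesgue"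
      using C(1)[of n] by (intro borel_measurable_if_I) (auto simp: lmeasurable_compact fmeasurableD)
  next
    fix x
    show "(\<lambda>n. if x \<in> C n then u x else 0) \<longlonglongrightarrow> (if x \<in> \<Omega> then u x else 0)"
    proof (cases "x \<in> \<Omega>")
      case True
      then obtain N where "x \<in> C N" using C(4) by auto
      then have "\<forall>n\<ge>N. x \<in> C n" using mono by blast
      then have "eventually (\<lambda>n. (if x \<in> C n then u x else 0) = u x) sequentially"
        by (auto simp: eventually_sequentially)
      then show ?thesis using True by (simp add: tendsto_eventually)
    next
      case False
      then have "x \<notin> C n" for n using C(2) by auto
      then show ?thesis using False by simp
    qed
  qed
  then show ?thesis using assms(1) by (subst (asm) borel_measurable_if) auto
qed

lemma locally_integrable_mult_test:
  fixes u :: "real^'n::finite \<Rightarrow> real"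
  assumes \<Omega>: "open \<Omega>" and u: "locally_integrable \<Omega> u" and \<phi>: "\<phi> \<in> test_functions \<Omega>"
    and k: "continuous_on UNIV k" "\<And>x. \<phi> x = 0 \<Longrightarrow> grad \<phi> x = 0 \<Longrightarrow> k x = 0"
  shows "integrable (lebesgue_on \<Omega>) (\<lambda>x. u x * k x)"
proof -
  define K where "K = closure {x. \<phi> x \<noteq> 0}"
  have K: "compact K" "K \<subseteq> \<Omega>" using \<phi> by (auto simp: K_def test_functions_def)
  have Kl: "K \<in> sets lebesgue" using K(1) by (simp add: lmeasurable_compact fmeasurableD)
  have out: "k x = 0" if "x \<notin> K" for x
  proof -
    have "x \<notin> closure {x. \<phi> x \<noteq> 0}" using that by (simp add: K_def)
    then show ?thesis
      using k(2) test_function_eq_0_outside_support[OF \<phi>] grad_eq_0_outside_support[OF \<phi>] by blast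
  qed
  have km: "k \<in> borel_measurable (lebesgue_on K)"
    using k(1) Kl by (intro continuous_imp_measurable_on_sets_lebesgue) (auto intro: continuous_on_subset)
  have "bounded (k ` K)" using compact_continuous_image[of K k] k(1) K(1) continuous_on_subset compact_imp_bounded by blast
  then obtain B where B: "\<And>x. x \<in> K \<Longrightarrow> \<bar>k x\<bar> \<le> B" by (auto simp: bounded_iff)
  have uK: "integrable (lebesgue_on K) u" using u K by (auto simp: locally_integrable_def)
  have "integrable (lebesgue_on K) (\<lambda>x. u x * k x)"
  proof (rule Bochner_Integration.integrable_bound)
    show "integrable (lebesgue_on K) (\<lambda>x. B * u x)" using uK by simp
    show "(\<lambda>x. u x * k x) \<in> borel_measurable (lebesgue_on K)" using uK km by (intro borel_measurable_times) auto
    have "\<bar>u x * k x\<bar> \<le> \<bar>B * u x\<bar>" if "x \<in> K" for x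
    proof -
      have "\<bar>k x\<bar> \<le> \<bar>B\<bar>" using B[OF that] by linarith
      from mult_right_mono[OF this abs_ge_zero[of "u x"]] show ?thesis by (simp only: abs_mult mult.commute)
    qed
    then show "AE x in lebesgue_on K. norm (u x * k x) \<le> norm (B * u x)" by (intro AE_I2) auto
  qed
  then have "integrable lebesgue (\<lambda>x. if x \<in> K then u x * k x else 0)"
    by (rule Lebesgue_Measure.integrable_restrict_UNIV[OF Kl, THEN iffD2])
  also have "(\<lambda>x. if x \<in> K then u x * k x else 0) = (\<lambda>x. if x \<in> \<Omega> then u x * k x else 0)"
    using out K(2) by (auto simp: fun_eq_iff)
  finally show ?thesis using \<Omega> by (intro Lebesgue_Measure.integrable_restrict_UNIV[THEN iffD1]) auto
qed

text \<open>The boxes form an intersection-stable generator of the Borel sets, so an integrable function whose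
  integral over every box vanishes has vanishing integral over every Borel set.\<close>

lemma AE_eq_0_if_box_integrals_0:
  fixes h :: "'a::euclidean_space \<Rightarrow> real"
  assumes h: "integrable lborel h" and total: "(\<integral>x. h x \<partial>lborel) = 0"
    and box: "\<And>a b. (\<integral>x. indicator (box a b) x * h x \<partial>lborel) = 0"
  shows "AE x in lborel. h x = 0"
proof (rule density_unique_real[OF h, of "\<lambda>_. 0"])
  fix A :: "'a set" assume "A \<in> sets lborel"
  then have A: "A \<in> sigma_sets UNIV (range (\<lambda>(a, b). box a b))"
    by (simp add: borel_eq_box)
  have subset_Pow_UNIV: "range (\<lambda>(a::'a, b). box a b) \<subseteq> Pow UNIV" by simp
  have st: "Int_stable (range (\<lambda>(a::'a, b). box a b))"
    by (auto simp: Int_stable_def box_Int_box)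
  have setI: "B \<in> sets lborel" if "B \<in> sigma_sets UNIV (range (\<lambda>(a::'a, b). box a b))" for B
    using that by (simp add: borel_eq_box)
  have "set_lebesgue_integral lborel A h = 0"
    using st subset_Pow_UNIV A
  proof (induction rule: sigma_sets_induct_disjoint)
    case (compl B)
    note B = setI[OF compl.hyps]
    have "set_lebesgue_integral lborel (UNIV - B) h = (\<integral>x. h x - indicator B x *\<^sub>R h x \<partial>lborel)"
      unfolding set_lebesgue_integral_def by (intro Bochner_Integration.integral_cong) (auto simp: indicator_def)
    also have "\<dots> = 0"
      using compl.IH total h B integrable_mult_indicator[OF B h]
      by (simp add: set_lebesgue_integral_def)
    finally show ?case .
  next
    case (union B)
    have "(LINT x:(\<Union>i. B i)|lborel. h x) = (\<Sum>i. (LINT x:(B i)|lborel. h x))"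
    proof (rule lebesgue_integral_countable_add)
      show Bs: "B i \<in> sets lborel" for i using union.hyps(2) setI by auto
      show "B i \<inter> B j = {}" if "i \<noteq> j" for i j using union.hyps(1) that by (auto simp: disjoint_family_on_def)
      show "set_integrable lborel (\<Union>i. B i) h"
        unfolding set_integrable_def using Bs by (intro integrable_mult_indicator h) auto
    qed
    then show ?case using union.IH by simp
  qed (use box in \<open>auto simp: set_lebesgue_integral_def\<close>)
  then show "set_lebesgue_integral lborel A h = set_lebesgue_integral lborel A (\<lambda>_. 0)"
    by (simp add: set_lebesgue_integral_def)
qed simp

text \<open>The fundamental lemma of the calculus of variations.  The smooth approximations of indicators of
  boxes show that the integral over every box vanishes.\<close>

lemma AE_eq_0_if_orthogonal_to_test_functions:
  fixes g :: "real^'n::finite \<Rightarrow> real"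
  assumes \<Omega>: "open \<Omega>" and g: "locally_integrable \<Omega> g"
    and orth: "\<And>\<phi>. \<phi> \<in> test_functions \<Omega> \<Longrightarrow> (LINT x|lebesgue_on \<Omega>. g x * \<phi> x) = 0"
  shows "AE x in lebesgue_on \<Omega>. g x = 0"
proof -
  have \<Omega>l: "\<Omega> \<in> sets lebesgue" using \<Omega> by simp
  have gm[measurable]: "g \<in> borel_measurable (lebesgue_on \<Omega>)" by (rule locally_integrable_measurable[OF \<Omega> g])
  have gint: "integrable lebesgue (\<lambda>x. indicator (cbox a b) x * g x)" if "cbox a b \<subseteq> \<Omega>" for a b
  proof -
    have "integrable (lebesgue_on (cbox a b)) g" using g that by (auto simp: locally_integrable_def)
    then show ?thesis by (simp add: integrable_restrict_space)
  qed
  have gintb: "integrable lebesgue (\<lambda>x. indicator (box a b) x * (indicator (cbox c d) x * g x))" if "cbox c d \<subseteq> \<Omega>" for a b c d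
    using integrable_mult_indicator[OF _ gint[OF that], of "box a b"] by simp
  have box0: "(\<integral>x. indicator (box a b) x * g x \<partial>lebesgue) = 0" if ab: "cbox a b \<subseteq> \<Omega>" for a b
  proof -
    let ?\<psi> = "\<lambda>n x. box_bump a b (real (Suc n)) x"
    have "(\<lambda>n. LINT x|lebesgue_on \<Omega>. g x * ?\<psi> n x) \<longlonglongrightarrow> (LINT x|lebesgue_on \<Omega>. g x * indicator (box a b) x)"
    proof (rule integral_dominated_convergence[where w = "\<lambda>x. \<bar>indicator (cbox a b) x * g x\<bar>"])
      have "indicator (box a b) \<in> borel_measurable (lebesgue_on \<Omega>)"
        by (intro measurable_restrict_space1) (auto intro!: borel_measurable_indicator)
      then show "(\<lambda>x. g x * indicator (box a b) x) \<in> borel_measurable (lebesgue_on \<Omega>)" by measurable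
      show "(\<lambda>x. g x * ?\<psi> n x) \<in> borel_measurable (lebesgue_on \<Omega>)" for n
      proof -
        have "?\<psi> n \<in> test_functions UNIV" by (rule box_bump_test_function) auto
        then have "?\<psi> n \<in> borel_measurable (lebesgue_on \<Omega>)"
          using \<Omega>l by (intro continuous_imp_measurable_on_sets_lebesgue test_function_continuous)
        then show ?thesis by measurable
      qed
      have "integrable (lebesgue_on \<Omega>) (\<lambda>x. indicator (cbox a b) x * g x)"
      proof -
        have "(\<lambda>x. indicator \<Omega> x *\<^sub>R (indicator (cbox a b) x * g x)) = (\<lambda>x. indicator (cbox a b) x * g x)"
          using ab by (auto simp: indicator_def fun_eq_iff)
        then show ?thesis using gint[OF ab] \<Omega>l by (simp add: integrable_restrict_space)
      qed
      then show "integrable (lebesgue_on \<Omega>) (\<lambda>x. \<bar>indicator (cbox a b) x * g x\<bar>)" by (rule integrable_abs)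
      show "AE x in lebesgue_on \<Omega>. (\<lambda>n. g x * ?\<psi> n x) \<longlonglongrightarrow> g x * indicator (box a b) x"
        by (intro AE_I2 tendsto_mult tendsto_const box_bump_tendsto_indicator)
      fix n
      show "AE x in lebesgue_on \<Omega>. norm (g x * ?\<psi> n x) \<le> \<bar>indicator (cbox a b) x * g x\<bar>"
      proof (intro AE_I2)
        fix x
        show "norm (g x * ?\<psi> n x) \<le> \<bar>indicator (cbox a b) x * g x\<bar>"
        proof (cases "x \<in> box a b")
          case True
          then show ?thesis using box_bump_le_1[of a b "real (Suc n)" x] box_bump_nonneg[of a b "real (Suc n)" x]
              box_subset_cbox[of a b] by (auto simp: abs_mult mult_left_le simp del: of_nat_Suc)
        qed (simp add: box_bump_eq_0)
      qed
    qed
    moreover have "(LINT x|lebesgue_on \<Omega>. g x * ?\<psi> n x) = 0" for n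
      using ab by (intro orth box_bump_test_function) auto
    ultimately have "(LINT x|lebesgue_on \<Omega>. g x * indicator (box a b) x) = 0" by (simp add: LIMSEQ_const_iff)
    moreover have "(\<lambda>x. indicator \<Omega> x *\<^sub>R (g x * indicator (box a b) x)) = (\<lambda>x. indicator (box a b) x * g x)"
      using ab box_subset_cbox[of a b] by (auto simp: indicator_def fun_eq_iff)
    ultimately show ?thesis using \<Omega>l by (simp add: integral_restrict_space)
  qed
  have cbox_AE: "AE x in lebesgue. x \<in> cbox c d \<longrightarrow> g x = 0" if cd: "cbox c d \<subseteq> \<Omega>" for c d
  proof -
    let ?h = "\<lambda>x. indicator (box c d) x * g x"
    have hint: "integrable lebesgue ?h"
    proof -
      have "(\<lambda>x. indicator (box c d) x * (indicator (cbox c d) x * g x)) = ?h"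
        using box_subset_cbox[of c d] by (auto simp: indicator_def fun_eq_iff)
      then show ?thesis using gintb[OF cd, of c d] by simp
    qed
    obtain h' where h'[measurable]: "h' \<in> borel_measurable lborel" and hh': "AE x in lborel. ?h x = h' x"
      using completion_ex_borel_measurable_real[OF borel_measurable_integrable[OF hint]] by blast
    have hh'l: "AE x in lebesgue. ?h x = h' x" using hh' by (rule AE_completion)
    have h'l: "h' \<in> borel_measurable lebesgue" using h' by (rule measurable_completion)
    have h'int: "integrable lebesgue h'" by (rule integrable_cong_AE_imp[OF hint h'l]) (use hh'l in auto)
    have "AE x in lborel. h' x = 0"
    proof (rule AE_eq_0_if_box_integrals_0)
      show "integrable lborel h'" using h'int h' by (simp add: integrable_completion)
      have "(\<integral>x. h' x \<partial>(lborel :: (real^'n) measure)) = (\<integral>x. h' x \<partial>lebesgue)" using h' by (simp add: integral_completion)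
      also have "\<dots> = (\<integral>x. ?h x \<partial>lebesgue)" using hh'l h'l hint by (intro integral_cong_AE) auto
      finally show "(\<integral>x. h' x \<partial>lborel) = 0" using box0[OF cd] by simp
      fix a b :: "real^'n"
      have [measurable]: "box a b \<in> sets lborel" by simp
      have bm: "(\<lambda>x. indicator (box a b) x * h' x) \<in> borel_measurable lborel" by measurable
      have "(\<integral>x. indicator (box a b) x * h' x \<partial>lborel) = (\<integral>x. indicator (box a b) x * h' x \<partial>lebesgue)"
        using bm by (simp add: integral_completion)
      also have "\<dots> = (\<integral>x. indicator (box a b) x * ?h x \<partial>lebesgue)"
      proof (rule integral_cong_AE)
        show "(\<lambda>x. indicator (box a b) x * h' x) \<in> borel_measurable lebesgue" using bm by (rule measurable_completion)
        show "(\<lambda>x. indicator (box a b) x * ?h x) \<in> borel_measurable lebesgue"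
          using integrable_mult_indicator[OF _ hint, of "box a b"] by auto
      qed (use hh'l in auto)
      also have "\<dots> = 0"
      proof -
        obtain a' b' where ab': "box a b \<inter> box c d = box a' b'" using box_Int_box[of a b c d] by blast
        have eq: "(\<lambda>x. indicator (box a b) x * ?h x) = (\<lambda>x. indicator (box a' b') x * g x)"
          unfolding ab'[symmetric] by (auto simp: indicator_def fun_eq_iff)
        show ?thesis
        proof (cases "box a' b' = {}")
          case True
          then show ?thesis unfolding eq by simp
        next
          case False
          have "closure (box a' b') \<subseteq> closure (box c d)" using ab' by (intro closure_mono) auto
          moreover have "closure (box c d) \<subseteq> cbox c d" using box_subset_cbox closed_cbox by (rule closure_minimal)
          ultimately have "cbox a' b' \<subseteq> \<Omega>" using cd closure_box[OF False] by auto
          then show ?thesis unfolding eq by (rule box0)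
        qed
      qed
      finally show "(\<integral>x. indicator (box a b) x * h' x \<partial>lborel) = 0" .
    qed
    then have "AE x in lebesgue. h' x = 0" by (rule AE_completion)
    moreover have "AE x in lebesgue. x \<notin> cbox c d - box c d"
      using null_sets_cbox_Diff_box[of c d] by (intro AE_completion AE_not_in)
    ultimately show ?thesis using hh'l
    proof eventually_elim
      case (elim x)
      then show ?case by (cases "x \<in> box c d") auto
    qed
  qed
  obtain \<D> where D: "countable \<D>" "\<D> \<subseteq> Pow \<Omega>" "\<And>X. X \<in> \<D> \<Longrightarrow> \<exists>a b. X = cbox a b" "\<Union>\<D> = \<Omega>"
    using open_countable_Union_open_cbox[OF \<Omega>] by metis
  have "AE x in lebesgue. \<forall>X\<in>\<D>. x \<in> X \<longrightarrow> g x = 0"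
  proof (subst AE_ball_countable[OF D(1)], intro ballI)
    fix X assume X: "X \<in> \<D>"
    then obtain a b where "X = cbox a b" using D(3) by blast
    then show "AE x in lebesgue. x \<in> X \<longrightarrow> g x = 0" using cbox_AE[of a b] D(2) X by auto
  qed
  then have "AE x in lebesgue. x \<in> \<Omega> \<longrightarrow> g x = 0" using D(4) by (auto elim!: eventually_mono)
  then show ?thesis using \<Omega>l by (simp add: AE_restrict_space_iff)
qed

lemma locally_integrable_nth: "locally_integrable \<Omega> g \<Longrightarrow> locally_integrable \<Omega> (\<lambda>x. g x $ i)"
  unfolding locally_integrable_def by (auto intro: integrable_bounded_linear[OF bounded_linear_vec_nth])

text \<open>This makes the choice inside \<^const>\<open>weak_grad\<close> harmless: every weak gradient is one of its versions.\<close>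

lemma weak_gradient_unique:
  fixes u :: "real^'n::finite \<Rightarrow> real"
  assumes \<Omega>: "open \<Omega>" and g: "is_weak_gradient \<Omega> u g" and h: "is_weak_gradient \<Omega> u h"
  shows "AE x in lebesgue_on \<Omega>. g x = h x"
proof -
  have loc: "locally_integrable \<Omega> (\<lambda>x. g x $ i)" "locally_integrable \<Omega> (\<lambda>x. h x $ i)" for i
    using g h by (auto simp: is_weak_gradient_def intro!: locally_integrable_nth)
  have "AE x in lebesgue_on \<Omega>. g x $ i - h x $ i = 0" for i
  proof (rule AE_eq_0_if_orthogonal_to_test_functions[OF \<Omega>])
    show "locally_integrable \<Omega> (\<lambda>x. g x $ i - h x $ i)"
      using loc[of i] by (auto simp: locally_integrable_def)
    fix \<phi> assume \<phi>: "\<phi> \<in> test_functions \<Omega>"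
    have "integrable (lebesgue_on \<Omega>) (\<lambda>x. g x $ i * \<phi> x)" "integrable (lebesgue_on \<Omega>) (\<lambda>x. h x $ i * \<phi> x)"
      by (auto intro!: locally_integrable_mult_test[OF \<Omega> _ \<phi>] loc test_function_continuous[OF \<phi>])
    moreover have "(LINT x|lebesgue_on \<Omega>. g x $ i * \<phi> x) = (LINT x|lebesgue_on \<Omega>. h x $ i * \<phi> x)"
      using g h \<phi> by (fastforce simp: is_weak_gradient_def)
    ultimately show "(LINT x|lebesgue_on \<Omega>. (g x $ i - h x $ i) * \<phi> x) = 0"
      by (simp add: left_diff_distrib)
  qed
  then have "AE x in lebesgue_on \<Omega>. \<forall>i. g x $ i - h x $ i = 0" by (simp add: AE_all_countable)
  then show ?thesis by eventually_elim (simp add: vec_eq_iff)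
qed

lemma weak_grad_is_weak_gradient: "is_weak_gradient \<Omega> u g \<Longrightarrow> is_weak_gradient \<Omega> u (weak_grad \<Omega> u)"
  unfolding weak_grad_def by (rule someI[where P = "is_weak_gradient \<Omega> u"])

lemma is_weak_gradient_diff:
  fixes u v :: "real^'n::finite \<Rightarrow> real"
  assumes \<Omega>: "open \<Omega>" and u: "is_weak_gradient \<Omega> u g" and v: "is_weak_gradient \<Omega> v h"
  shows "is_weak_gradient \<Omega> (\<lambda>x. u x - v x) (\<lambda>x. g x - h x)"
  unfolding is_weak_gradient_def
proof (intro conjI ballI allI)
  show "locally_integrable \<Omega> (\<lambda>x. u x - v x)" "locally_integrable \<Omega> (\<lambda>x. g x - h x)"
    using u v by (auto simp: is_weak_gradient_def locally_integrable_def)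
  fix \<phi> i assume \<phi>: "\<phi> \<in> test_functions \<Omega>"
  have pd: "continuous_on UNIV (partial_deriv i \<phi>)"
    by (rule C_n_imp_continuous_on[OF partial_deriv_C_n[OF \<phi>, of 0]])
  have pd0: "partial_deriv i \<phi> x = 0" if "grad \<phi> x = 0" for x
    using that by (metis grad_nth zero_index)
  have "integrable (lebesgue_on \<Omega>) (\<lambda>x. u x * partial_deriv i \<phi> x)"
    "integrable (lebesgue_on \<Omega>) (\<lambda>x. v x * partial_deriv i \<phi> x)"
    "integrable (lebesgue_on \<Omega>) (\<lambda>x. g x $ i * \<phi> x)" "integrable (lebesgue_on \<Omega>) (\<lambda>x. h x $ i * \<phi> x)"
    using u v pd pd0
    by (auto intro!: locally_integrable_mult_test[OF \<Omega> _ \<phi>] locally_integrable_nth test_function_continuous[OF \<phi>]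
        simp: is_weak_gradient_def)
  moreover have "(LINT x|lebesgue_on \<Omega>. u x * partial_deriv i \<phi> x) = - (LINT x|lebesgue_on \<Omega>. g x $ i * \<phi> x)"
    "(LINT x|lebesgue_on \<Omega>. v x * partial_deriv i \<phi> x) = - (LINT x|lebesgue_on \<Omega>. h x $ i * \<phi> x)"
    using u v \<phi> by (auto simp: is_weak_gradient_def)
  ultimately show "(LINT x|lebesgue_on \<Omega>. (u x - v x) * partial_deriv i \<phi> x) = - (LINT x|lebesgue_on \<Omega>. (g x - h x) $ i * \<phi> x)"
    by (simp add: left_diff_distrib)
qed

text \<open>Integration by parts is the vanishing of the integral of the gradient of a product.\<close>

lemma test_function_weak_gradient:
  assumes \<Omega>: "open \<Omega>" and \<phi>: "\<phi> \<in> test_functions \<Omega>"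
  shows "is_weak_gradient \<Omega> \<phi> (grad \<phi>)"
  unfolding is_weak_gradient_def
proof (intro conjI ballI allI)
  have loc: "locally_integrable \<Omega> f" if "continuous_on UNIV f" for f :: "real^'a \<Rightarrow> 'c::euclidean_space"
    unfolding locally_integrable_def
  proof (intro allI impI)
    fix K :: "(real^'a) set" assume "compact K \<and> K \<subseteq> \<Omega>"
    then have K: "compact K" by simp
    have "integrable lborel (\<lambda>x. indicator K x *\<^sub>R f x)"
      using K that by (intro borel_integrable_compact) (auto intro: continuous_on_subset)
    then have "integrable lebesgue (\<lambda>x. indicator K x *\<^sub>R f x)" by (simp add: integrable_completion)
    then show "integrable (lebesgue_on K) f"
      using K by (simp add: integrable_restrict_space lmeasurable_compact fmeasurableD)
  qed
  show "locally_integrable \<Omega> \<phi>" by (intro loc test_function_continuous[OF \<phi>])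
  show "locally_integrable \<Omega> (grad \<phi>)" by (intro loc grad_continuous[OF \<phi>])
  fix \<psi> i assume \<psi>: "\<psi> \<in> test_functions \<Omega>"
  note cont = test_function_continuous[OF \<phi>, of UNIV] test_function_continuous[OF \<psi>, of UNIV]
    C_n_imp_continuous_on[OF partial_deriv_C_n[OF \<phi>, of 0 i]] C_n_imp_continuous_on[OF partial_deriv_C_n[OF \<psi>, of 0 i]]
  have pd0: "partial_deriv i \<psi> x = 0" if "grad \<psi> x = 0" for x
    using that by (metis grad_nth zero_index)
  have i1: "integrable lborel (\<lambda>x. \<phi> x * partial_deriv i \<psi> x)"
    by (rule test_function_integrable[OF \<psi>]) (use cont pd0 in \<open>auto intro!: continuous_intros\<close>)
  have i2: "integrable lborel (\<lambda>x. partial_deriv i \<phi> x * \<psi> x)"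
    by (rule test_function_integrable[OF \<psi>]) (use cont in \<open>auto intro!: continuous_intros\<close>)
  have prod: "(\<lambda>x. \<phi> x * \<psi> x) \<in> test_functions \<Omega>"
    by (rule test_function_mult[OF \<psi> test_function_C_n[OF \<phi>]])
  have "0 = (\<integral>x. partial_deriv i (\<lambda>x. \<phi> x * \<psi> x) x \<partial>lborel)"
    using integral_grad_eq_0[OF prod, of "axis i 1"] by (simp add: inner_axis)
  also have "\<dots> = (\<integral>x. \<phi> x * partial_deriv i \<psi> x \<partial>lborel) + (\<integral>x. partial_deriv i \<phi> x * \<psi> x \<partial>lborel)"
    unfolding partial_deriv_mult[OF \<phi> \<psi>] by (rule Bochner_Integration.integral_add[OF i1 i2])
  finally have eq: "(\<integral>x. \<phi> x * partial_deriv i \<psi> x \<partial>lborel) = - (\<integral>x. partial_deriv i \<phi> x * \<psi> x \<partial>lborel)" by simp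
  have "(LINT x|lebesgue_on \<Omega>. \<phi> x * partial_deriv i \<psi> x) = (\<integral>x. \<phi> x * partial_deriv i \<psi> x \<partial>lborel)"
    using \<Omega> i1 test_function_eq_0[OF \<phi>] by (intro integral_lebesgue_on_eq) auto
  moreover have "(LINT x|lebesgue_on \<Omega>. grad \<phi> x $ i * \<psi> x) = (\<integral>x. partial_deriv i \<phi> x * \<psi> x \<partial>lborel)"
    using \<Omega> i2 test_function_eq_0[OF \<psi>] by (subst integral_lebesgue_on_eq) auto
  ultimately show "(LINT x|lebesgue_on \<Omega>. \<phi> x * partial_deriv i \<psi> x) = - (LINT x|lebesgue_on \<Omega>. grad \<phi> x $ i * \<psi> x)"
    using eq by simp
qed

section \<open>The energy space\<close>

lemma abs_powr_2 [simp]: "\<bar>t::real\<bar> powr 2 = t\<^sup>2"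
  by (cases "t = 0") auto

lemma norm_powr_2 [simp]: "norm t powr 2 = (norm t)\<^sup>2"
  by (cases "t = 0") auto

lemma powr_add_le:
  assumes "0 \<le> a" "0 \<le> b" "0 \<le> r"
  shows "(a + b) powr r \<le> 2 powr r * (a powr r + b powr r :: real)"
proof -
  have "(a + b) powr r \<le> (2 * max a b) powr r" using assms by (intro powr_mono2) auto
  also have "\<dots> = 2 powr r * max a b powr r" using assms by (intro powr_mult) 
  also have "\<dots> \<le> 2 powr r * (a powr r + b powr r)" by (intro mult_left_mono) (auto simp: max_def)
  finally show ?thesis .
qed

lemma Fatou_integral:
  fixes f :: "nat \<Rightarrow> 'a \<Rightarrow> real"
  assumes f: "\<And>i. integrable M (f i)" "\<And>i. AE x in M. 0 \<le> f i x"
    and f'[measurable]: "f' \<in> borel_measurable M" and lim: "AE x in M. (\<lambda>i. f i x) \<longlonglongrightarrow> f' x"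
    and le: "\<And>i. i \<ge> N \<Longrightarrow> (\<integral>x. f i x \<partial>M) \<le> c"
  shows "integrable M f'" "(\<integral>x. f' x \<partial>M) \<le> c"
proof -
  have [measurable]: "f i \<in> borel_measurable M" for i using f(1) by auto
  have "AE x in M. \<forall>i. 0 \<le> f i x" using f(2) by (simp add: AE_all_countable)
  then have pos: "AE x in M. 0 \<le> f' x" using lim
    by eventually_elim (auto intro: LIMSEQ_le_const)
  have c: "0 \<le> c" using le[of N] integral_nonneg_AE[OF f(2)[of N]] by simp
  have "(\<integral>\<^sup>+x. ennreal (f' x) \<partial>M) = (\<integral>\<^sup>+x. liminf (\<lambda>i. ennreal (f i x)) \<partial>M)"
    using lim by (intro nn_integral_cong_AE, eventually_elim)
      (metis lim_imp_Liminf sequentially_bot tendsto_ennrealI trivial_limit_sequentially)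
  also have "\<dots> \<le> liminf (\<lambda>i. \<integral>\<^sup>+x. ennreal (f i x) \<partial>M)" by (rule nn_integral_liminf) simp
  also have "\<dots> \<le> limsup (\<lambda>i. \<integral>\<^sup>+x. ennreal (f i x) \<partial>M)" by (rule Liminf_le_Limsup) simp
  also have "\<dots> \<le> ennreal c"
  proof (rule Limsup_bounded)
    show "\<forall>\<^sub>F i in sequentially. (\<integral>\<^sup>+x. ennreal (f i x) \<partial>M) \<le> ennreal c"
      unfolding eventually_sequentially
    proof (intro exI allI impI)
      fix i assume "i \<ge> N"
      then show "(\<integral>\<^sup>+x. ennreal (f i x) \<partial>M) \<le> ennreal c"
        using le[of i] by (subst nn_integral_eq_integral[OF f(1,2)]) (rule ennreal_leI)
    qed
  qed
  finally have nn: "(\<integral>\<^sup>+x. ennreal (f' x) \<partial>M) \<le> ennreal c" .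
  show int: "integrable M f'"
    using pos nn by (intro integrableI_nonneg) (auto intro: le_less_trans)
  show "(\<integral>x. f' x \<partial>M) \<le> c"
    using nn c by (subst (asm) nn_integral_eq_integral[OF int pos]) (simp add: ennreal_le_iff)
qed

lemma integral_abs_sq_le:
  assumes "finite_measure M" and [measurable]: "f \<in> borel_measurable M" and "integrable M (\<lambda>x. (f x)\<^sup>2)"
  shows "(\<integral>x. \<bar>f x\<bar> \<partial>M)\<^sup>2 \<le> measure M (space M) * (\<integral>x. (f x :: real)\<^sup>2 \<partial>M)"
proof -
  interpret finite_measure M by fact
  have "(\<integral>x. 1 * \<bar>f x\<bar> \<partial>M)\<^sup>2 \<le> (\<integral>x. 1\<^sup>2 \<partial>M) * (\<integral>x. \<bar>f x\<bar>\<^sup>2 \<partial>M)"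
    using assms(3) by (intro Cauchy_Schwarz_integral(2)) auto
  then show ?thesis by simp
qed

text \<open>The upper bound on \<open>q\<close> is the one under which the Dirichlet norm controls the \<open>L\<^sup>q\<close> norm in
  \<open>sobolev_test_function\<close>.\<close>

locale phase_domain =
  fixes \<Omega> :: "(real^'n::finite) set" and q B :: real and \<mu> :: "real^'n \<Rightarrow> real"
  assumes open_Omega: "open \<Omega>" and bounded_Omega: "bounded \<Omega>" and nonempty_Omega: "\<Omega> \<noteq> {}"
    and q: "2 < q" "q < 2 + 4 / real CARD('n)"
    and mu_measurable [measurable]: "\<mu> \<in> borel_measurable (lebesgue_on \<Omega>)"
    and mu: "\<And>x. x \<in> \<Omega> \<Longrightarrow> 0 \<le> \<mu> x" "\<And>x. x \<in> \<Omega> \<Longrightarrow> \<mu> x \<le> B"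
begin

abbreviation "M \<equiv> lebesgue_on \<Omega>"

lemma Omega_lebesgue: "\<Omega> \<in> sets lebesgue"
  using open_Omega by simp

sublocale finite_measure M
  by (intro finite_measure_lebesgue_on lmeasurable_open open_Omega bounded_Omega)

lemma B_nonneg: "B \<ge> 0"
  using mu nonempty_Omega order_trans by blast

text \<open>The Musielak--Orlicz--Sobolev norm also measures \<open>\<mu> \<bar>u\<bar>\<^sup>q\<close>.  On the closure of the test functions that term is
  controlled by the gradient, so the energy leaves it out.\<close>

definition energy :: "(real^'n \<Rightarrow> real) \<Rightarrow> (real^'n \<Rightarrow> real^'n) \<Rightarrow> real^'n \<Rightarrow> real" where
  "energy u g x = (u x)\<^sup>2 + (norm (g x))\<^sup>2 + \<mu> x * norm (g x) powr q"

definition finite_energy :: "(real^'n \<Rightarrow> real) \<Rightarrow> (real^'n \<Rightarrow> real^'n) \<Rightarrow> bool" where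
  "finite_energy u g \<longleftrightarrow> u \<in> borel_measurable M \<and> g \<in> borel_measurable M \<and> integrable M (energy u g)"

abbreviation total_energy :: "(real^'n \<Rightarrow> real) \<Rightarrow> (real^'n \<Rightarrow> real^'n) \<Rightarrow> real" where
  "total_energy u g \<equiv> integral\<^sup>L M (energy u g)"

abbreviation energy_dist ::
    "(real^'n \<Rightarrow> real) \<Rightarrow> (real^'n \<Rightarrow> real^'n) \<Rightarrow> (real^'n \<Rightarrow> real) \<Rightarrow> (real^'n \<Rightarrow> real^'n) \<Rightarrow> real" where
  "energy_dist u g v h \<equiv> total_energy (\<lambda>x. u x - v x) (\<lambda>x. g x - h x)"

lemma energy_nonneg: "x \<in> \<Omega> \<Longrightarrow> 0 \<le> energy u g x"
  using mu by (simp add: energy_def)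

lemma energy_measurable:
  assumes [measurable]: "u \<in> borel_measurable M" "g \<in> borel_measurable M"
  shows "energy u g \<in> borel_measurable M"
  unfolding energy_def by measurable

lemma total_energy_nonneg: "0 \<le> total_energy u g"
  by (intro integral_nonneg_AE AE_I2) (auto simp: energy_nonneg)

lemma energy_minus: "energy (\<lambda>x. - u x) (\<lambda>x. - g x) = energy u g"
  by (simp add: energy_def fun_eq_iff)

lemma energy_add_le:
  assumes x: "x \<in> \<Omega>"
  shows "energy (\<lambda>x. u x + v x) (\<lambda>x. g x + h x) x \<le> 2 powr q * (energy u g x + energy v h x)"
proof -
  have sq: "(a + b)\<^sup>2 \<le> 2 powr q * (a\<^sup>2 + b\<^sup>2)" for a b :: real
  proof -
    have "(a + b)\<^sup>2 \<le> 2 * (a\<^sup>2 + b\<^sup>2)" using sum_squares_bound[of a b] by (simp add: power2_sum)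
    also have "\<dots> \<le> 2 powr q * (a\<^sup>2 + b\<^sup>2)"
      using q(1) powr_mono[of 1 q 2] by (intro mult_right_mono) auto
    finally show ?thesis .
  qed
  have n: "norm (g x + h x) \<le> norm (g x) + norm (h x)" by (rule norm_triangle_ineq)
  have "(norm (g x + h x))\<^sup>2 \<le> 2 powr q * ((norm (g x))\<^sup>2 + (norm (h x))\<^sup>2)"
    by (rule order_trans[OF power_mono[OF n] sq]) simp
  moreover have "\<mu> x * norm (g x + h x) powr q \<le> \<mu> x * (2 powr q * (norm (g x) powr q + norm (h x) powr q))"
  proof (intro mult_left_mono mu(1)[OF x])
    show "norm (g x + h x) powr q \<le> 2 powr q * (norm (g x) powr q + norm (h x) powr q)"
      using q(1) by (intro order_trans[OF powr_mono2[OF _ _ n] powr_add_le]) auto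
  qed
  ultimately show ?thesis using sq[of "u x" "v x"] by (simp add: energy_def algebra_simps)
qed

lemma finite_energyD:
  assumes "finite_energy u g"
  shows "u \<in> borel_measurable M" "g \<in> borel_measurable M" "integrable M (energy u g)"
  using assms by (auto simp: finite_energy_def)

lemma
  assumes "finite_energy u g"
  shows sq_integrable: "integrable M (\<lambda>x. (u x)\<^sup>2)"
    and grad_sq_int: "integrable M (\<lambda>x. (norm (g x))\<^sup>2)"
    and grad_powr_integrable: "integrable M (\<lambda>x. \<mu> x * norm (g x) powr q)"
    and integral_sq_le: "(\<integral>x. (u x)\<^sup>2 \<partial>M) \<le> total_energy u g"
    and integral_grad_sq_le: "(\<integral>x. (norm (g x))\<^sup>2 \<partial>M) \<le> total_energy u g"
    and integral_grad_powr_le: "(\<integral>x. \<mu> x * norm (g x) powr q \<partial>M) \<le> total_energy u g"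
proof -
  note [measurable] = finite_energyD(1,2)[OF assms]
  note E = finite_energyD(3)[OF assms]
  have b: "0 \<le> (u x)\<^sup>2" "0 \<le> (norm (g x))\<^sup>2" "0 \<le> \<mu> x * norm (g x) powr q" if "x \<in> \<Omega>" for x
    using mu(1)[OF that] by auto
  show i: "integrable M (\<lambda>x. (u x)\<^sup>2)" "integrable M (\<lambda>x. (norm (g x))\<^sup>2)" "integrable M (\<lambda>x. \<mu> x * norm (g x) powr q)"
    by (rule Bochner_Integration.integrable_bound[OF E]; use mu in \<open>auto intro!: AE_I2 simp: energy_def\<close>)+
  show "(\<integral>x. (u x)\<^sup>2 \<partial>M) \<le> total_energy u g" "(\<integral>x. (norm (g x))\<^sup>2 \<partial>M) \<le> total_energy u g"
    "(\<integral>x. \<mu> x * norm (g x) powr q \<partial>M) \<le> total_energy u g"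
    by (rule integral_mono_AE; use i E mu in \<open>auto intro!: AE_I2 simp: energy_def\<close>)+
qed

lemma
  assumes "finite_energy u g" "finite_energy v h"
  shows finite_energy_add: "finite_energy (\<lambda>x. u x + v x) (\<lambda>x. g x + h x)"
    and total_energy_add_le: "total_energy (\<lambda>x. u x + v x) (\<lambda>x. g x + h x) \<le> 2 powr q * (total_energy u g + total_energy v h)"
proof -
  note [measurable] = finite_energyD(1,2)[OF assms(1)] finite_energyD(1,2)[OF assms(2)]
  have i: "integrable M (\<lambda>x. 2 powr q * (energy u g x + energy v h x))"
    using assms by (auto dest: finite_energyD(3))
  have j: "integrable M (energy (\<lambda>x. u x + v x) (\<lambda>x. g x + h x))"
  proof (rule Bochner_Integration.integrable_bound[OF i])
    show "energy (\<lambda>x. u x + v x) (\<lambda>x. g x + h x) \<in> borel_measurable M" by (intro energy_measurable) auto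
    show "AE x in M. norm (energy (\<lambda>x. u x + v x) (\<lambda>x. g x + h x) x) \<le> norm (2 powr q * (energy u g x + energy v h x))"
    proof (intro AE_I2)
      fix x assume "x \<in> space M"
      then have x: "x \<in> \<Omega>" by simp
      show "norm (energy (\<lambda>x. u x + v x) (\<lambda>x. g x + h x) x) \<le> norm (2 powr q * (energy u g x + energy v h x))"
        using order_trans[OF energy_add_le[OF x, of u v g h] abs_ge_self] energy_nonneg[OF x] by simp
    qed
  qed
  then show "finite_energy (\<lambda>x. u x + v x) (\<lambda>x. g x + h x)" by (simp add: finite_energy_def)
  have "total_energy (\<lambda>x. u x + v x) (\<lambda>x. g x + h x) \<le> (\<integral>x. 2 powr q * (energy u g x + energy v h x) \<partial>M)"
    using energy_add_le by (intro integral_mono_AE i j AE_I2) auto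
  also have "\<dots> = 2 powr q * (total_energy u g + total_energy v h)"
    using assms by (simp add: finite_energyD(3))
  finally show "total_energy (\<lambda>x. u x + v x) (\<lambda>x. g x + h x) \<le> 2 powr q * (total_energy u g + total_energy v h)" .
qed

lemma finite_energy_minus: "finite_energy u g \<Longrightarrow> finite_energy (\<lambda>x. - u x) (\<lambda>x. - g x)"
  by (simp add: finite_energy_def energy_minus)

lemma
  assumes "finite_energy u g" "finite_energy v h"
  shows finite_energy_diff: "finite_energy (\<lambda>x. u x - v x) (\<lambda>x. g x - h x)"
    and total_energy_diff_le: "energy_dist u g v h \<le> 2 powr q * (total_energy u g + total_energy v h)"
  using finite_energy_add[OF assms(1) finite_energy_minus[OF assms(2)]]
    total_energy_add_le[OF assms(1) finite_energy_minus[OF assms(2)]] by (simp_all add: energy_minus)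

lemma energy_cmult_le:
  assumes x: "x \<in> \<Omega>"
  shows "energy (\<lambda>x. c * u x) (\<lambda>x. c *\<^sub>R g x) x \<le> (c\<^sup>2 + \<bar>c\<bar> powr q) * energy u g x"
proof -
  have "energy (\<lambda>x. c * u x) (\<lambda>x. c *\<^sub>R g x) x
      = c\<^sup>2 * ((u x)\<^sup>2 + (norm (g x))\<^sup>2) + \<bar>c\<bar> powr q * (\<mu> x * norm (g x) powr q)"
    by (simp add: energy_def power_mult_distrib powr_mult algebra_simps)
  also have "\<dots> \<le> (c\<^sup>2 + \<bar>c\<bar> powr q) * ((u x)\<^sup>2 + (norm (g x))\<^sup>2) + (c\<^sup>2 + \<bar>c\<bar> powr q) * (\<mu> x * norm (g x) powr q)"
    using mu(1)[OF x] by (intro add_mono mult_right_mono) auto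
  finally show ?thesis by (simp add: energy_def algebra_simps)
qed

lemma
  assumes "finite_energy u g"
  shows finite_energy_cmult: "finite_energy (\<lambda>x. c * u x) (\<lambda>x. c *\<^sub>R g x)"
    and total_energy_cmult_le: "total_energy (\<lambda>x. c * u x) (\<lambda>x. c *\<^sub>R g x) \<le> (c\<^sup>2 + \<bar>c\<bar> powr q) * total_energy u g"
proof -
  note [measurable] = finite_energyD(1,2)[OF assms]
  have i: "integrable M (\<lambda>x. (c\<^sup>2 + \<bar>c\<bar> powr q) * energy u g x)"
    using assms by (auto dest: finite_energyD(3))
  have j: "integrable M (energy (\<lambda>x. c * u x) (\<lambda>x. c *\<^sub>R g x))"
  proof (rule Bochner_Integration.integrable_bound[OF i])
    show "energy (\<lambda>x. c * u x) (\<lambda>x. c *\<^sub>R g x) \<in> borel_measurable M" by (intro energy_measurable) auto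
    show "AE x in M. norm (energy (\<lambda>x. c * u x) (\<lambda>x. c *\<^sub>R g x) x) \<le> norm ((c\<^sup>2 + \<bar>c\<bar> powr q) * energy u g x)"
    proof (intro AE_I2)
      fix x assume "x \<in> space M"
      then have x: "x \<in> \<Omega>" by simp
      show "norm (energy (\<lambda>x. c * u x) (\<lambda>x. c *\<^sub>R g x) x) \<le> norm ((c\<^sup>2 + \<bar>c\<bar> powr q) * energy u g x)"
        using order_trans[OF energy_cmult_le[OF x, of c u g] abs_ge_self] energy_nonneg[OF x] by simp
    qed
  qed
  then show "finite_energy (\<lambda>x. c * u x) (\<lambda>x. c *\<^sub>R g x)" by (simp add: finite_energy_def)
  have "total_energy (\<lambda>x. c * u x) (\<lambda>x. c *\<^sub>R g x) \<le> (\<integral>x. (c\<^sup>2 + \<bar>c\<bar> powr q) * energy u g x \<partial>M)"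
    using energy_cmult_le by (intro integral_mono_AE i j AE_I2) auto
  then show "total_energy (\<lambda>x. c * u x) (\<lambda>x. c *\<^sub>R g x) \<le> (c\<^sup>2 + \<bar>c\<bar> powr q) * total_energy u g" by simp
qed

lemma test_measurable:
  assumes "\<phi> \<in> test_functions \<Omega>"
  shows "\<phi> \<in> borel_measurable M" "grad \<phi> \<in> borel_measurable M"
  using test_function_continuous[OF assms] grad_continuous[OF assms] Omega_lebesgue
  by (auto intro: continuous_imp_measurable_on_sets_lebesgue)

lemma finite_energy_test:
  assumes \<phi>: "\<phi> \<in> test_functions \<Omega>"
  shows "finite_energy \<phi> (grad \<phi>)"
proof -
  obtain C where C: "C \<ge> 0" "\<And>x. \<bar>\<phi> x\<bar> \<le> C" using test_function_bounded[OF \<phi>] by auto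
  obtain G where G: "G \<ge> 0" "\<And>x. norm (grad \<phi> x) \<le> G" using grad_bounded[OF \<phi>] by auto
  have "integrable M (energy \<phi> (grad \<phi>))"
  proof (rule integrable_const_bound)
    show "energy \<phi> (grad \<phi>) \<in> borel_measurable M" by (intro energy_measurable test_measurable[OF \<phi>])
    show "AE x in M. norm (energy \<phi> (grad \<phi>) x) \<le> C\<^sup>2 + G\<^sup>2 + B * G powr q"
    proof (intro AE_I2)
      fix x assume "x \<in> space M"
      then have x: "x \<in> \<Omega>" by simp
      have "(\<phi> x)\<^sup>2 \<le> C\<^sup>2" using C(2)[of x] by (metis abs_ge_zero power2_abs power_mono)
      moreover have "(norm (grad \<phi> x))\<^sup>2 \<le> G\<^sup>2" using G(2) by (intro power_mono) auto
      moreover have "\<mu> x * norm (grad \<phi> x) powr q \<le> B * G powr q"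
        using mu[OF x] G(2) B_nonneg q(1) by (intro mult_mono powr_mono2) auto
      ultimately show "norm (energy \<phi> (grad \<phi>) x) \<le> C\<^sup>2 + G\<^sup>2 + B * G powr q"
        using energy_nonneg[OF x] by (simp add: energy_def)
    qed
  qed
  then show ?thesis using test_measurable[OF \<phi>] by (simp add: finite_energy_def)
qed

text \<open>The closure of the test functions in energy.  Its elements are pairs of a function and a gradient, which
  keeps all limit arguments free of the choice of a representative of the weak gradient.\<close>

definition W0 :: "(real^'n \<Rightarrow> real) \<Rightarrow> (real^'n \<Rightarrow> real^'n) \<Rightarrow> bool" where
  "W0 u g \<longleftrightarrow> finite_energy u g \<and>
    (\<forall>\<epsilon>>0. \<exists>\<phi>\<in>test_functions \<Omega>. energy_dist u g \<phi> (grad \<phi>) < \<epsilon>)"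

lemma W0_finite_energy: "W0 u g \<Longrightarrow> finite_energy u g"
  by (simp add: W0_def)

lemma W0_approx:
  assumes "W0 u g" "\<epsilon> > 0"
  obtains \<phi> where "\<phi> \<in> test_functions \<Omega>" "energy_dist u g \<phi> (grad \<phi>) < \<epsilon>"
  using assms unfolding W0_def by blast

lemma W0_approx_sequence:
  assumes "W0 u g"
  obtains \<phi> where "\<And>n. \<phi> n \<in> test_functions \<Omega>"
    "\<And>n. energy_dist u g (\<phi> n) (grad (\<phi> n)) < 1 / real (Suc n)"
proof -
  have "\<forall>n. \<exists>\<phi>\<in>test_functions \<Omega>. energy_dist u g \<phi> (grad \<phi>) < 1 / real (Suc n)"
    using assms unfolding W0_def by simp
  then show thesis using that by metis
qed

lemma W0_test: "\<phi> \<in> test_functions \<Omega> \<Longrightarrow> W0 \<phi> (grad \<phi>)"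
proof -
  assume "\<phi> \<in> test_functions \<Omega>"
  moreover have "energy (\<lambda>x. 0) (\<lambda>x. 0) = (\<lambda>x. 0)" by (simp add: energy_def fun_eq_iff)
  ultimately show ?thesis by (auto simp: W0_def finite_energy_test intro!: bexI[of _ \<phi>])
qed

lemma W0_add:
  assumes "W0 u g" "W0 v h"
  shows "W0 (\<lambda>x. u x + v x) (\<lambda>x. g x + h x)"
  unfolding W0_def
proof (intro conjI allI impI)
  note fe = W0_finite_energy[OF assms(1)] W0_finite_energy[OF assms(2)]
  show "finite_energy (\<lambda>x. u x + v x) (\<lambda>x. g x + h x)" by (intro finite_energy_add fe)
  fix \<epsilon> :: real assume \<epsilon>: "\<epsilon> > 0"
  define e where "e = \<epsilon> / (2 * 2 powr q)"
  have e: "e > 0" using \<epsilon> by (simp add: e_def)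
  obtain \<phi> where \<phi>: "\<phi> \<in> test_functions \<Omega>" "energy_dist u g \<phi> (grad \<phi>) < e"
    using W0_approx[OF assms(1) e] .
  obtain \<psi> where \<psi>: "\<psi> \<in> test_functions \<Omega>" "energy_dist v h \<psi> (grad \<psi>) < e"
    using W0_approx[OF assms(2) e] .
  have "total_energy (\<lambda>x. (u x - \<phi> x) + (v x - \<psi> x)) (\<lambda>x. (g x - grad \<phi> x) + (h x - grad \<psi> x))
      \<le> 2 powr q * (energy_dist u g \<phi> (grad \<phi>) + energy_dist v h \<psi> (grad \<psi>))"
    by (intro total_energy_add_le finite_energy_diff fe finite_energy_test \<phi> \<psi>)
  also have "\<dots> < 2 powr q * (e + e)" using \<phi>(2) \<psi>(2) by (intro mult_strict_left_mono) auto
  also have "\<dots> = \<epsilon>" by (simp add: e_def)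
  finally show "\<exists>\<phi>\<in>test_functions \<Omega>. total_energy (\<lambda>x. u x + v x - \<phi> x) (\<lambda>x. g x + h x - grad \<phi> x) < \<epsilon>"
    using \<phi>(1) \<psi>(1) by (intro bexI[of _ "\<lambda>x. \<phi> x + \<psi> x"] test_function_add) (simp_all add: grad_add algebra_simps)
qed

lemma W0_cmult:
  assumes "W0 u g"
  shows "W0 (\<lambda>x. c * u x) (\<lambda>x. c *\<^sub>R g x)"
  unfolding W0_def
proof (intro conjI allI impI)
  note fe = W0_finite_energy[OF assms(1)]
  show "finite_energy (\<lambda>x. c * u x) (\<lambda>x. c *\<^sub>R g x)" by (intro finite_energy_cmult fe)
  fix \<epsilon> :: real assume \<epsilon>: "\<epsilon> > 0"
  define k where "k = c\<^sup>2 + \<bar>c\<bar> powr q + 1"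
  have k: "k > 0" by (simp add: k_def add_nonneg_pos)
  obtain \<phi> where \<phi>: "\<phi> \<in> test_functions \<Omega>" "energy_dist u g \<phi> (grad \<phi>) < \<epsilon> / k"
    using W0_approx[OF assms(1), of "\<epsilon> / k"] \<epsilon> k by auto
  have "total_energy (\<lambda>x. c * (u x - \<phi> x)) (\<lambda>x. c *\<^sub>R (g x - grad \<phi> x))
      \<le> (c\<^sup>2 + \<bar>c\<bar> powr q) * energy_dist u g \<phi> (grad \<phi>)"
    by (intro total_energy_cmult_le finite_energy_diff fe finite_energy_test \<phi>)
  also have "\<dots> \<le> k * energy_dist u g \<phi> (grad \<phi>)"
    by (intro mult_right_mono total_energy_nonneg) (simp add: k_def)
  also have "\<dots> < \<epsilon>" using \<phi>(2) k by (simp add: field_simps)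
  finally show "\<exists>\<phi>\<in>test_functions \<Omega>. total_energy (\<lambda>x. c * u x - \<phi> x) (\<lambda>x. c *\<^sub>R g x - grad \<phi> x) < \<epsilon>"
    using \<phi>(1) by (intro bexI[of _ "\<lambda>x. c * \<phi> x"] test_function_cmult) (simp_all add: grad_cmult algebra_simps)
qed

lemma W0_diff: "W0 u g \<Longrightarrow> W0 v h \<Longrightarrow> W0 (\<lambda>x. u x - v x) (\<lambda>x. g x - h x)"
  using W0_add[OF _ W0_cmult[of v h "-1"]] by simp

lemma W0_cong_AE:
  assumes "W0 u g" "AE x in M. g x = h x" and [measurable]: "h \<in> borel_measurable M"
  shows "W0 u h"
proof -
  note [measurable] = finite_energyD(1,2)[OF W0_finite_energy[OF assms(1)]]
  have "integrable M (energy u h)"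
  proof (rule integrable_cong_AE_imp[OF finite_energyD(3)[OF W0_finite_energy[OF assms(1)]]])
    show "energy u h \<in> borel_measurable M" by (intro energy_measurable) auto
    show "AE x in M. energy u g x = energy u h x" using assms(2) by eventually_elim (simp add: energy_def)
  qed
  moreover have "energy_dist u h \<phi> (grad \<phi>) = energy_dist u g \<phi> (grad \<phi>)"
    if "\<phi> \<in> test_functions \<Omega>" for \<phi>
  proof (rule integral_cong_AE)
    note [measurable] = test_measurable[OF that]
    show "energy (\<lambda>x. u x - \<phi> x) (\<lambda>x. h x - grad \<phi> x) \<in> borel_measurable M"
      "energy (\<lambda>x. u x - \<phi> x) (\<lambda>x. g x - grad \<phi> x) \<in> borel_measurable M"
      by (intro energy_measurable; measurable)+
    show "AE x in M. energy (\<lambda>x. u x - \<phi> x) (\<lambda>x. h x - grad \<phi> x) x = energy (\<lambda>x. u x - \<phi> x) (\<lambda>x. g x - grad \<phi> x) x"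
      using assms(2) by eventually_elim (simp add: energy_def)
  qed
  ultimately show ?thesis using assms(1) by (auto simp: W0_def finite_energy_def)
qed

text \<open>Completeness: a Cauchy sequence has an almost everywhere convergent subsequence, and Fatou's lemma turns
  the pointwise limit into a limit in energy.\<close>

lemma W0_complete:
  assumes W: "\<And>n. W0 (u n) (g n)"
    and cauchy: "\<And>\<epsilon>. \<epsilon> > 0 \<Longrightarrow> \<exists>N. \<forall>i\<ge>N. \<forall>j\<ge>N. energy_dist (u i) (g i) (u j) (g j) < \<epsilon>"
  obtains u' g' s where "W0 u' g'" "strict_mono (s :: nat \<Rightarrow> nat)"
    "AE x in M. (\<lambda>i. u (s i) x) \<longlonglongrightarrow> u' x" "AE x in M. (\<lambda>i. g (s i) x) \<longlonglongrightarrow> g' x"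
    "(\<lambda>n. energy_dist (u n) (g n) u' g') \<longlonglongrightarrow> 0"
proof -
  note fe = W0_finite_energy[OF W]
  note [measurable] = finite_energyD(1,2)[OF fe]
  define p where "p n x = (u n x, g n x)" for n x
  have pm[measurable]: "p n \<in> borel_measurable M" for n unfolding p_def by measurable
  have pn: "norm (p i x - p j x) \<le> \<delta> + energy (\<lambda>x. u i x - u j x) (\<lambda>x. g i x - g j x) x / \<delta>"
    if "x \<in> \<Omega>" "\<delta> > 0" for i j x \<delta>
  proof -
    let ?t = "norm (p i x - p j x)"
    have "?t \<le> \<delta> + ?t\<^sup>2 / \<delta>"
    proof (cases "?t \<le> \<delta>")
      case False
      then have "?t * \<delta> \<le> ?t\<^sup>2" by (simp add: power2_eq_square mult_left_mono)
      then have "?t \<le> ?t\<^sup>2 / \<delta>" using that by (simp add: field_simps)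
      then show ?thesis using that by simp
    qed (use that in \<open>simp add: add_increasing2\<close>)
    moreover have "?t\<^sup>2 \<le> energy (\<lambda>x. u i x - u j x) (\<lambda>x. g i x - g j x) x"
      using mu(1)[OF that(1)] by (simp add: p_def norm_Pair energy_def)
    ultimately show ?thesis using that by (meson add_left_mono divide_right_mono less_imp_le order_trans)
  qed
  have pint: "integrable M (p n)" for n
  proof (rule Bochner_Integration.integrable_bound)
    show "integrable M (\<lambda>x. 1 + energy (u n) (g n) x)" using finite_energyD(3)[OF fe] by simp
    show "AE x in M. norm (p n x) \<le> norm (1 + energy (u n) (g n) x)"
    proof (intro AE_I2)
      fix x assume "x \<in> space M"
      then have x: "x \<in> \<Omega>" by simp
      have "norm (p n x) \<le> 1 + (norm (p n x))\<^sup>2"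
      proof -
        have "2 * norm (p n x) \<le> 1 + (norm (p n x))\<^sup>2" using sum_squares_bound[of 1 "norm (p n x)"] by simp
        then show ?thesis using norm_ge_zero[of "p n x"] by linarith
      qed
      moreover have "(norm (p n x))\<^sup>2 \<le> energy (u n) (g n) x"
        using mu(1)[OF x] by (simp add: p_def norm_Pair energy_def)
      ultimately show "norm (p n x) \<le> norm (1 + energy (u n) (g n) x)"
        unfolding real_norm_def by linarith
    qed
  qed (rule pm)
  have L1: "\<exists>N. \<forall>i\<ge>N. \<forall>j\<ge>N. (LINT x|M. norm (p i x - p j x)) < e" if e: "e > 0" for e
  proof -
    define \<delta> where "\<delta> = e / (2 * (measure M (space M) + 1))"
    have m: "measure M (space M) + 1 > 0" by (simp add: add_nonneg_pos)
    have \<delta>: "\<delta> > 0" "\<delta> * measure M (space M) < e / 2" using e m by (auto simp: \<delta>_def field_simps)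
    obtain N where N: "\<And>i j. i \<ge> N \<Longrightarrow> j \<ge> N \<Longrightarrow> energy_dist (u i) (g i) (u j) (g j) < \<delta> * e / 2"
      using cauchy[of "\<delta> * e / 2"] \<delta>(1) e by auto
    have "(LINT x|M. norm (p i x - p j x)) < e" if ij: "i \<ge> N" "j \<ge> N" for i j
    proof -
      note E = finite_energyD(3)[OF finite_energy_diff[OF fe fe], of i j]
      have "(LINT x|M. norm (p i x - p j x)) \<le> (LINT x|M. \<delta> + energy (\<lambda>x. u i x - u j x) (\<lambda>x. g i x - g j x) x / \<delta>)"
        using pint E \<delta>(1) pn by (intro integral_mono_AE AE_I2) auto
      also have "\<dots> = \<delta> * measure M (space M) + energy_dist (u i) (g i) (u j) (g j) / \<delta>"
        using E by (subst Bochner_Integration.integral_add) auto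
      also have "\<dots> < e / 2 + e / 2"
        using \<delta> N[OF ij] by (intro add_strict_mono) (auto simp: field_simps)
      finally show ?thesis by simp
    qed
    then show ?thesis by blast
  qed
  obtain s where s: "strict_mono s" "AE x in M. Cauchy (\<lambda>i. p (s i) x)"
    by (rule cauchy_L1_AE_cauchy_subseq[OF pint L1])
  define p' where "p' x = lim (\<lambda>i. p (s i) x)" for x
  have p'm[measurable]: "p' \<in> borel_measurable M" unfolding p'_def by measurable
  define u' where "u' x = fst (p' x)" for x
  define g' where "g' x = snd (p' x)" for x
  have p'pair: "p' \<in> M \<rightarrow>\<^sub>M borel \<Otimes>\<^sub>M borel" using p'm by (simp only: borel_prod)
  have [measurable]: "u' \<in> borel_measurable M" "g' \<in> borel_measurable M"
    unfolding u'_def g'_def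
    using measurable_compose[OF p'pair measurable_fst] measurable_compose[OF p'pair measurable_snd] by auto
  have conv: "AE x in M. (\<lambda>i. p (s i) x) \<longlonglongrightarrow> p' x"
    using s(2) by eventually_elim (simp add: p'_def convergent_LIMSEQ_iff Cauchy_convergent_iff)
  have cu: "AE x in M. (\<lambda>i. u (s i) x) \<longlonglongrightarrow> u' x"
    using conv by eventually_elim (auto dest!: tendsto_fst simp: u'_def p_def)
  have cg: "AE x in M. (\<lambda>i. g (s i) x) \<longlonglongrightarrow> g' x"
    using conv by eventually_elim (auto dest!: tendsto_snd simp: g'_def p_def)
  have key: "\<exists>N. \<forall>n\<ge>N. integrable M (energy (\<lambda>x. u n x - u' x) (\<lambda>x. g n x - g' x)) \<and>
      energy_dist (u n) (g n) u' g' \<le> \<epsilon>" if \<epsilon>: "\<epsilon> > 0" for \<epsilon>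
  proof -
    obtain N where N: "\<And>i j. i \<ge> N \<Longrightarrow> j \<ge> N \<Longrightarrow> energy_dist (u i) (g i) (u j) (g j) < \<epsilon>"
      using cauchy[OF \<epsilon>] by auto
    have "integrable M (energy (\<lambda>x. u n x - u' x) (\<lambda>x. g n x - g' x)) \<and>
      energy_dist (u n) (g n) u' g' \<le> \<epsilon>" if n: "n \<ge> N" for n
    proof -
      let ?f = "\<lambda>i. energy (\<lambda>x. u n x - u (s i) x) (\<lambda>x. g n x - g (s i) x)"
      have a: "integrable M (?f i)" for i
        by (intro finite_energyD(3) finite_energy_diff fe)
      have b: "AE x in M. 0 \<le> ?f i x" for i using energy_nonneg by (intro AE_I2) auto
      have c: "energy (\<lambda>x. u n x - u' x) (\<lambda>x. g n x - g' x) \<in> borel_measurable M"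
        by (intro energy_measurable) measurable
      have d: "AE x in M. (\<lambda>i. ?f i x) \<longlonglongrightarrow> energy (\<lambda>x. u n x - u' x) (\<lambda>x. g n x - g' x) x"
        using cu cg
      proof eventually_elim
        case (elim x)
        have pw: "(\<lambda>i. norm (g n x - g (s i) x) powr q) \<longlonglongrightarrow> norm (g n x - g' x) powr q"
          using q(1) by (intro tendsto_powr2 tendsto_intros elim) auto
        show ?case
          unfolding energy_def by (intro tendsto_add tendsto_mult tendsto_power tendsto_norm tendsto_diff tendsto_const elim pw)
      qed
      have e: "energy_dist (u n) (g n) (u (s i)) (g (s i)) \<le> \<epsilon>" if "i \<ge> N" for i
        using N[of n "s i"] n that seq_suble[OF s(1), of i] by simp
      show ?thesis using Fatou_integral[OF a b c d e] by blast
    qed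
    then show ?thesis by blast
  qed
  have fe_lim: "finite_energy (\<lambda>x. u n x - u' x) (\<lambda>x. g n x - g' x) "
    if "integrable M (energy (\<lambda>x. u n x - u' x) (\<lambda>x. g n x - g' x))" for n
    using that by (simp add: finite_energy_def)
  have fe': "finite_energy u' g'"
  proof -
    obtain N where "integrable M (energy (\<lambda>x. u N x - u' x) (\<lambda>x. g N x - g' x))" using key[of 1] by auto
    from finite_energy_diff[OF fe[of N] fe_lim[OF this]] show ?thesis by simp
  qed
  have "W0 u' g'"
    unfolding W0_def
  proof (intro conjI fe' allI impI)
    fix \<epsilon> :: real assume \<epsilon>: "\<epsilon> > 0"
    define e where "e = \<epsilon> / (3 * 2 powr q)"
    have e: "e > 0" using \<epsilon> by (simp add: e_def)
    obtain n where n: "integrable M (energy (\<lambda>x. u n x - u' x) (\<lambda>x. g n x - g' x))"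
      "energy_dist (u n) (g n) u' g' \<le> e" using key[OF e] by blast
    obtain \<phi> where \<phi>: "\<phi> \<in> test_functions \<Omega>" "energy_dist (u n) (g n) \<phi> (grad \<phi>) < e"
      using W0_approx[OF W e] .
    have "total_energy (\<lambda>x. (u n x - \<phi> x) - (u n x - u' x)) (\<lambda>x. (g n x - grad \<phi> x) - (g n x - g' x))
      \<le> 2 powr q * (energy_dist (u n) (g n) \<phi> (grad \<phi>) + energy_dist (u n) (g n) u' g')"
      by (intro total_energy_diff_le fe_lim n finite_energy_diff fe finite_energy_test \<phi>)
    also have "\<dots> < 2 powr q * (e + e)" using n(2) \<phi>(2) by (intro mult_strict_left_mono) auto
    also have "\<dots> < \<epsilon>" using \<epsilon> by (simp add: e_def)
    finally show "\<exists>\<phi>\<in>test_functions \<Omega>. energy_dist u' g' \<phi> (grad \<phi>) < \<epsilon>"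
      using \<phi>(1) by (intro bexI[of _ \<phi>]) auto
  qed
  moreover have "(\<lambda>n. energy_dist (u n) (g n) u' g') \<longlonglongrightarrow> 0"
  proof (rule LIMSEQ_I)
    fix r :: real assume "r > 0"
    then obtain N where "\<forall>n\<ge>N. energy_dist (u n) (g n) u' g' \<le> r / 2"
      using key[of "r / 2"] by auto
    then show "\<exists>no. \<forall>n\<ge>no. norm (energy_dist (u n) (g n) u' g' - 0) < r"
      using \<open>r > 0\<close> total_energy_nonneg by (intro exI[of _ N]) fastforce
  qed
  ultimately show thesis using that s(1) cu cg by blast
qed

end

section \<open>The energy space is the Musielak--Orlicz--Sobolev space\<close>

lemma integrable_lebesgue_on_subset:
  fixes f :: "'a::euclidean_space \<Rightarrow> 'b::{banach, second_countable_topology}"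
  assumes "integrable (lebesgue_on S) f" "T \<subseteq> S" "S \<in> sets lebesgue" "T \<in> sets lebesgue"
  shows "integrable (lebesgue_on T) f"
proof -
  have "integrable lebesgue (\<lambda>x. indicator T x *\<^sub>R (indicator S x *\<^sub>R f x))"
    using assms by (intro integrable_mult_indicator[where A = T]) (simp_all add: integrable_restrict_space)
  also have "(\<lambda>x. indicator T x *\<^sub>R (indicator S x *\<^sub>R f x)) = (\<lambda>x. indicator T x *\<^sub>R f x)"
    using assms(2) by (auto simp: indicator_def fun_eq_iff)
  finally show ?thesis using assms(4) by (simp add: integrable_restrict_space)
qed

lemma borel_measurable_vec_nth [measurable (raw)]:
  fixes f :: "'a \<Rightarrow> real^'n::finite"
  shows "f \<in> borel_measurable N \<Longrightarrow> (\<lambda>x. f x $ i) \<in> borel_measurable N"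
  by (rule measurable_compose[OF _ borel_measurable_continuous_onI]) (auto intro!: continuous_intros)

lemma eq_0_if_sq_le:
  fixes a C :: real
  assumes "\<And>\<epsilon>. \<epsilon> > 0 \<Longrightarrow> a\<^sup>2 \<le> \<epsilon> * C"
  shows "a = 0"
proof (rule ccontr)
  assume "a \<noteq> 0"
  then have a: "a\<^sup>2 > 0" by simp
  define e where "e = a\<^sup>2 / (2 * (\<bar>C\<bar> + 1))"
  have pos: "2 * (\<bar>C\<bar> + 1) > 0" by (simp add: add_nonneg_pos)
  have e: "e > 0" using a pos by (simp add: e_def)
  have "a\<^sup>2 \<le> e * \<bar>C\<bar>" using order_trans[OF assms[OF e] mult_left_mono[OF abs_ge_self]] e by simp
  also have "\<dots> < e * (2 * (\<bar>C\<bar> + 1))" using e by (intro mult_strict_left_mono) auto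
  also have "\<dots> = a\<^sup>2" unfolding e_def using pos by (intro nonzero_eq_divide_eq[THEN iffD1]) auto
  finally show False by simp
qed

context phase_domain
begin

lemma W0_locally_integrable:
  assumes "W0 u g"
  shows "locally_integrable \<Omega> u" "locally_integrable \<Omega> g"
proof -
  note fe = W0_finite_energy[OF assms]
  note [measurable] = finite_energyD(1,2)[OF fe]
  have u: "integrable M u" by (rule square_integrable_imp_integrable) (use sq_integrable[OF fe] in auto)
  have "integrable M (\<lambda>x. norm (g x))"
    by (rule square_integrable_imp_integrable) (use grad_sq_int[OF fe] in auto)
  then have g: "integrable M g" by (subst (asm) integrable_norm_iff) auto
  show "locally_integrable \<Omega> u" "locally_integrable \<Omega> g"
    unfolding locally_integrable_def
    using integrable_lebesgue_on_subset[OF u _ Omega_lebesgue] integrable_lebesgue_on_subset[OF g _ Omega_lebesgue]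
    by (auto simp: lmeasurable_compact fmeasurableD)
qed

text \<open>The defining identity holds for test functions, and both of its sides are continuous in the square norm.\<close>

lemma W0_weak_gradient:
  assumes "W0 u g"
  shows "is_weak_gradient \<Omega> u g"
  unfolding is_weak_gradient_def
proof (intro conjI ballI allI)
  note fe = W0_finite_energy[OF assms]
  note loc = W0_locally_integrable[OF assms]
  note [measurable] = finite_energyD(1,2)[OF fe]
  show "locally_integrable \<Omega> u" "locally_integrable \<Omega> g" by fact+
  fix \<phi> i assume \<phi>: "\<phi> \<in> test_functions \<Omega>"
  have pd: "continuous_on UNIV (partial_deriv i \<phi>)"
    by (rule C_n_imp_continuous_on[OF partial_deriv_C_n[OF \<phi>, of 0]])
  have pd0: "partial_deriv i \<phi> x = 0" if "grad \<phi> x = 0" for x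
    using that by (metis grad_nth zero_index)
  note [measurable] = test_measurable[OF \<phi>]
  have [measurable]: "partial_deriv i \<phi> \<in> borel_measurable M"
    using pd Omega_lebesgue by (intro continuous_imp_measurable_on_sets_lebesgue) (auto intro: continuous_on_subset)
  have pdsq: "integrable M (\<lambda>x. (partial_deriv i \<phi> x)\<^sup>2)"
  proof -
    have "integrable lborel (\<lambda>x. (partial_deriv i \<phi> x)\<^sup>2)"
      by (rule test_function_integrable[OF \<phi>]) (use pd pd0 in \<open>auto intro!: continuous_intros\<close>)
    then show ?thesis using Omega_lebesgue grad_eq_0[OF \<phi>] pd0
      by (subst integrable_lebesgue_on_eq) auto
  qed
  note phisq = sq_integrable[OF finite_energy_test[OF \<phi>]]
  have iu: "integrable M (\<lambda>x. u x * partial_deriv i \<phi> x)"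
    by (rule locally_integrable_mult_test[OF open_Omega loc(1) \<phi> pd]) (use pd0 in auto)
  have ig: "integrable M (\<lambda>x. g x $ i * \<phi> x)"
    by (rule locally_integrable_mult_test[OF open_Omega locally_integrable_nth[OF loc(2)] \<phi> test_function_continuous[OF \<phi>]]) auto
  let ?S = "(LINT x|M. u x * partial_deriv i \<phi> x) + (LINT x|M. g x $ i * \<phi> x)"
  have "?S\<^sup>2 \<le> \<epsilon> * (2 * ((LINT x|M. (partial_deriv i \<phi> x)\<^sup>2) + (LINT x|M. (\<phi> x)\<^sup>2)))" if \<epsilon>: "\<epsilon> > 0" for \<epsilon>
  proof -
    obtain \<psi> where \<psi>: "\<psi> \<in> test_functions \<Omega>" "energy_dist u g \<psi> (grad \<psi>) < \<epsilon>"
      using W0_approx[OF assms \<epsilon>] .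
    note [measurable] = test_measurable[OF \<psi>(1)]
    have w\<psi>: "W0 \<psi> (grad \<psi>)" by (rule W0_test[OF \<psi>(1)])
    have fd: "finite_energy (\<lambda>x. u x - \<psi> x) (\<lambda>x. g x - grad \<psi> x)"
      by (intro finite_energy_diff fe finite_energy_test \<psi>)
    have i\<psi>: "integrable M (\<lambda>x. \<psi> x * partial_deriv i \<phi> x)"
      by (rule locally_integrable_mult_test[OF open_Omega W0_locally_integrable(1)[OF w\<psi>] \<phi> pd]) (use pd0 in auto)
    have ig\<psi>: "integrable M (\<lambda>x. grad \<psi> x $ i * \<phi> x)"
      by (rule locally_integrable_mult_test[OF open_Omega locally_integrable_nth[OF W0_locally_integrable(2)[OF w\<psi>]] \<phi>
            test_function_continuous[OF \<phi>]]) auto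
    have parts: "(LINT x|M. \<psi> x * partial_deriv i \<phi> x) = - (LINT x|M. grad \<psi> x $ i * \<phi> x)"
      using test_function_weak_gradient[OF open_Omega \<psi>(1)] \<phi> unfolding is_weak_gradient_def by blast
    define a where "a = (LINT x|M. (u x - \<psi> x) * partial_deriv i \<phi> x)"
    define b where "b = (LINT x|M. (g x $ i - grad \<psi> x $ i) * \<phi> x)"
    have "?S = a + b"
      unfolding a_def b_def left_diff_distrib
      by (simp only: Bochner_Integration.integral_diff[OF iu i\<psi>] Bochner_Integration.integral_diff[OF ig ig\<psi>] parts)
    then have "?S\<^sup>2 \<le> 2 * (a\<^sup>2 + b\<^sup>2)" using sum_squares_bound[of a b] by (simp add: power2_sum)
    moreover have "a\<^sup>2 \<le> \<epsilon> * (LINT x|M. (partial_deriv i \<phi> x)\<^sup>2)"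
    proof -
      have "a\<^sup>2 \<le> (LINT x|M. (u x - \<psi> x)\<^sup>2) * (LINT x|M. (partial_deriv i \<phi> x)\<^sup>2)"
        unfolding a_def by (rule Cauchy_Schwarz_integral(2)) (use sq_integrable[OF fd] pdsq in auto)
      also have "\<dots> \<le> \<epsilon> * (LINT x|M. (partial_deriv i \<phi> x)\<^sup>2)"
        using order_trans[OF integral_sq_le[OF fd] less_imp_le[OF \<psi>(2)]] by (intro mult_right_mono) auto
      finally show ?thesis .
    qed
    moreover have "b\<^sup>2 \<le> \<epsilon> * (LINT x|M. (\<phi> x)\<^sup>2)"
    proof -
      have le: "(g x $ i - grad \<psi> x $ i)\<^sup>2 \<le> (norm (g x - grad \<psi> x))\<^sup>2" for x
        using component_le_norm_cart[of "g x - grad \<psi> x" i] by (simp add: abs_le_square_iff[symmetric] del: grad_nth)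
      have int: "integrable M (\<lambda>x. (g x $ i - grad \<psi> x $ i)\<^sup>2)"
        by (rule Bochner_Integration.integrable_bound[OF grad_sq_int[OF fd]]) (use le in \<open>auto simp del: grad_nth\<close>)
      have "b\<^sup>2 \<le> (LINT x|M. (g x $ i - grad \<psi> x $ i)\<^sup>2) * (LINT x|M. (\<phi> x)\<^sup>2)"
        unfolding b_def by (rule Cauchy_Schwarz_integral(2)) (use int phisq in \<open>auto simp del: grad_nth\<close>)
      also have "\<dots> \<le> \<epsilon> * (LINT x|M. (\<phi> x)\<^sup>2)"
      proof (rule mult_right_mono)
        have "(LINT x|M. (g x $ i - grad \<psi> x $ i)\<^sup>2) \<le> (LINT x|M. (norm (g x - grad \<psi> x))\<^sup>2)"
          by (intro integral_mono int grad_sq_int[OF fd] le)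
        also have "\<dots> \<le> \<epsilon>" using order_trans[OF integral_grad_sq_le[OF fd] less_imp_le[OF \<psi>(2)]] .
        finally show "(LINT x|M. (g x $ i - grad \<psi> x $ i)\<^sup>2) \<le> \<epsilon>" .
      qed simp
      finally show ?thesis .
    qed
    ultimately show ?thesis by (simp add: algebra_simps)
  qed
  then have "?S = 0" by (rule eq_0_if_sq_le)
  then show "(LINT x|M. u x * partial_deriv i \<phi> x) = - (LINT x|M. g x $ i * \<phi> x)" by simp
qed

lemma W0_weak_grad:
  assumes "W0 u g"
  shows "AE x in M. weak_grad \<Omega> u x = g x" "weak_grad \<Omega> u \<in> borel_measurable M" "W0 u (weak_grad \<Omega> u)"
proof -
  note wg = W0_weak_gradient[OF assms]
  have wg': "is_weak_gradient \<Omega> u (weak_grad \<Omega> u)" by (rule weak_grad_is_weak_gradient[OF wg])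
  show ae: "AE x in M. weak_grad \<Omega> u x = g x" by (rule weak_gradient_unique[OF open_Omega wg' wg])
  show m: "weak_grad \<Omega> u \<in> borel_measurable M"
    using wg' by (intro locally_integrable_measurable[OF open_Omega]) (simp add: is_weak_gradient_def)
  show "W0 u (weak_grad \<Omega> u)" by (rule W0_cong_AE[OF assms _ m]) (use ae in auto)
qed

lemma dirichlet_eq: "\<phi> \<in> test_functions \<Omega> \<Longrightarrow> dirichlet \<phi> = (\<integral>x. (norm (grad \<phi> x))\<^sup>2 \<partial>M)"
  unfolding dirichlet_def using Omega_lebesgue grad_borel[of \<phi> \<Omega>] grad_eq_0[of \<phi> \<Omega>]
  by (intro integral_lebesgue_on_eq[symmetric]) auto

lemma integral_sq_test: "\<phi> \<in> test_functions \<Omega> \<Longrightarrow> (\<integral>x. (\<phi> x)\<^sup>2 \<partial>M) = (\<integral>x. (\<phi> x)\<^sup>2 \<partial>lborel)"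
  using Omega_lebesgue test_function_borel[of \<phi> \<Omega>] test_function_eq_0[of \<phi> \<Omega>]
  by (intro integral_lebesgue_on_eq) auto

lemma norm_sq_add_le:
  fixes a b :: "'b::real_inner"
  assumes "\<eta> > 0"
  shows "(norm (a + b))\<^sup>2 \<le> (1 + \<eta>) * (norm a)\<^sup>2 + (1 + 1 / \<eta>) * (norm b)\<^sup>2"
proof -
  have "2 * (a \<bullet> b) \<le> 2 * (norm a * norm b)" using norm_cauchy_schwarz[of a b] by simp
  also have "\<dots> = 2 * (sqrt \<eta> * norm a) * (norm b / sqrt \<eta>)" using assms by simp
  also have "\<dots> \<le> (sqrt \<eta> * norm a)\<^sup>2 + (norm b / sqrt \<eta>)\<^sup>2" by (rule sum_squares_bound)
  also have "\<dots> = \<eta> * (norm a)\<^sup>2 + 1 / \<eta> * (norm b)\<^sup>2" using assms by (simp add: power_mult_distrib power_divide)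
  finally show ?thesis
    by (simp add: power2_norm_eq_inner inner_add_left inner_add_right inner_commute algebra_simps)
qed

text \<open>The Sobolev inequality passes to limits of test functions by Fatou's lemma.\<close>

lemma W0_sobolev:
  "\<exists>C\<ge>0. \<forall>u g \<delta>. W0 u g \<longrightarrow> \<delta> > 0 \<longrightarrow> (\<integral>x. (norm (g x))\<^sup>2 \<partial>M) < \<delta>\<^sup>2 \<longrightarrow>
    integrable M (\<lambda>x. \<bar>u x\<bar> powr q) \<and> (\<integral>x. \<bar>u x\<bar> powr q \<partial>M) \<le> C * \<delta> powr q"
proof -
  have q0: "0 < q" using q(1) by simp
  obtain C where C: "C \<ge> 0" "\<And>\<phi> \<delta>. \<phi> \<in> test_functions \<Omega> \<Longrightarrow> \<delta> > 0 \<Longrightarrow> dirichlet \<phi> \<le> \<delta>\<^sup>2 \<Longrightarrow>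
      (\<integral>\<^sup>+x. ennreal (\<bar>\<phi> x\<bar> powr q) \<partial>lborel) \<le> ennreal (C * \<delta> powr q)"
    using sobolev_test_function[OF bounded_Omega q0 q(2)] by blast
  have test: "integrable M (\<lambda>x. \<bar>\<phi> x\<bar> powr q) \<and> (\<integral>x. \<bar>\<phi> x\<bar> powr q \<partial>M) \<le> C * \<delta> powr q"
    if \<phi>: "\<phi> \<in> test_functions \<Omega>" and \<delta>: "\<delta> > 0" "dirichlet \<phi> \<le> \<delta>\<^sup>2" for \<phi> \<delta>
  proof -
    note [measurable] = test_measurable[OF \<phi>]
    have le: "(\<integral>\<^sup>+x. ennreal (\<bar>\<phi> x\<bar> powr q) \<partial>M) \<le> ennreal (C * \<delta> powr q)"
      by (rule order_trans[OF nn_integral_lebesgue_on_le[OF Omega_lebesgue] C(2)[OF \<phi> \<delta>]])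
    then have int: "integrable M (\<lambda>x. \<bar>\<phi> x\<bar> powr q)"
      by (intro integrableI_nonneg) (auto intro: le_less_trans)
    show ?thesis using le C(1) int by (subst (asm) nn_integral_eq_integral) (auto simp: ennreal_le_iff)
  qed
  have "integrable M (\<lambda>x. \<bar>u x\<bar> powr q) \<and> (\<integral>x. \<bar>u x\<bar> powr q \<partial>M) \<le> C * \<delta> powr q"
    if W: "W0 u g" and \<delta>: "\<delta> > 0" and lt: "(\<integral>x. (norm (g x))\<^sup>2 \<partial>M) < \<delta>\<^sup>2" for u g \<delta>
  proof -
    note fe = W0_finite_energy[OF W]
    note [measurable] = finite_energyD(1,2)[OF fe]
    obtain \<phi> where \<phi>: "\<And>n. \<phi> n \<in> test_functions \<Omega>"
      and \<phi>e: "\<And>n. energy_dist u g (\<phi> n) (grad (\<phi> n)) < 1 / real (Suc n)"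
      using W0_approx_sequence[OF W] by blast
    note [measurable] = test_measurable[OF \<phi>]
    have fd: "finite_energy (\<lambda>x. u x - \<phi> n x) (\<lambda>x. g x - grad (\<phi> n) x)" for n
      by (intro finite_energy_diff fe finite_energy_test \<phi>)
    have lim0: "(\<lambda>n. 1 / real (Suc n)) \<longlonglongrightarrow> 0" using LIMSEQ_inverse_real_of_nat by (simp add: inverse_eq_divide)
    have L1: "(\<lambda>n. \<integral>x. norm (u x - \<phi> n x) \<partial>M) \<longlonglongrightarrow> 0"
    proof -
      have "(\<integral>x. \<bar>u x - \<phi> n x\<bar> \<partial>M)\<^sup>2 \<le> measure M (space M) * (1 / real (Suc n))" for n
      proof -
        have "(\<integral>x. \<bar>u x - \<phi> n x\<bar> \<partial>M)\<^sup>2 \<le> measure M (space M) * (\<integral>x. (u x - \<phi> n x)\<^sup>2 \<partial>M)"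
          using sq_integrable[OF fd] by (intro integral_abs_sq_le) (auto intro: finite_measure_axioms)
        also have "\<dots> \<le> measure M (space M) * (1 / real (Suc n))"
          using order_trans[OF integral_sq_le[OF fd] less_imp_le[OF \<phi>e]] by (intro mult_left_mono) auto
        finally show ?thesis .
      qed
      then have "(\<lambda>n. (\<integral>x. \<bar>u x - \<phi> n x\<bar> \<partial>M)\<^sup>2) \<longlonglongrightarrow> 0"
        by (intro tendsto_sandwich[where f = "\<lambda>_. 0" and h = "\<lambda>n. measure M (space M) * (1 / real (Suc n))",
              OF _ _ tendsto_const tendsto_mult_right_zero[OF lim0]]) (auto simp del: of_nat_Suc)
      then have "(\<lambda>n. sqrt ((\<integral>x. \<bar>u x - \<phi> n x\<bar> \<partial>M)\<^sup>2)) \<longlonglongrightarrow> sqrt 0" by (rule tendsto_real_sqrt)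
      then show ?thesis by (simp add: tendsto_rabs_zero_iff)
    qed
    have "integrable M (\<lambda>x. u x - \<phi> n x)" for n
      by (rule square_integrable_imp_integrable) (use sq_integrable[OF fd] in auto)
    then obtain s where s: "strict_mono s" "AE x in M. (\<lambda>n. u x - \<phi> (s n) x) \<longlonglongrightarrow> 0"
      using tendsto_L1_AE_subseq[of M "\<lambda>n x. u x - \<phi> n x"] L1 by auto
    have ae: "AE x in M. (\<lambda>n. \<bar>\<phi> (s n) x\<bar> powr q) \<longlonglongrightarrow> \<bar>u x\<bar> powr q"
      using s(2)
    proof eventually_elim
      case (elim x)
      have "(\<lambda>n. u x - (u x - \<phi> (s n) x)) \<longlonglongrightarrow> u x - 0" by (intro tendsto_intros elim)
      then show ?case using q0 by (intro tendsto_powr2 tendsto_rabs tendsto_const) auto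
    qed
    define G where "G = (\<integral>x. (norm (g x))\<^sup>2 \<partial>M)"
    have G0: "G \<ge> 0" by (simp add: G_def)
    \<comment> \<open>Small enough to keep \<open>(1 + \<eta>) G\<close> below \<open>\<delta>\<^sup>2\<close>, which leaves room for the approximation error.\<close>
    define \<eta> where "\<eta> = (\<delta>\<^sup>2 - G) / (2 * (G + 1))"
    have \<eta>: "\<eta> > 0" using lt G0 by (simp add: \<eta>_def G_def[symmetric])
    have \<eta>G: "(1 + \<eta>) * G < \<delta>\<^sup>2"
    proof -
      have "\<eta> * G < \<eta> * (2 * (G + 1))" using \<eta> G0 by (intro mult_strict_left_mono) auto
      also have "\<dots> = \<delta>\<^sup>2 - G" using G0 by (simp add: \<eta>_def)
      finally show ?thesis by (simp add: algebra_simps)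
    qed
    have "(\<lambda>n. (1 + \<eta>) * G + (1 + 1 / \<eta>) * (1 / real (Suc n))) \<longlonglongrightarrow> (1 + \<eta>) * G + (1 + 1 / \<eta>) * 0"
      by (intro tendsto_intros lim0)
    then have "\<forall>\<^sub>F n in sequentially. (1 + \<eta>) * G + (1 + 1 / \<eta>) * (1 / real (Suc n)) < \<delta>\<^sup>2"
      using \<eta>G by (intro order_tendstoD) auto
    then obtain N where N: "\<And>n. n \<ge> N \<Longrightarrow> (1 + \<eta>) * G + (1 + 1 / \<eta>) * (1 / real (Suc n)) < \<delta>\<^sup>2"
      by (auto simp: eventually_sequentially)
    have D: "dirichlet (\<phi> n) \<le> \<delta>\<^sup>2" if n: "n \<ge> N" for n
    proof -
      note i1 = grad_sq_int[OF fe] and i2 = grad_sq_int[OF fd[of n]]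
      have pt: "(norm (grad (\<phi> n) x))\<^sup>2 \<le> (1 + \<eta>) * (norm (g x))\<^sup>2 + (1 + 1 / \<eta>) * (norm (g x - grad (\<phi> n) x))\<^sup>2" for x
        using norm_sq_add_le[OF \<eta>, of "g x" "grad (\<phi> n) x - g x"] by (simp add: norm_minus_commute)
      have "dirichlet (\<phi> n) \<le> (\<integral>x. (1 + \<eta>) * (norm (g x))\<^sup>2 + (1 + 1 / \<eta>) * (norm (g x - grad (\<phi> n) x))\<^sup>2 \<partial>M)"
        unfolding dirichlet_eq[OF \<phi>] using i1 i2 pt
        by (intro integral_mono grad_sq_int[OF finite_energy_test[OF \<phi>]]) auto
      also have "\<dots> = (1 + \<eta>) * G + (1 + 1 / \<eta>) * (\<integral>x. (norm (g x - grad (\<phi> n) x))\<^sup>2 \<partial>M)"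
        using i1 i2 by (simp add: G_def)
      also have "\<dots> \<le> (1 + \<eta>) * G + (1 + 1 / \<eta>) * (1 / real (Suc n))"
        using order_trans[OF integral_grad_sq_le[OF fd] less_imp_le[OF \<phi>e]] \<eta>
        by (intro add_left_mono mult_left_mono) auto
      finally show ?thesis using N[OF n] by simp
    qed
    define f where "f i x = \<bar>\<phi> (s (i + N)) x\<bar> powr q" for i x
    have fD: "dirichlet (\<phi> (s (i + N))) \<le> \<delta>\<^sup>2" for i
      using seq_suble[OF s(1), of "i + N"] by (intro D) simp
    have fi: "integrable M (f i)" "(\<integral>x. f i x \<partial>M) \<le> C * \<delta> powr q" for i
      unfolding f_def using test[OF \<phi> \<delta> fD] by auto
    have flim: "AE x in M. (\<lambda>i. f i x) \<longlonglongrightarrow> \<bar>u x\<bar> powr q"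
      using ae unfolding f_def by eventually_elim (rule LIMSEQ_ignore_initial_segment)
    have f0: "AE x in M. 0 \<le> f i x" for i by (simp add: f_def)
    have um: "(\<lambda>x. \<bar>u x\<bar> powr q) \<in> borel_measurable M" by measurable
    show ?thesis using Fatou_integral[OF fi(1) f0 um flim fi(2)] by blast
  qed
  then show ?thesis using C(1) by blast
qed

abbreviation "H \<equiv> double_phase 2 q \<mu>"

lemma modular_eq: "modular H \<Omega> v = (\<integral>\<^sup>+x. ennreal ((v x)\<^sup>2 + \<mu> x * \<bar>v x\<bar> powr q) \<partial>M)"
  by (simp add: modular_def double_phase_def)

lemma musielak_iff: "v \<in> musielak_space H \<Omega> \<longleftrightarrow>
    v \<in> borel_measurable M \<and> integrable M (\<lambda>x. (v x)\<^sup>2 + \<mu> x * \<bar>v x\<bar> powr q)"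
proof -
  have "integrable M (\<lambda>x. (v x)\<^sup>2 + \<mu> x * \<bar>v x\<bar> powr q) \<longleftrightarrow> (\<integral>\<^sup>+x. ennreal ((v x)\<^sup>2 + \<mu> x * \<bar>v x\<bar> powr q) \<partial>M) < \<infinity>"
    if [measurable]: "v \<in> borel_measurable M"
  proof -
    have "(\<integral>\<^sup>+x. ennreal (norm ((v x)\<^sup>2 + \<mu> x * \<bar>v x\<bar> powr q)) \<partial>M) = (\<integral>\<^sup>+x. ennreal ((v x)\<^sup>2 + \<mu> x * \<bar>v x\<bar> powr q) \<partial>M)"
      using mu(1) by (intro nn_integral_cong) simp
    then show ?thesis unfolding integrable_iff_bounded by simp
  qed
  then show ?thesis by (auto simp: musielak_space_def modular_eq)
qed

lemma modular_scaled:
  assumes "\<tau> > 0"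
  shows "modular H \<Omega> (\<lambda>x. v x / \<tau>) = (\<integral>\<^sup>+x. ennreal ((v x)\<^sup>2 / \<tau>\<^sup>2 + \<mu> x * \<bar>v x\<bar> powr q / \<tau> powr q) \<partial>M)"
  using assms by (simp add: modular_eq power_divide powr_divide abs_divide)

lemma luxemburg_norm_le:
  assumes [measurable]: "v \<in> borel_measurable M" and \<tau>: "\<tau> > 0"
    and i: "integrable M (\<lambda>x. (v x)\<^sup>2)" "integrable M (\<lambda>x. \<mu> x * \<bar>v x\<bar> powr q)"
    and le: "(\<integral>x. (v x)\<^sup>2 \<partial>M) \<le> \<tau>\<^sup>2 / 2" "(\<integral>x. \<mu> x * \<bar>v x\<bar> powr q \<partial>M) \<le> \<tau> powr q / 2"
  shows "luxemburg_norm H \<Omega> v \<le> \<tau>"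
  unfolding luxemburg_norm_def
proof (rule cInf_lower)
  have "modular H \<Omega> (\<lambda>x. v x / \<tau>) = ennreal (\<integral>x. (v x)\<^sup>2 / \<tau>\<^sup>2 + \<mu> x * \<bar>v x\<bar> powr q / \<tau> powr q \<partial>M)"
    unfolding modular_scaled[OF \<tau>] using i mu(1) by (intro nn_integral_eq_integral) (auto intro!: AE_I2)
  also have "\<dots> \<le> 1"
  proof -
    have "(\<integral>x. (v x)\<^sup>2 / \<tau>\<^sup>2 + \<mu> x * \<bar>v x\<bar> powr q / \<tau> powr q \<partial>M) =
      (\<integral>x. (v x)\<^sup>2 \<partial>M) / \<tau>\<^sup>2 + (\<integral>x. \<mu> x * \<bar>v x\<bar> powr q \<partial>M) / \<tau> powr q" using i by simp
    also have "\<dots> \<le> 1 / 2 + 1 / 2" using le \<tau> by (intro add_mono) (auto simp: field_simps)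
    finally show ?thesis by (simp add: ennreal_le_1)
  qed
  finally show "\<tau> \<in> {\<tau>. \<tau> > 0 \<and> modular H \<Omega> (\<lambda>x. v x / \<tau>) \<le> 1}" using \<tau> by simp
  show "bdd_below {\<tau>. \<tau> > 0 \<and> modular H \<Omega> (\<lambda>x. v x / \<tau>) \<le> 1}" by (rule bdd_belowI[of _ 0]) auto
qed

text \<open>The infimum of the empty set of reals is unspecified, so a bound on the Luxemburg norm only carries
  information because the set in its definition is inhabited.\<close>

lemma luxemburg_set_nonempty:
  assumes "v \<in> musielak_space H \<Omega>"
  shows "{\<tau>. \<tau> > 0 \<and> modular H \<Omega> (\<lambda>x. v x / \<tau>) \<le> 1} \<noteq> {}"
proof -
  have [measurable]: "v \<in> borel_measurable M" and i: "integrable M (\<lambda>x. (v x)\<^sup>2 + \<mu> x * \<bar>v x\<bar> powr q)"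
    using assms by (auto simp: musielak_iff)
  define J where "J = (\<integral>x. (v x)\<^sup>2 + \<mu> x * \<bar>v x\<bar> powr q \<partial>M)"
  have J0: "J \<ge> 0" unfolding J_def using mu(1) by (intro integral_nonneg_AE AE_I2) auto
  define \<tau> where "\<tau> = J + 1"
  have \<tau>: "\<tau> \<ge> 1" "\<tau> > 0" using J0 by (auto simp: \<tau>_def)
  have t2: "\<tau> \<le> \<tau>\<^sup>2" using \<tau> by (simp add: power2_eq_square)
  have tq: "\<tau> \<le> \<tau> powr q" using \<tau> q(1) powr_mono[of 1 q \<tau>] by simp
  have "modular H \<Omega> (\<lambda>x. v x / \<tau>) \<le> (\<integral>\<^sup>+x. ennreal (((v x)\<^sup>2 + \<mu> x * \<bar>v x\<bar> powr q) / \<tau>) \<partial>M)"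
    unfolding modular_scaled[OF \<tau>(2)]
  proof (intro nn_integral_mono ennreal_leI)
    fix x assume "x \<in> space M"
    then have "0 \<le> \<mu> x * \<bar>v x\<bar> powr q" using mu(1) by simp
    then show "(v x)\<^sup>2 / \<tau>\<^sup>2 + \<mu> x * \<bar>v x\<bar> powr q / \<tau> powr q \<le> ((v x)\<^sup>2 + \<mu> x * \<bar>v x\<bar> powr q) / \<tau>"
      unfolding add_divide_distrib using \<tau> t2 tq by (intro add_mono divide_left_mono) auto
  qed
  also have "\<dots> = ennreal (J / \<tau>)"
    using i mu(1) \<tau> by (subst nn_integral_eq_integral) (auto intro!: AE_I2 simp: J_def)
  also have "\<dots> \<le> 1" using J0 by (simp add: \<tau>_def ennreal_le_1)
  finally show ?thesis using \<tau>(2) by blast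
qed

lemma luxemburg_norm_nonneg: "v \<in> musielak_space H \<Omega> \<Longrightarrow> 0 \<le> luxemburg_norm H \<Omega> v"
  unfolding luxemburg_norm_def by (rule cInf_greatest[OF luxemburg_set_nonempty]) auto

text \<open>For \<open>\<sigma> \<le> 1\<close> one has \<open>\<sigma>\<^sup>q \<le> \<sigma>\<^sup>2\<close>, so the quadratic scaling bounds both terms of the modular.\<close>

lemma luxemburg_norm_lessD:
  assumes v: "v \<in> musielak_space H \<Omega>" and less: "luxemburg_norm H \<Omega> v < \<tau>" and \<tau>: "\<tau> \<le> 1"
  shows "(\<integral>x. (v x)\<^sup>2 + \<mu> x * \<bar>v x\<bar> powr q \<partial>M) \<le> \<tau>\<^sup>2"
proof -
  have [measurable]: "v \<in> borel_measurable M" and i: "integrable M (\<lambda>x. (v x)\<^sup>2 + \<mu> x * \<bar>v x\<bar> powr q)"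
    using v by (auto simp: musielak_iff)
  obtain \<sigma> where \<sigma>: "\<sigma> > 0" "\<sigma> < \<tau>" "modular H \<Omega> (\<lambda>x. v x / \<sigma>) \<le> 1"
    using cInf_lessD[OF luxemburg_set_nonempty[OF v]] less unfolding luxemburg_norm_def by blast
  have sq: "\<sigma> powr q \<le> \<sigma>\<^sup>2" using \<sigma> \<tau> q(1) powr_mono'[of 2 q \<sigma>] by simp
  have "ennreal (\<integral>x. (v x)\<^sup>2 + \<mu> x * \<bar>v x\<bar> powr q \<partial>M) = (\<integral>\<^sup>+x. ennreal ((v x)\<^sup>2 + \<mu> x * \<bar>v x\<bar> powr q) \<partial>M)"
    using i mu(1) by (intro nn_integral_eq_integral[symmetric]) (auto intro!: AE_I2)
  also have "\<dots> \<le> (\<integral>\<^sup>+x. ennreal (\<sigma>\<^sup>2) * ennreal ((v x)\<^sup>2 / \<sigma>\<^sup>2 + \<mu> x * \<bar>v x\<bar> powr q / \<sigma> powr q) \<partial>M)"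
  proof (intro nn_integral_mono)
    fix x assume "x \<in> space M"
    then have m: "0 \<le> \<mu> x * \<bar>v x\<bar> powr q" using mu(1) by simp
    have "\<mu> x * \<bar>v x\<bar> powr q = \<sigma> powr q * (\<mu> x * \<bar>v x\<bar> powr q / \<sigma> powr q)" using \<sigma>(1) by simp
    also have "\<dots> \<le> \<sigma>\<^sup>2 * (\<mu> x * \<bar>v x\<bar> powr q / \<sigma> powr q)" using m by (intro mult_right_mono[OF sq]) auto
    finally have "(v x)\<^sup>2 + \<mu> x * \<bar>v x\<bar> powr q \<le> \<sigma>\<^sup>2 * ((v x)\<^sup>2 / \<sigma>\<^sup>2 + \<mu> x * \<bar>v x\<bar> powr q / \<sigma> powr q)"
      using \<sigma>(1) by (simp add: distrib_left)
    then have "ennreal ((v x)\<^sup>2 + \<mu> x * \<bar>v x\<bar> powr q) \<le> ennreal (\<sigma>\<^sup>2 * ((v x)\<^sup>2 / \<sigma>\<^sup>2 + \<mu> x * \<bar>v x\<bar> powr q / \<sigma> powr q))"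
      by (rule ennreal_leI)
    also have "\<dots> = ennreal (\<sigma>\<^sup>2) * ennreal ((v x)\<^sup>2 / \<sigma>\<^sup>2 + \<mu> x * \<bar>v x\<bar> powr q / \<sigma> powr q)"
      using m by (intro ennreal_mult) auto
    finally show "ennreal ((v x)\<^sup>2 + \<mu> x * \<bar>v x\<bar> powr q) \<le> ennreal (\<sigma>\<^sup>2) * ennreal ((v x)\<^sup>2 / \<sigma>\<^sup>2 + \<mu> x * \<bar>v x\<bar> powr q / \<sigma> powr q)" .
  qed
  also have "\<dots> = ennreal (\<sigma>\<^sup>2) * modular H \<Omega> (\<lambda>x. v x / \<sigma>)"
    unfolding modular_scaled[OF \<sigma>(1)] by (intro nn_integral_cmult) measurable
  also have "\<dots> \<le> ennreal (\<sigma>\<^sup>2) * 1" by (intro mult_left_mono \<sigma>(3)) simp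
  finally have "(\<integral>x. (v x)\<^sup>2 + \<mu> x * \<bar>v x\<bar> powr q \<partial>M) \<le> \<sigma>\<^sup>2" by (simp add: ennreal_le_iff)
  also have "\<dots> \<le> \<tau>\<^sup>2" using \<sigma> by (intro power_mono) auto
  finally show ?thesis .
qed

lemma musielak_cong_AE:
  assumes "v \<in> musielak_space H \<Omega>" "AE x in M. \<bar>v x\<bar> = \<bar>w x\<bar>" "w \<in> borel_measurable M"
  shows "w \<in> musielak_space H \<Omega>"
proof -
  note [measurable] = assms(3)
  have "integrable M (\<lambda>x. (w x)\<^sup>2 + \<mu> x * \<bar>w x\<bar> powr q)"
  proof (rule integrable_cong_AE_imp)
    show "integrable M (\<lambda>x. (v x)\<^sup>2 + \<mu> x * \<bar>v x\<bar> powr q)" using assms(1) by (simp add: musielak_iff)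
    show "AE x in M. (v x)\<^sup>2 + \<mu> x * \<bar>v x\<bar> powr q = (w x)\<^sup>2 + \<mu> x * \<bar>w x\<bar> powr q"
      using assms(2) by eventually_elim (metis power2_abs)
  qed measurable
  then show ?thesis using assms(3) by (simp add: musielak_iff)
qed

lemma finite_energy_musielak_grad: "finite_energy u g \<Longrightarrow> (\<lambda>x. norm (g x)) \<in> musielak_space H \<Omega>"
proof -
  assume fe: "finite_energy u g"
  note [measurable] = finite_energyD(2)[OF fe]
  have "(\<lambda>x. norm (g x)) \<in> borel_measurable M" by measurable
  moreover have "integrable M (\<lambda>x. (norm (g x))\<^sup>2 + \<mu> x * norm (g x) powr q)"
    by (rule Bochner_Integration.integrable_add[OF grad_sq_int[OF fe] grad_powr_integrable[OF fe]])
  ultimately show ?thesis unfolding musielak_iff by simp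
qed

lemma mu_Lq:
  assumes [measurable]: "u \<in> borel_measurable M" and i: "integrable M (\<lambda>x. \<bar>u x\<bar> powr q)"
  shows "integrable M (\<lambda>x. \<mu> x * \<bar>u x\<bar> powr q)" "(\<integral>x. \<mu> x * \<bar>u x\<bar> powr q \<partial>M) \<le> B * (\<integral>x. \<bar>u x\<bar> powr q \<partial>M)"
proof -
  show int: "integrable M (\<lambda>x. \<mu> x * \<bar>u x\<bar> powr q)"
  proof (rule Bochner_Integration.integrable_bound[OF integrable_mult_right[OF i, of B]])
    show "AE x in M. norm (\<mu> x * \<bar>u x\<bar> powr q) \<le> norm (B * \<bar>u x\<bar> powr q)"
    proof (intro AE_I2)
      fix x assume "x \<in> space M"
      then show "norm (\<mu> x * \<bar>u x\<bar> powr q) \<le> norm (B * \<bar>u x\<bar> powr q)"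
        using mult_right_mono[OF mu(2), of x "\<bar>u x\<bar> powr q"] mu(1)[of x] by (simp add: abs_mult B_nonneg)
    qed
  qed measurable
  have "(\<integral>x. \<mu> x * \<bar>u x\<bar> powr q \<partial>M) \<le> (\<integral>x. B * \<bar>u x\<bar> powr q \<partial>M)"
    using mu i by (intro integral_mono_AE int AE_I2 mult_right_mono) auto
  then show "(\<integral>x. \<mu> x * \<bar>u x\<bar> powr q \<partial>M) \<le> B * (\<integral>x. \<bar>u x\<bar> powr q \<partial>M)" by simp
qed

lemma W0_musielak:
  assumes "W0 u g"
  shows "u \<in> musielak_space H \<Omega>"
proof -
  note fe = W0_finite_energy[OF assms]
  define G where "G = (\<integral>x. (norm (g x))\<^sup>2 \<partial>M)"
  define \<delta> where "\<delta> = G + 1"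
  have G: "G \<ge> 0" by (simp add: G_def)
  have "(G + 1)\<^sup>2 = G\<^sup>2 + 2 * G + 1" by (simp add: power2_sum)
  then have "\<delta> > 0" "G < \<delta>\<^sup>2" using G zero_le_power2[of G] unfolding \<delta>_def by linarith+
  then have \<delta>: "\<delta> > 0" "(\<integral>x. (norm (g x))\<^sup>2 \<partial>M) < \<delta>\<^sup>2" by (simp_all add: G_def)
  then have "integrable M (\<lambda>x. \<bar>u x\<bar> powr q)" using W0_sobolev assms by blast
  from mu_Lq(1)[OF finite_energyD(1)[OF fe] this] show ?thesis
    using sq_integrable[OF fe] finite_energyD(1)[OF fe] by (auto simp: musielak_iff)
qed

text \<open>Energy convergence of the approximating test functions is convergence in the Sobolev norm: the gradient terms are
  part of the energy, and the Sobolev inequality turns the convergence of the gradients into that of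
  \<open>\<mu> \<bar>u\<bar>\<^sup>q\<close>.\<close>

theorem sobolev_space0_if_W0:
  assumes W: "W0 u g"
  shows "u \<in> sobolev_space0 H \<Omega>"
proof -
  note wg = W0_weak_grad[OF W]
  have "u \<in> sobolev_space H \<Omega>"
    unfolding sobolev_space_def
    using W0_musielak[OF W] W0_weak_gradient[OF W] finite_energy_musielak_grad[OF W0_finite_energy[OF wg(3)]] by auto
  moreover have "\<exists>\<phi>\<in>test_functions \<Omega>. sobolev_norm H \<Omega> (\<lambda>x. u x - \<phi> x) < \<epsilon>" if \<epsilon>: "\<epsilon> > 0" for \<epsilon>
  proof -
    obtain C where C: "C \<ge> 0" "\<And>u g \<delta>. W0 u g \<Longrightarrow> \<delta> > 0 \<Longrightarrow> (\<integral>x. (norm (g x))\<^sup>2 \<partial>M) < \<delta>\<^sup>2 \<Longrightarrow>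
        integrable M (\<lambda>x. \<bar>u x\<bar> powr q) \<and> (\<integral>x. \<bar>u x\<bar> powr q \<partial>M) \<le> C * \<delta> powr q"
      using W0_sobolev by blast
    define \<tau> where "\<tau> = \<epsilon> / 3"
    have \<tau>: "\<tau> > 0" using \<epsilon> by (simp add: \<tau>_def)
    define k where "k = 2 * (B * C + 1)"
    have k: "k > 0" using B_nonneg C(1) by (simp add: k_def add_nonneg_pos)
    \<comment> \<open>Chosen so that the Sobolev inequality bounds the weighted term by \<open>\<tau>\<^sup>q / 2\<close>.\<close>
    define \<delta> where "\<delta> = (\<tau> powr q / k) powr (1 / q)"
    have \<delta>: "\<delta> > 0" using \<tau> k by (simp add: \<delta>_def)
    have \<delta>q: "\<delta> powr q = \<tau> powr q / k" using \<tau> k q(1) by (simp add: \<delta>_def powr_powr)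
    have BC: "B * (C * \<delta> powr q) \<le> \<tau> powr q / 2"
    proof -
      have "B * (C * \<delta> powr q) \<le> (B * C + 1) * \<delta> powr q" by (simp add: algebra_simps)
      also have "\<dots> = \<tau> powr q / 2"
      proof -
        have "c * (t / (2 * c)) = t / 2" if "c > 0" for c t :: real using that by simp
        moreover have "B * C + 1 > 0" using B_nonneg C(1) by (simp add: add_nonneg_pos)
        ultimately show ?thesis by (simp only: \<delta>q k_def)
      qed
      finally show ?thesis .
    qed
    define e where "e = Min {\<tau>\<^sup>2 / 2, \<tau> powr q / 2, \<delta>\<^sup>2}"
    have e: "e > 0" "e \<le> \<tau>\<^sup>2 / 2" "e \<le> \<tau> powr q / 2" "e \<le> \<delta>\<^sup>2" using \<tau> \<delta> by (auto simp: e_def)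
    obtain \<phi> where \<phi>: "\<phi> \<in> test_functions \<Omega>" "energy_dist u g \<phi> (grad \<phi>) < e"
      using W0_approx[OF W e(1)] .
    have Wd: "W0 (\<lambda>x. u x - \<phi> x) (\<lambda>x. g x - grad \<phi> x)" by (rule W0_diff[OF W W0_test[OF \<phi>(1)]])
    note wgd = W0_weak_grad[OF Wd]
    let ?h = "weak_grad \<Omega> (\<lambda>x. u x - \<phi> x)"
    note fed = W0_finite_energy[OF Wd] and feh = W0_finite_energy[OF wgd(3)]
    note [measurable] = finite_energyD(1)[OF fed] wgd(2) finite_energyD(2)[OF fed]
    have eq: "total_energy (\<lambda>x. u x - \<phi> x) ?h = energy_dist u g \<phi> (grad \<phi>)"
    proof (rule integral_cong_AE)
      show "AE x in M. energy (\<lambda>x. u x - \<phi> x) ?h x = energy (\<lambda>x. u x - \<phi> x) (\<lambda>x. g x - grad \<phi> x) x"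
        using wgd(1) by eventually_elim (simp add: energy_def)
    qed (use finite_energyD(3)[OF fed] finite_energyD(3)[OF feh] in auto)
    have lt: "total_energy (\<lambda>x. u x - \<phi> x) ?h < e" using \<phi>(2) eq by simp
    have "luxemburg_norm H \<Omega> (\<lambda>x. norm (?h x)) \<le> \<tau>"
      using grad_sq_int[OF feh] grad_powr_integrable[OF feh] integral_grad_sq_le[OF feh] integral_grad_powr_le[OF feh] lt e
      by (intro luxemburg_norm_le \<tau>) auto
    moreover have "luxemburg_norm H \<Omega> (\<lambda>x. u x - \<phi> x) \<le> \<tau>"
    proof -
      have "(\<integral>x. (norm (g x - grad \<phi> x))\<^sup>2 \<partial>M) < \<delta>\<^sup>2"
        using integral_grad_sq_le[OF fed] \<phi>(2) e(4) by linarith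
      note Lq = C(2)[OF Wd \<delta> this]
      have "(\<integral>x. \<mu> x * \<bar>u x - \<phi> x\<bar> powr q \<partial>M) \<le> \<tau> powr q / 2"
        using mu_Lq(2)[OF finite_energyD(1)[OF fed]] Lq mult_left_mono[of "\<integral>x. \<bar>u x - \<phi> x\<bar> powr q \<partial>M" "C * \<delta> powr q" B] B_nonneg BC
        by linarith
      then show ?thesis
        using sq_integrable[OF fed] mu_Lq(1)[OF finite_energyD(1)[OF fed]] Lq integral_sq_le[OF fed] \<phi>(2) e(2)
        by (intro luxemburg_norm_le \<tau>) auto
    qed
    ultimately have "sobolev_norm H \<Omega> (\<lambda>x. u x - \<phi> x) \<le> 2 * \<tau>" by (simp add: sobolev_norm_def)
    then show ?thesis using \<phi>(1) \<epsilon> by (intro bexI[of _ \<phi>]) (auto simp: \<tau>_def)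
  qed
  ultimately show ?thesis by (simp add: sobolev_space0_def)
qed

theorem W0_if_sobolev_space0:
  assumes u: "u \<in> sobolev_space0 H \<Omega>"
  shows "W0 u (weak_grad \<Omega> u)"
proof -
  let ?g = "weak_grad \<Omega> u"
  obtain g0 where "is_weak_gradient \<Omega> u g0" and um: "u \<in> musielak_space H \<Omega>" and gm: "(\<lambda>x. norm (?g x)) \<in> musielak_space H \<Omega>"
    using u by (auto simp: sobolev_space0_def sobolev_space_def)
  then have wg: "is_weak_gradient \<Omega> u ?g" using weak_grad_is_weak_gradient by blast
  have um': "u \<in> borel_measurable M" using um by (simp add: musielak_iff)
  have gm': "?g \<in> borel_measurable M"
    using wg by (intro locally_integrable_measurable[OF open_Omega]) (simp add: is_weak_gradient_def)
  have fe_if: "finite_energy v h" if "v \<in> musielak_space H \<Omega>" "(\<lambda>x. norm (h x)) \<in> musielak_space H \<Omega>" "h \<in> borel_measurable M" for v h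
  proof -
    have [measurable]: "v \<in> borel_measurable M" "h \<in> borel_measurable M" using that by (auto simp: musielak_iff)
    have "integrable M (\<lambda>x. ((v x)\<^sup>2 + \<mu> x * \<bar>v x\<bar> powr q) + ((norm (h x))\<^sup>2 + \<mu> x * \<bar>norm (h x)\<bar> powr q))"
      using that by (intro Bochner_Integration.integrable_add[OF musielak_iff[THEN iffD1, THEN conjunct2] musielak_iff[THEN iffD1, THEN conjunct2]])
    then have "integrable M (energy v h)"
    proof (rule Bochner_Integration.integrable_bound)
      show "energy v h \<in> borel_measurable M" by (intro energy_measurable) auto
      show "AE x in M. norm (energy v h x) \<le> norm (((v x)\<^sup>2 + \<mu> x * \<bar>v x\<bar> powr q) + ((norm (h x))\<^sup>2 + \<mu> x * \<bar>norm (h x)\<bar> powr q))"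
        using mu(1) by (intro AE_I2) (auto simp: energy_def)
    qed
    then show ?thesis by (simp add: finite_energy_def)
  qed
  show ?thesis
    unfolding W0_def
  proof (intro conjI allI impI)
    show fe: "finite_energy u ?g" by (rule fe_if[OF um gm gm'])
    fix \<epsilon> :: real assume \<epsilon>: "\<epsilon> > 0"
    \<comment> \<open>For Luxemburg norms of at most one, the squared norm bounds the modular.\<close>
    define \<tau> where "\<tau> = min 1 (\<epsilon> / 3)"
    have \<tau>: "\<tau> > 0" "\<tau> \<le> 1" "\<tau> \<le> \<epsilon> / 3" using \<epsilon> by (auto simp: \<tau>_def)
    have "\<tau>\<^sup>2 \<le> \<tau>" using \<tau> by (simp add: power2_eq_square mult_left_le)
    then have t2: "\<tau>\<^sup>2 \<le> \<epsilon> / 3" using \<tau>(3) by linarith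
    obtain \<phi> where \<phi>: "\<phi> \<in> test_functions \<Omega>" and sn: "sobolev_norm H \<Omega> (\<lambda>x. u x - \<phi> x) < \<tau>"
      using u \<tau>(1) by (auto simp: sobolev_space0_def)
    let ?v = "\<lambda>x. u x - \<phi> x" and ?d = "\<lambda>x. ?g x - grad \<phi> x"
    let ?h = "weak_grad \<Omega> ?v"
    have wd: "is_weak_gradient \<Omega> ?v ?d"
      by (rule is_weak_gradient_diff[OF open_Omega wg test_function_weak_gradient[OF open_Omega \<phi>]])
    have wh: "is_weak_gradient \<Omega> ?v ?h" by (rule weak_grad_is_weak_gradient[OF wd])
    have ae: "AE x in M. ?h x = ?d x" by (rule weak_gradient_unique[OF open_Omega wh wd])
    have hm: "?h \<in> borel_measurable M"
      using wh by (intro locally_integrable_measurable[OF open_Omega]) (simp add: is_weak_gradient_def)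
    have fd: "finite_energy ?v ?d" by (intro finite_energy_diff fe finite_energy_test \<phi>)
    note [measurable] = finite_energyD(1,2)[OF fd] hm
    have vm: "?v \<in> musielak_space H \<Omega>"
    proof -
      note iu = um[unfolded musielak_iff, THEN conjunct2] and i\<phi> = W0_musielak[OF W0_test[OF \<phi>], unfolded musielak_iff, THEN conjunct2]
      have le: "(u x - \<phi> x)\<^sup>2 + \<mu> x * \<bar>u x - \<phi> x\<bar> powr q
          \<le> 2 powr q * (((u x)\<^sup>2 + \<mu> x * \<bar>u x\<bar> powr q) + ((\<phi> x)\<^sup>2 + \<mu> x * \<bar>\<phi> x\<bar> powr q))" if x: "x \<in> \<Omega>" for x
      proof -
        have "\<mu> x * \<bar>u x - \<phi> x\<bar> powr q \<le> \<mu> x * (2 powr q * (\<bar>u x\<bar> powr q + \<bar>\<phi> x\<bar> powr q))"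
          using q(1) by (intro mult_left_mono mu(1)[OF x] order_trans[OF powr_mono2[OF _ _ abs_triangle_ineq4] powr_add_le]) auto
        moreover have "(u x - \<phi> x)\<^sup>2 \<le> 2 powr q * ((u x)\<^sup>2 + (\<phi> x)\<^sup>2)"
        proof -
          have "(u x - \<phi> x)\<^sup>2 \<le> 2 * ((u x)\<^sup>2 + (\<phi> x)\<^sup>2)" using sum_squares_bound[of "u x" "- \<phi> x"] by (simp add: power2_diff)
          also have "\<dots> \<le> 2 powr q * ((u x)\<^sup>2 + (\<phi> x)\<^sup>2)"
            using q(1) powr_mono[of 1 q 2] by (intro mult_right_mono) auto
          finally show ?thesis .
        qed
        ultimately show ?thesis by (simp add: algebra_simps)
      qed
      have "integrable M (\<lambda>x. (u x - \<phi> x)\<^sup>2 + \<mu> x * \<bar>u x - \<phi> x\<bar> powr q)"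
      proof (rule Bochner_Integration.integrable_bound)
        show "integrable M (\<lambda>x. 2 powr q * (((u x)\<^sup>2 + \<mu> x * \<bar>u x\<bar> powr q) + ((\<phi> x)\<^sup>2 + \<mu> x * \<bar>\<phi> x\<bar> powr q)))"
          by (intro integrable_mult_right Bochner_Integration.integrable_add[OF iu i\<phi>])
        show "AE x in M. norm ((u x - \<phi> x)\<^sup>2 + \<mu> x * \<bar>u x - \<phi> x\<bar> powr q)
            \<le> norm (2 powr q * (((u x)\<^sup>2 + \<mu> x * \<bar>u x\<bar> powr q) + ((\<phi> x)\<^sup>2 + \<mu> x * \<bar>\<phi> x\<bar> powr q)))"
        proof (intro AE_I2)
          fix x assume "x \<in> space M"
          then have x: "x \<in> \<Omega>" by simp
          have "0 \<le> (u x - \<phi> x)\<^sup>2 + \<mu> x * \<bar>u x - \<phi> x\<bar> powr q" using mu(1)[OF x] by simp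
          then show "norm ((u x - \<phi> x)\<^sup>2 + \<mu> x * \<bar>u x - \<phi> x\<bar> powr q)
            \<le> norm (2 powr q * (((u x)\<^sup>2 + \<mu> x * \<bar>u x\<bar> powr q) + ((\<phi> x)\<^sup>2 + \<mu> x * \<bar>\<phi> x\<bar> powr q)))"
            unfolding real_norm_def using le[OF x] by linarith
        qed
      qed measurable
      then show ?thesis using finite_energyD(1)[OF fd] by (simp add: musielak_iff)
    qed
    have dm: "(\<lambda>x. norm (?d x)) \<in> musielak_space H \<Omega>" by (rule finite_energy_musielak_grad[OF fd])
    have hmus: "(\<lambda>x. norm (?h x)) \<in> musielak_space H \<Omega>"
      by (rule musielak_cong_AE[OF dm]) (use ae in auto)
    have l: "luxemburg_norm H \<Omega> ?v < \<tau>" "luxemburg_norm H \<Omega> (\<lambda>x. norm (?h x)) < \<tau>"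
      using sn luxemburg_norm_nonneg[OF vm] luxemburg_norm_nonneg[OF hmus] by (auto simp: sobolev_norm_def)
    have "total_energy ?v ?d \<le> (\<integral>x. ((?v x)\<^sup>2 + \<mu> x * \<bar>?v x\<bar> powr q) + ((norm (?h x))\<^sup>2 + \<mu> x * \<bar>norm (?h x)\<bar> powr q) \<partial>M)"
    proof (rule integral_mono_AE[OF finite_energyD(3)[OF fd]])
      show "integrable M (\<lambda>x. ((?v x)\<^sup>2 + \<mu> x * \<bar>?v x\<bar> powr q) + ((norm (?h x))\<^sup>2 + \<mu> x * \<bar>norm (?h x)\<bar> powr q))"
        using vm hmus by (intro Bochner_Integration.integrable_add[OF musielak_iff[THEN iffD1, THEN conjunct2] musielak_iff[THEN iffD1, THEN conjunct2]])
      have "AE x in M. x \<in> \<Omega>" by (intro AE_I2) simp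
      with ae show "AE x in M. energy ?v ?d x \<le> ((?v x)\<^sup>2 + \<mu> x * \<bar>?v x\<bar> powr q) + ((norm (?h x))\<^sup>2 + \<mu> x * \<bar>norm (?h x)\<bar> powr q)"
        by eventually_elim (use mu(1) in \<open>auto simp: energy_def\<close>)
    qed
    also have "\<dots> = (\<integral>x. (?v x)\<^sup>2 + \<mu> x * \<bar>?v x\<bar> powr q \<partial>M) + (\<integral>x. (norm (?h x))\<^sup>2 + \<mu> x * \<bar>norm (?h x)\<bar> powr q \<partial>M)"
      using vm hmus by (intro Bochner_Integration.integral_add[OF musielak_iff[THEN iffD1, THEN conjunct2] musielak_iff[THEN iffD1, THEN conjunct2]])
    also have "\<dots> \<le> \<tau>\<^sup>2 + \<tau>\<^sup>2"
      using luxemburg_norm_lessD[OF vm l(1) \<tau>(2)] luxemburg_norm_lessD[OF hmus l(2) \<tau>(2)] by (intro add_mono)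
    also have "\<dots> < \<epsilon>" using t2 \<epsilon> by simp
    finally show "\<exists>\<phi>\<in>test_functions \<Omega>. total_energy (\<lambda>x. u x - \<phi> x) (\<lambda>x. ?g x - grad \<phi> x) < \<epsilon>"
      using \<phi> by blast
  qed
qed

end

section \<open>Square integrable functions\<close>

lemma
  fixes f g :: "'a \<Rightarrow> 'b::euclidean_space"
  assumes [measurable]: "f \<in> borel_measurable N" "g \<in> borel_measurable N"
    and f: "integrable N (\<lambda>x. (norm (f x))\<^sup>2)" and g: "integrable N (\<lambda>x. (norm (g x))\<^sup>2)"
  shows integrable_inner_sq: "integrable N (\<lambda>x. f x \<bullet> g x)"
    and Cauchy_Schwarz_inner: "(\<integral>x. f x \<bullet> g x \<partial>N)\<^sup>2 \<le> (\<integral>x. (norm (f x))\<^sup>2 \<partial>N) * (\<integral>x. (norm (g x))\<^sup>2 \<partial>N)"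
proof -
  note CS = Cauchy_Schwarz_integral[of "\<lambda>x. norm (f x)" N "\<lambda>x. norm (g x)", OF _ _ f g]
  have i: "integrable N (\<lambda>x. norm (f x) * norm (g x))" by (rule CS(1)) auto
  show int: "integrable N (\<lambda>x. f x \<bullet> g x)"
    by (rule Bochner_Integration.integrable_bound[OF i]) (auto simp: Cauchy_Schwarz_ineq2)
  have "\<bar>\<integral>x. f x \<bullet> g x \<partial>N\<bar> \<le> (\<integral>x. \<bar>f x \<bullet> g x\<bar> \<partial>N)" by (rule integral_abs_bound)
  also have "\<dots> \<le> (\<integral>x. norm (f x) * norm (g x) \<partial>N)"
    using int by (intro integral_mono integrable_abs i Cauchy_Schwarz_ineq2)
  finally have "(\<integral>x. f x \<bullet> g x \<partial>N)\<^sup>2 \<le> (\<integral>x. norm (f x) * norm (g x) \<partial>N)\<^sup>2"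
    by (metis abs_ge_zero power2_abs power_mono)
  also have "\<dots> \<le> (\<integral>x. (norm (f x))\<^sup>2 \<partial>N) * (\<integral>x. (norm (g x))\<^sup>2 \<partial>N)" by (rule CS(2)) auto
  finally show "(\<integral>x. f x \<bullet> g x \<partial>N)\<^sup>2 \<le> (\<integral>x. (norm (f x))\<^sup>2 \<partial>N) * (\<integral>x. (norm (g x))\<^sup>2 \<partial>N)" .
qed

lemma integral_norm_sq_add:
  fixes f g :: "'a \<Rightarrow> 'b::euclidean_space"
  assumes [measurable]: "f \<in> borel_measurable N" "g \<in> borel_measurable N"
    and f: "integrable N (\<lambda>x. (norm (f x))\<^sup>2)" and g: "integrable N (\<lambda>x. (norm (g x))\<^sup>2)"
  shows "integrable N (\<lambda>x. (norm (f x + g x))\<^sup>2)"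
    "(\<integral>x. (norm (f x + g x))\<^sup>2 \<partial>N) = (\<integral>x. (norm (f x))\<^sup>2 \<partial>N) + 2 * (\<integral>x. f x \<bullet> g x \<partial>N) + (\<integral>x. (norm (g x))\<^sup>2 \<partial>N)"
proof -
  have eq: "(\<lambda>x. (norm (f x + g x))\<^sup>2) = (\<lambda>x. (norm (f x))\<^sup>2 + 2 * (f x \<bullet> g x) + (norm (g x))\<^sup>2)"
    by (auto simp: power2_norm_eq_inner inner_add_left inner_add_right inner_commute)
  note i = integrable_inner_sq[OF assms]
  show "integrable N (\<lambda>x. (norm (f x + g x))\<^sup>2)" unfolding eq using f g i by auto
  show "(\<integral>x. (norm (f x + g x))\<^sup>2 \<partial>N) = (\<integral>x. (norm (f x))\<^sup>2 \<partial>N) + 2 * (\<integral>x. f x \<bullet> g x \<partial>N) + (\<integral>x. (norm (g x))\<^sup>2 \<partial>N)"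
    unfolding eq using f g i by simp
qed

lemma integral_norm_sq_diff:
  fixes f g :: "'a \<Rightarrow> 'b::euclidean_space"
  assumes [measurable]: "f \<in> borel_measurable N" "g \<in> borel_measurable N"
    and f: "integrable N (\<lambda>x. (norm (f x))\<^sup>2)" and g: "integrable N (\<lambda>x. (norm (g x))\<^sup>2)"
  shows "integrable N (\<lambda>x. (norm (f x - g x))\<^sup>2)"
    "(\<integral>x. (norm (f x - g x))\<^sup>2 \<partial>N) = (\<integral>x. (norm (f x))\<^sup>2 \<partial>N) - 2 * (\<integral>x. f x \<bullet> g x \<partial>N) + (\<integral>x. (norm (g x))\<^sup>2 \<partial>N)"
  using integral_norm_sq_add[of f N "\<lambda>x. - g x"] assms by auto

text \<open>Minkowski's inequality in the square norm: expand the square and estimate the mixed term by Cauchy--Schwarz.\<close>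

lemma sqrt_integral_norm_sq_add_le:
  fixes f g :: "'a \<Rightarrow> 'b::euclidean_space"
  assumes [measurable]: "f \<in> borel_measurable N" "g \<in> borel_measurable N"
    and f: "integrable N (\<lambda>x. (norm (f x))\<^sup>2)" and g: "integrable N (\<lambda>x. (norm (g x))\<^sup>2)"
  shows "sqrt (\<integral>x. (norm (f x + g x))\<^sup>2 \<partial>N) \<le> sqrt (\<integral>x. (norm (f x))\<^sup>2 \<partial>N) + sqrt (\<integral>x. (norm (g x))\<^sup>2 \<partial>N)"
proof (rule real_le_lsqrt)
  let ?F = "\<integral>x. (norm (f x))\<^sup>2 \<partial>N" and ?G = "\<integral>x. (norm (g x))\<^sup>2 \<partial>N"
  have "(\<integral>x. f x \<bullet> g x \<partial>N) \<le> sqrt (?F * ?G)"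
    by (rule real_le_rsqrt) (rule Cauchy_Schwarz_inner[OF assms])
  then have "(\<integral>x. (norm (f x + g x))\<^sup>2 \<partial>N) \<le> ?F + 2 * sqrt (?F * ?G) + ?G"
    unfolding integral_norm_sq_add(2)[OF assms] by simp
  also have "\<dots> = (sqrt ?F + sqrt ?G)\<^sup>2" by (simp add: power2_sum real_sqrt_mult)
  finally show "(\<integral>x. (norm (f x + g x))\<^sup>2 \<partial>N) \<le> (sqrt ?F + sqrt ?G)\<^sup>2" .
qed simp

lemma
  fixes f :: "nat \<Rightarrow> 'a \<Rightarrow> 'b::euclidean_space"
  assumes m[measurable]: "\<And>n. f n \<in> borel_measurable N" "g \<in> borel_measurable N" "h \<in> borel_measurable N"
    and f: "\<And>n. integrable N (\<lambda>x. (norm (f n x))\<^sup>2)" and g: "integrable N (\<lambda>x. (norm (g x))\<^sup>2)"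
    and h: "integrable N (\<lambda>x. (norm (h x))\<^sup>2)"
    and lim: "(\<lambda>n. \<integral>x. (norm (f n x - g x))\<^sup>2 \<partial>N) \<longlonglongrightarrow> 0"
  shows tendsto_integral_inner: "(\<lambda>n. \<integral>x. f n x \<bullet> h x \<partial>N) \<longlonglongrightarrow> (\<integral>x. g x \<bullet> h x \<partial>N)"
    and tendsto_integral_norm_sq: "(\<lambda>n. \<integral>x. (norm (f n x))\<^sup>2 \<partial>N) \<longlonglongrightarrow> (\<integral>x. (norm (g x))\<^sup>2 \<partial>N)"
proof -
  have d: "integrable N (\<lambda>x. (norm (f n x - g x))\<^sup>2)" for n by (rule integral_norm_sq_diff(1)[OF m(1,2) f g])
  have *: "(\<lambda>n. \<integral>x. f n x \<bullet> k x \<partial>N) \<longlonglongrightarrow> (\<integral>x. g x \<bullet> k x \<partial>N)"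
    if km[measurable]: "k \<in> borel_measurable N" and k: "integrable N (\<lambda>x. (norm (k x))\<^sup>2)" for k
  proof -
    have "(\<lambda>n. (\<integral>x. (f n x - g x) \<bullet> k x \<partial>N)\<^sup>2) \<longlonglongrightarrow> 0"
    proof (rule tendsto_sandwich[OF _ _ tendsto_const])
      show "\<forall>\<^sub>F n in sequentially. (\<integral>x. (f n x - g x) \<bullet> k x \<partial>N)\<^sup>2 \<le> (\<integral>x. (norm (f n x - g x))\<^sup>2 \<partial>N) * (\<integral>x. (norm (k x))\<^sup>2 \<partial>N)"
        by (intro always_eventually allI Cauchy_Schwarz_inner d k) measurable
      show "(\<lambda>n. (\<integral>x. (norm (f n x - g x))\<^sup>2 \<partial>N) * (\<integral>x. (norm (k x))\<^sup>2 \<partial>N)) \<longlonglongrightarrow> 0"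
        by (rule tendsto_mult_left_zero[OF lim])
    qed simp
    then have "(\<lambda>n. sqrt ((\<integral>x. (f n x - g x) \<bullet> k x \<partial>N)\<^sup>2)) \<longlonglongrightarrow> sqrt 0" by (rule tendsto_real_sqrt)
    then have "(\<lambda>n. \<integral>x. (f n x - g x) \<bullet> k x \<partial>N) \<longlonglongrightarrow> 0" by (simp add: tendsto_rabs_zero_iff)
    moreover have "(\<integral>x. (f n x - g x) \<bullet> k x \<partial>N) = (\<integral>x. f n x \<bullet> k x \<partial>N) - (\<integral>x. g x \<bullet> k x \<partial>N)" for n
      unfolding inner_diff_left
      by (rule Bochner_Integration.integral_diff[OF integrable_inner_sq[OF m(1) km f k] integrable_inner_sq[OF m(2) km g k]])
    ultimately have "(\<lambda>n. ((\<integral>x. f n x \<bullet> k x \<partial>N) - (\<integral>x. g x \<bullet> k x \<partial>N)) + (\<integral>x. g x \<bullet> k x \<partial>N)) \<longlonglongrightarrow> 0 + (\<integral>x. g x \<bullet> k x \<partial>N)"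
      by (intro tendsto_add tendsto_const) simp
    then show ?thesis by simp
  qed
  show "(\<lambda>n. \<integral>x. f n x \<bullet> h x \<partial>N) \<longlonglongrightarrow> (\<integral>x. g x \<bullet> h x \<partial>N)" by (rule *[OF m(3) h])
  have gg: "(\<lambda>x. g x \<bullet> g x) = (\<lambda>x. (norm (g x))\<^sup>2)" by (simp add: power2_norm_eq_inner)
  have "(\<integral>x. (norm (f n x))\<^sup>2 \<partial>N) = (\<integral>x. (norm (f n x - g x))\<^sup>2 \<partial>N) + 2 * (\<integral>x. f n x \<bullet> g x \<partial>N) - (\<integral>x. (norm (g x))\<^sup>2 \<partial>N)" for n
    unfolding integral_norm_sq_diff(2)[OF m(1,2) f g] by simp
  moreover have "(\<lambda>n. (\<integral>x. (norm (f n x - g x))\<^sup>2 \<partial>N) + 2 * (\<integral>x. f n x \<bullet> g x \<partial>N) - (\<integral>x. (norm (g x))\<^sup>2 \<partial>N))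
      \<longlonglongrightarrow> 0 + 2 * (\<integral>x. g x \<bullet> g x \<partial>N) - (\<integral>x. (norm (g x))\<^sup>2 \<partial>N)"
    by (intro tendsto_add tendsto_diff tendsto_mult lim *[OF m(2) g] tendsto_const)
  ultimately show "(\<lambda>n. \<integral>x. (norm (f n x))\<^sup>2 \<partial>N) \<longlonglongrightarrow> (\<integral>x. (norm (g x))\<^sup>2 \<partial>N)" by (simp add: gg)
qed

section \<open>The first Dirichlet eigenvalue\<close>

text \<open>By density this is the infimum of the Rayleigh quotient over the whole space with zero boundary values.\<close>

definition rayleigh_inf :: "(real^'n::finite) set \<Rightarrow> real" where
  "rayleigh_inf \<Omega> = Inf {dirichlet \<phi> |\<phi>. \<phi> \<in> test_functions \<Omega> \<and> (\<integral>x. (\<phi> x)\<^sup>2 \<partial>lborel) = 1}"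

lemma ex_normalized_test_function:
  fixes \<Omega> :: "(real^'n::finite) set"
  assumes "open \<Omega>" "\<Omega> \<noteq> {}"
  shows "\<exists>\<phi>\<in>test_functions \<Omega>. (\<integral>x. (\<phi> x)\<^sup>2 \<partial>lborel) = 1"
proof -
  obtain x where "x \<in> \<Omega>" using assms(2) by auto
  then obtain a b where ab: "cbox a b \<subseteq> \<Omega>" "x \<in> box a b" by (rule open_contains_cbox[OF assms(1)])
  define \<phi> where "\<phi> = box_bump a b 1"
  have \<phi>: "\<phi> \<in> test_functions \<Omega>" unfolding \<phi>_def by (rule box_bump_test_function) (use ab in auto)
  have "(\<integral>x. (\<phi> x)\<^sup>2 \<partial>lborel) \<noteq> 0"
  proof
    assume "(\<integral>x. (\<phi> x)\<^sup>2 \<partial>lborel) = 0"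
    then have "AE x in lborel. (\<phi> x)\<^sup>2 = 0"
      by (subst (asm) integral_nonneg_eq_0_iff_AE[OF test_function_sq_integrable[OF \<phi>]]) auto
    then have "AE x in lborel. x \<in> {x. \<phi> x = 0}" by simp
    then have "AE x in lebesgue. x \<in> {x. \<phi> x = 0}" by (rule AE_completion)
    moreover have "closed {x. \<phi> x = 0}"
      using test_function_continuous[OF \<phi>, of UNIV] by (intro closed_Collect_eq continuous_intros)
    ultimately have "x \<in> {x. \<phi> x = 0}" by (intro mem_closed_if_AE_lebesgue)
    moreover have "\<phi> x > 0" unfolding \<phi>_def using ab(2) by (intro box_bump_pos) auto
    ultimately show False by simp
  qed
  moreover have "(\<integral>x. (\<phi> x)\<^sup>2 \<partial>lborel) \<ge> 0" by simp
  ultimately have I: "(\<integral>x. (\<phi> x)\<^sup>2 \<partial>lborel) > 0" by linarith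
  define c where "c = 1 / sqrt (\<integral>x. (\<phi> x)\<^sup>2 \<partial>lborel)"
  have "(\<integral>x. (c * \<phi> x)\<^sup>2 \<partial>lborel) = 1"
    using I by (simp add: power_mult_distrib c_def power_divide)
  then show ?thesis by (intro bexI[of _ "\<lambda>x. c * \<phi> x"] test_function_cmult \<phi>)
qed

lemma rayleigh_inf_le:
  assumes "\<phi> \<in> test_functions \<Omega>" "(\<integral>x. (\<phi> x)\<^sup>2 \<partial>lborel) = 1"
  shows "rayleigh_inf \<Omega> \<le> dirichlet \<phi>"
  unfolding rayleigh_inf_def using assms by (intro cInf_lower bdd_belowI[of _ 0]) (auto simp: dirichlet_nonneg)

lemma rayleigh_inf_pos:
  fixes \<Omega> :: "(real^'n::finite) set"
  assumes "open \<Omega>" "bounded \<Omega>" "\<Omega> \<noteq> {}"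
  shows "rayleigh_inf \<Omega> > 0"
proof -
  obtain K where K: "K > 0" "\<And>\<phi>. \<phi> \<in> test_functions \<Omega> \<Longrightarrow> (\<integral>x. (\<phi> x)\<^sup>2 \<partial>lborel) \<le> K * dirichlet \<phi>"
    using poincare_test_function[OF assms(2)] by auto
  have "1 / K \<le> rayleigh_inf \<Omega>" unfolding rayleigh_inf_def
  proof (rule cInf_greatest)
    show "{dirichlet \<phi> |\<phi>. \<phi> \<in> test_functions \<Omega> \<and> (\<integral>x. (\<phi> x)\<^sup>2 \<partial>lborel) = 1} \<noteq> {}"
      using ex_normalized_test_function[OF assms(1,3)] by blast
    fix d assume "d \<in> {dirichlet \<phi> |\<phi>. \<phi> \<in> test_functions \<Omega> \<and> (\<integral>x. (\<phi> x)\<^sup>2 \<partial>lborel) = 1}"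
    then obtain \<phi> where "\<phi> \<in> test_functions \<Omega>" "(\<integral>x. (\<phi> x)\<^sup>2 \<partial>lborel) = 1" "d = dirichlet \<phi>" by auto
    then show "1 / K \<le> d" using K(2)[of \<phi>] K(1) by (simp add: field_simps)
  qed
  then show ?thesis using K(1) by (meson divide_pos_pos less_le_trans zero_less_one)
qed

lemma rayleigh_test_function:
  fixes \<Omega> :: "(real^'n::finite) set"
  assumes \<phi>: "\<phi> \<in> test_functions \<Omega>"
  shows "rayleigh_inf \<Omega> * (\<integral>x. (\<phi> x)\<^sup>2 \<partial>lborel) \<le> dirichlet \<phi>"
proof (cases "(\<integral>x. (\<phi> x)\<^sup>2 \<partial>lborel) = 0")
  case True
  then show ?thesis by (simp add: dirichlet_nonneg)
next
  case False
  moreover have "(\<integral>x. (\<phi> x)\<^sup>2 \<partial>lborel) \<ge> 0" by simp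
  ultimately have I: "(\<integral>x. (\<phi> x)\<^sup>2 \<partial>lborel) > 0" by linarith
  define c where "c = 1 / sqrt (\<integral>x. (\<phi> x)\<^sup>2 \<partial>lborel)"
  have c2: "c\<^sup>2 = 1 / (\<integral>x. (\<phi> x)\<^sup>2 \<partial>lborel)" using I by (simp add: c_def power_divide)
  have "rayleigh_inf \<Omega> \<le> dirichlet (\<lambda>x. c * \<phi> x)"
    using I by (intro rayleigh_inf_le test_function_cmult \<phi>) (simp add: power_mult_distrib c2)
  also have "\<dots> = c\<^sup>2 * dirichlet \<phi>"
    unfolding dirichlet_def grad_cmult[OF \<phi>] by (simp add: power_mult_distrib)
  finally show ?thesis unfolding c2 using I by (simp add: field_simps)
qed

context phase_domain
begin

abbreviation "lam \<equiv> rayleigh_inf \<Omega>"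

lemma lam_pos: "lam > 0"
  by (rule rayleigh_inf_pos[OF open_Omega bounded_Omega nonempty_Omega])

lemma total_energy_tendsto_0D:
  assumes fe: "\<And>n. finite_energy (u n) (g n)" and lim: "(\<lambda>n. total_energy (u n) (g n)) \<longlonglongrightarrow> 0"
  shows "(\<lambda>n. \<integral>x. (norm (u n x))\<^sup>2 \<partial>M) \<longlonglongrightarrow> 0" "(\<lambda>n. \<integral>x. (norm (g n x))\<^sup>2 \<partial>M) \<longlonglongrightarrow> 0"
  by (rule tendsto_sandwich[OF _ _ tendsto_const lim];
      use integral_sq_le[OF fe] integral_grad_sq_le[OF fe] in \<open>auto intro!: always_eventually\<close>)+

lemma energy_convergenceD:
  assumes fe: "\<And>n. finite_energy (u n) (g n)" and fe': "finite_energy u' g'"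
    and lim: "(\<lambda>n. energy_dist (u n) (g n) u' g') \<longlonglongrightarrow> 0"
  shows "(\<lambda>n. \<integral>x. (u n x)\<^sup>2 \<partial>M) \<longlonglongrightarrow> (\<integral>x. (u' x)\<^sup>2 \<partial>M)"
    and "(\<lambda>n. \<integral>x. (norm (g n x))\<^sup>2 \<partial>M) \<longlonglongrightarrow> (\<integral>x. (norm (g' x))\<^sup>2 \<partial>M)"
    and "\<And>h. h \<in> borel_measurable M \<Longrightarrow> integrable M (\<lambda>x. (h x)\<^sup>2) \<Longrightarrow>
      (\<lambda>n. \<integral>x. u n x * h x \<partial>M) \<longlonglongrightarrow> (\<integral>x. u' x * h x \<partial>M)"
proof -
  note [measurable] = finite_energyD(1,2)[OF fe] finite_energyD(1,2)[OF fe']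
  note z = total_energy_tendsto_0D[OF finite_energy_diff[OF fe fe'] lim]
  note sq = sq_integrable[OF fe] sq_integrable[OF fe'] grad_sq_int[OF fe] grad_sq_int[OF fe']
  show "(\<lambda>n. \<integral>x. (norm (g n x))\<^sup>2 \<partial>M) \<longlonglongrightarrow> (\<integral>x. (norm (g' x))\<^sup>2 \<partial>M)"
    by (rule tendsto_integral_norm_sq[where h = g']) (use sq z in auto)
  have "(\<lambda>n. \<integral>x. (norm (u n x))\<^sup>2 \<partial>M) \<longlonglongrightarrow> (\<integral>x. (norm (u' x))\<^sup>2 \<partial>M)"
    by (rule tendsto_integral_norm_sq[where h = u']) (use sq z in auto)
  then show "(\<lambda>n. \<integral>x. (u n x)\<^sup>2 \<partial>M) \<longlonglongrightarrow> (\<integral>x. (u' x)\<^sup>2 \<partial>M)" by simp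
  fix h :: "real^'n \<Rightarrow> real" assume [measurable]: "h \<in> borel_measurable M" and h: "integrable M (\<lambda>x. (h x)\<^sup>2)"
  have "(\<lambda>n. \<integral>x. u n x \<bullet> h x \<partial>M) \<longlonglongrightarrow> (\<integral>x. u' x \<bullet> h x \<partial>M)"
    by (rule tendsto_integral_inner) (use sq z h in auto)
  then show "(\<lambda>n. \<integral>x. u n x * h x \<partial>M) \<longlonglongrightarrow> (\<integral>x. u' x * h x \<partial>M)" by simp
qed

theorem W0_poincare:
  assumes W: "W0 u g"
  shows "lam * (\<integral>x. (u x)\<^sup>2 \<partial>M) \<le> (\<integral>x. (norm (g x))\<^sup>2 \<partial>M)"
proof -
  obtain \<phi> where \<phi>: "\<And>n. \<phi> n \<in> test_functions \<Omega>"
    and \<phi>e: "\<And>n. energy_dist u g (\<phi> n) (grad (\<phi> n)) < 1 / real (Suc n)"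
    using W0_approx_sequence[OF W] by blast
  have lim0: "(\<lambda>n. 1 / real (Suc n)) \<longlonglongrightarrow> 0" using LIMSEQ_inverse_real_of_nat by (simp add: inverse_eq_divide)
  have sym: "energy (\<lambda>x. \<phi> n x - u x) (\<lambda>x. grad (\<phi> n) x - g x) = energy (\<lambda>x. u x - \<phi> n x) (\<lambda>x. g x - grad (\<phi> n) x)" for n
    using energy_minus[of "\<lambda>x. u x - \<phi> n x" "\<lambda>x. g x - grad (\<phi> n) x"] by simp
  have lim: "(\<lambda>n. energy_dist (\<phi> n) (grad (\<phi> n)) u g) \<longlonglongrightarrow> 0"
    unfolding sym
    by (rule tendsto_sandwich[OF _ _ tendsto_const lim0])
      (use \<phi>e total_energy_nonneg in \<open>auto intro!: always_eventually less_imp_le simp del: of_nat_Suc\<close>)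
  note c = energy_convergenceD[OF finite_energy_test[OF \<phi>] W0_finite_energy[OF W] lim]
  show ?thesis
  proof (rule LIMSEQ_le[OF tendsto_mult[OF tendsto_const c(1)] c(2)], intro exI allI impI)
    fix n
    show "lam * (\<integral>x. (\<phi> n x)\<^sup>2 \<partial>M) \<le> (\<integral>x. (norm (grad (\<phi> n) x))\<^sup>2 \<partial>M)"
      using rayleigh_test_function[OF \<phi>] by (simp add: integral_sq_test[OF \<phi>] dirichlet_eq[OF \<phi>, symmetric])
  qed
qed

end

lemma eq_0_if_quadratic_nonneg:
  fixes b c :: real
  assumes "\<And>t. 0 \<le> 2 * t * b + t\<^sup>2 * c"
  shows "b = 0"
proof (rule ccontr)
  assume "b \<noteq> 0"
  define k where "k = \<bar>c\<bar> + 1"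
  have k: "k > 0" "c < k" by (auto simp: k_def)
  have "0 \<le> 2 * (- b / k) * b + (- b / k)\<^sup>2 * c" by (rule assms)
  also have "\<dots> \<le> 2 * (- b / k) * b + (- b / k)\<^sup>2 * k" using k by (intro add_left_mono mult_left_mono) auto
  also have "\<dots> = - (b\<^sup>2 / k)" using k by (simp add: power2_eq_square)
  also have "\<dots> < 0" using k \<open>b \<noteq> 0\<close> by simp
  finally show False by simp
qed

locale laplace_domain = phase_domain \<Omega> q 0 "\<lambda>_. 0" for \<Omega> :: "(real^'n::finite) set" and q
begin

lemma H_eq_pure_power: "H = pure_power 2"
  by (simp add: fun_eq_iff double_phase_def pure_power_def)

lemma energy_laplace: "energy u g = (\<lambda>x. (u x)\<^sup>2 + (norm (g x))\<^sup>2)"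
  by (simp add: energy_def fun_eq_iff)

lemma total_energy_laplace:
  "finite_energy u g \<Longrightarrow> total_energy u g = (\<integral>x. (u x)\<^sup>2 \<partial>M) + (\<integral>x. (norm (g x))\<^sup>2 \<partial>M)"
  unfolding energy_laplace by (rule Bochner_Integration.integral_add[OF sq_integrable grad_sq_int])

text \<open>A minimizing sequence converges in the square norm along a subsequence by Rellich's theorem.  The
  parallelogram identity then forces the gradients to converge as well: the Rayleigh quotient of the sum of two
  almost minimizers is not much below the infimum.\<close>

lemma rayleigh_inf_attained:
  obtains u g where "W0 u g" "(\<integral>x. (u x)\<^sup>2 \<partial>M) = 1" "(\<integral>x. (norm (g x))\<^sup>2 \<partial>M) = lam"
proof -
  let ?A = "{dirichlet \<phi> |\<phi>. \<phi> \<in> test_functions \<Omega> \<and> (\<integral>x. (\<phi> x)\<^sup>2 \<partial>lborel) = 1}"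
  have ne: "?A \<noteq> {}" using ex_normalized_test_function[OF open_Omega nonempty_Omega] by blast
  have "\<exists>\<phi>. \<phi> \<in> test_functions \<Omega> \<and> (\<integral>x. (\<phi> x)\<^sup>2 \<partial>lborel) = 1 \<and> dirichlet \<phi> < lam + 1 / real (Suc n)" for n
  proof -
    have "Inf ?A < lam + 1 / real (Suc n)" unfolding rayleigh_inf_def by simp
    from cInf_lessD[OF ne this] show ?thesis by auto
  qed
  then obtain \<phi>0 where \<phi>0: "\<And>n. \<phi>0 n \<in> test_functions \<Omega>" "\<And>n. (\<integral>x. (\<phi>0 n x)\<^sup>2 \<partial>lborel) = 1"
    "\<And>n. dirichlet (\<phi>0 n) < lam + 1 / real (Suc n)" by metis
  have "dirichlet (\<phi>0 n) \<le> lam + 1" for n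
    using \<phi>0(3)[of n] by (rule order_trans[OF less_imp_le]) simp
  then obtain s :: "nat \<Rightarrow> nat" where s: "strict_mono s"
    and s_cauchy: "\<And>\<epsilon>. \<epsilon> > 0 \<Longrightarrow> \<exists>N. \<forall>i\<ge>N. \<forall>j\<ge>N. (\<integral>x. (\<phi>0 (s i) x - \<phi>0 (s j) x)\<^sup>2 \<partial>lborel) < \<epsilon>"
    using rellich_test_functions[OF bounded_Omega, of \<phi>0 "lam + 1"] \<phi>0(1) by blast
  define \<phi> where "\<phi> n = \<phi>0 (s n)" for n
  have \<phi>: "\<phi> n \<in> test_functions \<Omega>" and \<phi>1: "(\<integral>x. (\<phi> n x)\<^sup>2 \<partial>M) = 1" for n
    using \<phi>0 by (auto simp: \<phi>_def integral_sq_test)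
  have \<phi>d: "(\<integral>x. (norm (grad (\<phi> n) x))\<^sup>2 \<partial>M) < lam + 1 / real (Suc n)" for n
  proof -
    have "1 / real (Suc (s n)) \<le> 1 / real (Suc n)"
      using seq_suble[OF s, of n] by (intro divide_left_mono) auto
    then show ?thesis using \<phi>0(3)[of "s n"] by (simp add: \<phi>_def dirichlet_eq[OF \<phi>0(1)] del: of_nat_Suc)
  qed
  note fe = finite_energy_test[OF \<phi>]
  note [measurable] = test_measurable[OF \<phi>]
  note sq = sq_integrable[OF fe] grad_sq_int[OF fe]
  have para: "(\<integral>x. (norm (grad (\<phi> i) x - grad (\<phi> j) x))\<^sup>2 \<partial>M)
      \<le> 2 / real (Suc i) + 2 / real (Suc j) + lam * (\<integral>x. (\<phi> i x - \<phi> j x)\<^sup>2 \<partial>M)" for i j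
  proof -
    note g = integral_norm_sq_add(2)[OF test_measurable(2)[OF \<phi>] test_measurable(2)[OF \<phi>] sq(2) sq(2), of i j]
      integral_norm_sq_diff(2)[OF test_measurable(2)[OF \<phi>] test_measurable(2)[OF \<phi>] sq(2) sq(2), of i j]
    have u1: "(\<integral>x. (norm (\<phi> i x + \<phi> j x))\<^sup>2 \<partial>M) = 2 + 2 * (\<integral>x. \<phi> i x \<bullet> \<phi> j x \<partial>M)"
      using sq(1) by (subst integral_norm_sq_add(2)) (auto simp: \<phi>1)
    have u2: "(\<integral>x. (norm (\<phi> i x - \<phi> j x))\<^sup>2 \<partial>M) = 2 - 2 * (\<integral>x. \<phi> i x \<bullet> \<phi> j x \<partial>M)"
      using sq(1) by (subst integral_norm_sq_diff(2)) (auto simp: \<phi>1)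
    have "lam * (\<integral>x. (\<phi> i x + \<phi> j x)\<^sup>2 \<partial>M) \<le> (\<integral>x. (norm (grad (\<phi> i) x + grad (\<phi> j) x))\<^sup>2 \<partial>M)"
      by (rule W0_poincare[OF W0_add[OF W0_test[OF \<phi>] W0_test[OF \<phi>]]])
    moreover have "(\<integral>x. (\<phi> i x + \<phi> j x)\<^sup>2 \<partial>M) = 4 - (\<integral>x. (\<phi> i x - \<phi> j x)\<^sup>2 \<partial>M)" using u1 u2 by simp
    ultimately have "lam * (4 - (\<integral>x. (\<phi> i x - \<phi> j x)\<^sup>2 \<partial>M)) \<le> (\<integral>x. (norm (grad (\<phi> i) x + grad (\<phi> j) x))\<^sup>2 \<partial>M)" by simp
    then have "4 * lam - lam * (\<integral>x. (\<phi> i x - \<phi> j x)\<^sup>2 \<partial>M) \<le> (\<integral>x. (norm (grad (\<phi> i) x + grad (\<phi> j) x))\<^sup>2 \<partial>M)"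
      by (simp add: algebra_simps)
    then show ?thesis using g \<phi>d[of i] \<phi>d[of j] by simp
  qed
  have cauchy: "\<exists>N. \<forall>i\<ge>N. \<forall>j\<ge>N. energy_dist (\<phi> i) (grad (\<phi> i)) (\<phi> j) (grad (\<phi> j)) < \<epsilon>" if \<epsilon>: "\<epsilon> > 0" for \<epsilon>
  proof -
    define e where "e = \<epsilon> / (2 * (1 + lam))"
    have half: "c * (\<epsilon> / (2 * c)) = \<epsilon> / 2" if "c > 0" for c using that by simp
    have e: "e > 0" "(1 + lam) * e = \<epsilon> / 2"
      unfolding e_def using \<epsilon> lam_pos by (simp, intro half, simp)
    obtain N1 where N1: "\<And>i j. i \<ge> N1 \<Longrightarrow> j \<ge> N1 \<Longrightarrow> (\<integral>x. (\<phi> i x - \<phi> j x)\<^sup>2 \<partial>lborel) < e"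
      using s_cauchy[OF e(1)] unfolding \<phi>_def by blast
    obtain N2 where N2: "1 / real (Suc N2) < \<epsilon> / 8" using nat_approx_posE[of "\<epsilon> / 8"] \<epsilon> by auto
    have "energy_dist (\<phi> i) (grad (\<phi> i)) (\<phi> j) (grad (\<phi> j)) < \<epsilon>" if "i \<ge> max N1 N2" "j \<ge> max N1 N2" for i j
    proof -
      have small: "1 / real (Suc k) < \<epsilon> / 8" if "k \<ge> N2" for k
        using that by (intro le_less_trans[OF divide_left_mono N2]) auto
      have "(\<integral>x. (\<phi> i x - \<phi> j x)\<^sup>2 \<partial>M) < e"
        using N1[of i j] that integral_sq_test[OF test_function_diff[OF \<phi> \<phi>], of i j] by simp
      then have "(1 + lam) * (\<integral>x. (\<phi> i x - \<phi> j x)\<^sup>2 \<partial>M) < \<epsilon> / 2"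
        using e(2) lam_pos by (metis add_pos_pos mult_strict_left_mono zero_less_one)
      moreover have "energy_dist (\<phi> i) (grad (\<phi> i)) (\<phi> j) (grad (\<phi> j))
          \<le> (1 + lam) * (\<integral>x. (\<phi> i x - \<phi> j x)\<^sup>2 \<partial>M) + 2 * (1 / real (Suc i)) + 2 * (1 / real (Suc j))"
        using para[of i j] unfolding total_energy_laplace[OF finite_energy_diff[OF fe fe]] by (simp add: distrib_right)
      ultimately show ?thesis using small[of i] small[of j] that by linarith
    qed
    then show ?thesis by blast
  qed
  obtain u g and r :: "nat \<Rightarrow> nat" where ug: "W0 u g" and "strict_mono r"
    "AE x in M. (\<lambda>i. \<phi> (r i) x) \<longlonglongrightarrow> u x" "AE x in M. (\<lambda>i. grad (\<phi> (r i)) x) \<longlonglongrightarrow> g x"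
    and lim: "(\<lambda>n. energy_dist (\<phi> n) (grad (\<phi> n)) u g) \<longlonglongrightarrow> 0"
    by (rule W0_complete[of \<phi> "\<lambda>n. grad (\<phi> n)", OF W0_test[OF \<phi>] cauchy])
  note c = energy_convergenceD[OF fe W0_finite_energy[OF ug] lim]
  have u1: "(\<integral>x. (u x)\<^sup>2 \<partial>M) = 1" using c(1) by (simp add: \<phi>1 LIMSEQ_const_iff)
  have "(\<lambda>n. lam + 1 / real (Suc n)) \<longlonglongrightarrow> lam + 0"
    using LIMSEQ_inverse_real_of_nat by (intro tendsto_add tendsto_const) (simp add: inverse_eq_divide)
  then have "(\<integral>x. (norm (g x))\<^sup>2 \<partial>M) \<le> lam + 0"
    using \<phi>d by (intro LIMSEQ_le[OF c(2)]) (auto intro: less_imp_le)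
  moreover have "lam \<le> (\<integral>x. (norm (g x))\<^sup>2 \<partial>M)" using W0_poincare[OF ug] by (simp add: u1)
  ultimately show thesis using that[OF ug u1] by simp
qed

text \<open>The quadratic form of the Rayleigh inequality is nonnegative and vanishes at a minimizer, so its derivative there is
  zero.\<close>

lemma rayleigh_euler_lagrange:
  assumes W: "W0 u g" and min: "(\<integral>x. (norm (g x))\<^sup>2 \<partial>M) = lam * (\<integral>x. (u x)\<^sup>2 \<partial>M)" and V: "W0 v h"
  shows "(\<integral>x. g x \<bullet> h x \<partial>M) = lam * (\<integral>x. u x * v x \<partial>M)"
proof -
  note fe = W0_finite_energy[OF W] and fv = W0_finite_energy[OF V]
  note [measurable] = finite_energyD(1,2)[OF fe] finite_energyD(1,2)[OF fv]
  define b where "b = (\<integral>x. g x \<bullet> h x \<partial>M) - lam * (\<integral>x. u x * v x \<partial>M)"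
  define c where "c = (\<integral>x. (norm (h x))\<^sup>2 \<partial>M) - lam * (\<integral>x. (v x)\<^sup>2 \<partial>M)"
  have "0 \<le> 2 * t * b + t\<^sup>2 * c" for t
  proof -
    note Vt = W0_cmult[OF V, of t]
    note ft = W0_finite_energy[OF Vt]
    have a: "lam * (\<integral>x. (u x + t * v x)\<^sup>2 \<partial>M) \<le> (\<integral>x. (norm (g x + t *\<^sub>R h x))\<^sup>2 \<partial>M)"
      by (rule W0_poincare[OF W0_add[OF W Vt]])
    have b1: "(\<integral>x. (norm (g x + t *\<^sub>R h x))\<^sup>2 \<partial>M) = (\<integral>x. (norm (g x))\<^sup>2 \<partial>M) + 2 * t * (\<integral>x. g x \<bullet> h x \<partial>M) + t\<^sup>2 * (\<integral>x. (norm (h x))\<^sup>2 \<partial>M)"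
      using grad_sq_int[OF fe] grad_sq_int[OF ft]
      by (subst integral_norm_sq_add(2)) (auto simp: power_mult_distrib)
    have "(\<integral>x. (norm (u x + t * v x))\<^sup>2 \<partial>M) = (\<integral>x. (u x)\<^sup>2 \<partial>M) + 2 * t * (\<integral>x. u x * v x \<partial>M) + t\<^sup>2 * (\<integral>x. (v x)\<^sup>2 \<partial>M)"
      using sq_integrable[OF fe] sq_integrable[OF ft]
      by (subst integral_norm_sq_add(2)) (auto simp: power_mult_distrib mult.left_commute[of _ t])
    with a b1 show ?thesis by (simp add: min b_def c_def algebra_simps)
  qed
  then have "b = 0" by (rule eq_0_if_quadratic_nonneg)
  then show ?thesis by (simp add: b_def)
qed

text \<open>The minimizer is an eigenfunction, and testing any eigenvalue equation with its own eigenfunction shows that no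
  eigenvalue lies below the infimum.\<close>

theorem first_eigenvalue_eq: "first_eigenvalue 2 \<Omega> = lam"
  unfolding first_eigenvalue_def
proof (rule Least_equality)
  have pw0: "norm v powr (2 - 2) *\<^sub>R v = v" "\<bar>t\<bar> powr (2 - 2) * t = t" for v :: "real^'n" and t :: real
    by auto
  obtain u g where ug: "W0 u g" "(\<integral>x. (u x)\<^sup>2 \<partial>M) = 1" "(\<integral>x. (norm (g x))\<^sup>2 \<partial>M) = lam"
    using rayleigh_inf_attained .
  note wg = W0_weak_grad[OF ug(1)]
  have "(\<integral>x. (norm (weak_grad \<Omega> u x))\<^sup>2 \<partial>M) = (\<integral>x. (norm (g x))\<^sup>2 \<partial>M)"
    using wg(1) by (intro integral_cong_AE)
      (use grad_sq_int[OF W0_finite_energy[OF ug(1)]] grad_sq_int[OF W0_finite_energy[OF wg(3)]] in auto)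
  then have min: "(\<integral>x. (norm (weak_grad \<Omega> u x))\<^sup>2 \<partial>M) = lam * (\<integral>x. (u x)\<^sup>2 \<partial>M)" using ug by simp
  have "\<not> (AE x in M. u x = 0)"
  proof
    assume "AE x in M. u x = 0"
    then have "AE x in M. (u x)\<^sup>2 = 0" by eventually_elim simp
    then have "(\<integral>x. (u x)\<^sup>2 \<partial>M) = 0" by (rule integral_eq_zero_AE)
    then show False using ug(2) by simp
  qed
  then show "is_eigenvalue 2 \<Omega> lam"
    unfolding is_eigenvalue_def pw0 H_eq_pure_power[symmetric]
    using sobolev_space0_if_W0[OF ug(1)] rayleigh_euler_lagrange[OF wg(3) min W0_if_sobolev_space0] by blast
  fix l assume "is_eigenvalue 2 \<Omega> l"
  then obtain v where v: "v \<in> sobolev_space0 H \<Omega>" "\<not> (AE x in M. v x = 0)"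
    and eq: "\<And>\<phi>. \<phi> \<in> sobolev_space0 H \<Omega> \<Longrightarrow> (LINT x|M. weak_grad \<Omega> v x \<bullet> weak_grad \<Omega> \<phi> x) = l * (LINT x|M. v x * \<phi> x)"
    unfolding is_eigenvalue_def pw0 H_eq_pure_power[symmetric] by blast
  note W = W0_if_sobolev_space0[OF v(1)]
  have e: "(\<integral>x. (norm (weak_grad \<Omega> v x))\<^sup>2 \<partial>M) = l * (\<integral>x. (v x)\<^sup>2 \<partial>M)"
    unfolding power2_norm_eq_inner using eq[OF v(1)] by (simp add: power2_eq_square)
  have "(\<integral>x. (v x)\<^sup>2 \<partial>M) \<noteq> 0"
  proof
    assume "(\<integral>x. (v x)\<^sup>2 \<partial>M) = 0"
    then have "AE x in M. (v x)\<^sup>2 = 0"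
      by (subst (asm) integral_nonneg_eq_0_iff_AE[OF sq_integrable[OF W0_finite_energy[OF W]]]) auto
    then show False using v(2) by simp
  qed
  moreover have "(\<integral>x. (v x)\<^sup>2 \<partial>M) \<ge> 0" by simp
  ultimately have "(\<integral>x. (v x)\<^sup>2 \<partial>M) > 0" by linarith
  moreover have "lam * (\<integral>x. (v x)\<^sup>2 \<partial>M) \<le> l * (\<integral>x. (v x)\<^sup>2 \<partial>M)" using W0_poincare[OF W] e by simp
  ultimately show "lam \<le> l" by (simp add: mult_le_cancel_right)
qed

end

section \<open>Convexity of the double phase integrand\<close>

lemma powr_minus_mult_norm:
  fixes a :: "'b::real_normed_vector"
  shows "norm a powr (r - 1) * norm a = norm a powr r"
    "norm a powr (r - 2) * norm a = norm a powr (r - 1)"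
    "norm a powr (r - 2) * (norm a)\<^sup>2 = norm a powr r"
proof -
  have *: "norm a powr (s - 1) * norm a = norm a powr s" for s
    by (cases "a = 0") (auto simp: powr_diff)
  show "norm a powr (r - 1) * norm a = norm a powr r" by (rule *)
  show 1: "norm a powr (r - 2) * norm a = norm a powr (r - 1)" using *[of "r - 1"] by simp
  show "norm a powr (r - 2) * (norm a)\<^sup>2 = norm a powr r"
    using 1 *[of r] by (simp add: power2_eq_square mult.assoc[symmetric])
qed

text \<open>The gradient inequality for the convex function \<open>\<xi> \<mapsto> \<bar>\<xi>\<bar>\<^sup>r / r\<close>, obtained from Young's inequality.\<close>

lemma norm_powr_gradient_ineq:
  fixes a b :: "'b::real_inner"
  assumes r: "r > 1"
  shows "norm a powr r / r - norm b powr r / r \<le> norm a powr (r - 2) * (a \<bullet> (a - b))"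
proof -
  have "norm a powr (r - 2) * (a \<bullet> b) \<le> norm a powr (r - 2) * (norm a * norm b)"
    by (intro mult_left_mono norm_cauchy_schwarz) auto
  also have "\<dots> = norm a powr (r - 1) * norm b" using powr_minus_mult_norm(2)[of a r] by (simp add: mult.assoc[symmetric])
  also have "\<dots> \<le> (norm a powr (r - 1)) powr (r / (r - 1)) / (r / (r - 1)) + norm b powr r / r"
    using r by (intro Youngs_inequality) (auto simp: field_simps)
  also have "(norm a powr (r - 1)) powr (r / (r - 1)) = norm a powr r" using r by (simp add: powr_powr)
  also have "norm a powr r / (r / (r - 1)) = norm a powr r - norm a powr r / r" using r by (simp add: field_simps)
  finally have "norm a powr (r - 2) * (a \<bullet> b) \<le> norm a powr r - norm a powr r / r + norm b powr r / r" .
  moreover have "norm a powr (r - 2) * (a \<bullet> a) = norm a powr r"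
    using powr_minus_mult_norm(3)[of a r] by (simp add: power2_norm_eq_inner)
  ultimately show ?thesis by (simp add: inner_diff_right right_diff_distrib)
qed

lemma powr_midpoint_convex:
  fixes s t :: real
  assumes "0 \<le> s" "0 \<le> t" "r > 1"
  shows "((s + t) / 2) powr r \<le> (s powr r + t powr r) / 2"
proof -
  let ?m = "(s + t) / 2"
  have "norm ?m powr r / r - norm s powr r / r \<le> norm ?m powr (r - 2) * (?m \<bullet> (?m - s))"
    "norm ?m powr r / r - norm t powr r / r \<le> norm ?m powr (r - 2) * (?m \<bullet> (?m - t))"
    by (rule norm_powr_gradient_ineq[OF assms(3)])+
  moreover have "(?m - s) + (?m - t) = 0" by (simp add: field_simps)
  then have "norm ?m powr (r - 2) * (?m \<bullet> (?m - s)) + norm ?m powr (r - 2) * (?m \<bullet> (?m - t)) = 0"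
    unfolding distrib_left[symmetric] inner_add_right[symmetric] by (simp only: inner_zero_right mult_zero_right)
  ultimately have "norm ?m powr r / r + norm ?m powr r / r \<le> norm s powr r / r + norm t powr r / r" by linarith
  then have "(norm ?m powr r + norm ?m powr r) / r \<le> (norm s powr r + norm t powr r) / r" by (simp add: add_divide_distrib)
  then have "norm ?m powr r + norm ?m powr r \<le> norm s powr r + norm t powr r"
    using assms(3) by (simp add: divide_le_cancel)
  then show ?thesis using assms by simp
qed

lemma powr_superadditive:
  fixes s t :: real
  assumes "0 \<le> s" "0 \<le> t" "r \<ge> 1"
  shows "s powr r + t powr r \<le> (s + t) powr r"
proof -
  have *: "x powr r = x * x powr (r - 1)" if "x \<ge> 0" for x :: real
    using that by (cases "x = 0") (auto simp: powr_diff)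
  have "s powr r + t powr r \<le> s * (s + t) powr (r - 1) + t * (s + t) powr (r - 1)"
    using assms by (simp only: *) (intro add_mono mult_left_mono powr_mono2; simp)
  also have "\<dots> = (s + t) powr r" using assms by (simp add: *[of "s + t"] distrib_right)
  finally show ?thesis .
qed

text \<open>Clarkson's inequality: with \<open>s = \<bar>(a+b)/2\<bar>\<^sup>2\<close> and \<open>t = \<bar>(a-b)/2\<bar>\<^sup>2\<close> the parallelogram identity says that
  \<open>s + t\<close> is the mean of \<open>\<bar>a\<bar>\<^sup>2\<close> and \<open>\<bar>b\<bar>\<^sup>2\<close>.\<close>

lemma clarkson:
  fixes a b :: "'b::real_inner"
  assumes r: "r > 2"
  shows "norm ((1 / 2) *\<^sub>R (a + b)) powr r + norm ((1 / 2) *\<^sub>R (a - b)) powr r \<le> (norm a powr r + norm b powr r) / 2"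
proof -
  have pw: "norm x powr r = ((norm x)\<^sup>2) powr (r / 2)" for x :: 'b
    unfolding norm_powr_2[symmetric] powr_powr by simp
  let ?s = "(norm ((1 / 2) *\<^sub>R (a + b)))\<^sup>2" and ?t = "(norm ((1 / 2) *\<^sub>R (a - b)))\<^sup>2"
  have st: "?s + ?t = ((norm a)\<^sup>2 + (norm b)\<^sup>2) / 2"
    by (simp add: power2_norm_eq_inner inner_add_left inner_add_right inner_diff_left inner_diff_right inner_commute algebra_simps)
  have "?s powr (r / 2) + ?t powr (r / 2) \<le> (?s + ?t) powr (r / 2)"
    using r by (intro powr_superadditive) auto
  also have "\<dots> \<le> (((norm a)\<^sup>2) powr (r / 2) + ((norm b)\<^sup>2) powr (r / 2)) / 2"
    unfolding st using r by (intro powr_midpoint_convex) auto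
  finally show ?thesis unfolding pw .
qed

lemma parallelogram:
  fixes a b :: "'b::real_inner"
  shows "(norm ((1 / 2) *\<^sub>R (a + b)))\<^sup>2 + (norm ((1 / 2) *\<^sub>R (a - b)))\<^sup>2 = ((norm a)\<^sup>2 + (norm b)\<^sup>2) / 2"
  by (simp add: power2_norm_eq_inner inner_add_left inner_add_right inner_diff_left inner_diff_right inner_commute algebra_simps)

context phase_domain
begin

definition potential :: "real^'n \<Rightarrow> real^'n \<Rightarrow> real" where
  "potential x \<xi> = (norm \<xi>)\<^sup>2 / 2 + \<mu> x * norm \<xi> powr q / q"

abbreviation "flux \<equiv> double_phase_flux 2 q \<mu> :: real^'n \<Rightarrow> real^'n \<Rightarrow> real^'n"

lemma flux_eq: "flux x \<xi> = \<xi> + (\<mu> x * norm \<xi> powr (q - 2)) *\<^sub>R \<xi>"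
  by (simp add: double_phase_flux_def)

lemma potential_nonneg: "x \<in> \<Omega> \<Longrightarrow> 0 \<le> potential x \<xi>"
  using mu(1) q(1) by (simp add: potential_def)

lemma potential_gradient_ineq:
  assumes "x \<in> \<Omega>"
  shows "potential x a - potential x b \<le> flux x a \<bullet> (a - b)"
proof -
  have "\<mu> x * (norm a powr q / q - norm b powr q / q) \<le> \<mu> x * (norm a powr (q - 2) * (a \<bullet> (a - b)))"
    using q(1) by (intro mult_left_mono norm_powr_gradient_ineq mu(1) assms) auto
  moreover have "(norm a)\<^sup>2 / 2 - (norm b)\<^sup>2 / 2 \<le> a \<bullet> (a - b)"
  proof -
    have "0 \<le> (norm (a - b))\<^sup>2" by simp
    then show ?thesis by (simp add: power2_norm_eq_inner inner_diff_left inner_diff_right inner_commute)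
  qed
  ultimately show ?thesis by (simp add: potential_def flux_eq inner_add_left algebra_simps)
qed

lemma flux_strongly_monotone:
  assumes "x \<in> \<Omega>"
  shows "(norm (a - b))\<^sup>2 \<le> (flux x a - flux x b) \<bullet> (a - b)"
proof -
  let ?G = "\<lambda>a. norm a powr (q - 2) *\<^sub>R (a :: real^'n)"
  have "norm a powr q / q - norm b powr q / q \<le> ?G a \<bullet> (a - b)"
    "norm b powr q / q - norm a powr q / q \<le> ?G b \<bullet> (b - a)"
    using q(1) norm_powr_gradient_ineq[of q a b] norm_powr_gradient_ineq[of q b a] by auto
  then have "0 \<le> ?G a \<bullet> (a - b) + ?G b \<bullet> (b - a)" by linarith
  also have "\<dots> = (?G a - ?G b) \<bullet> (a - b)" by (simp add: inner_diff_left inner_diff_right algebra_simps)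
  finally have "0 \<le> \<mu> x * ((?G a - ?G b) \<bullet> (a - b))" using mu(1)[OF assms] by simp
  moreover have "(flux x a - flux x b) \<bullet> (a - b) = (norm (a - b))\<^sup>2 + \<mu> x * ((?G a - ?G b) \<bullet> (a - b))"
    by (simp add: flux_eq power2_norm_eq_inner inner_diff_left inner_diff_right inner_add_left algebra_simps)
  ultimately show ?thesis by simp
qed

lemma potential_midpoint:
  assumes "x \<in> \<Omega>"
  shows "potential x ((1 / 2) *\<^sub>R (a + b)) + potential x ((1 / 2) *\<^sub>R (a - b)) \<le> (potential x a + potential x b) / 2"
proof -
  have "\<mu> x / q * (norm ((1 / 2) *\<^sub>R (a + b)) powr q + norm ((1 / 2) *\<^sub>R (a - b)) powr q) \<le> \<mu> x / q * ((norm a powr q + norm b powr q) / 2)"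
    using q(1) mu(1)[OF assms] by (intro mult_left_mono clarkson) auto
  moreover have "1 / 2 * ((norm ((1 / 2) *\<^sub>R (a + b)))\<^sup>2 + (norm ((1 / 2) *\<^sub>R (a - b)))\<^sup>2) = 1 / 2 * (((norm a)\<^sup>2 + (norm b)\<^sup>2) / 2)"
    unfolding parallelogram ..
  ultimately show ?thesis unfolding potential_def by (simp add: algebra_simps)
qed

lemma young_powr:
  fixes a b :: real
  assumes "0 \<le> a" "0 \<le> b"
  shows "a powr (q - 1) * b \<le> (a + b) powr q"
proof -
  have *: "x powr q = x powr (q - 1) * x" if "x \<ge> 0" for x :: real
    using that by (cases "x = 0") (auto simp: powr_diff)
  show ?thesis unfolding *[OF add_nonneg_nonneg[OF assms]]
    using assms q(1) by (intro mult_mono powr_mono2) auto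
qed

lemma flux_inner_le:
  assumes "x \<in> \<Omega>" "norm a \<le> s" "0 \<le> s"
  shows "\<bar>flux x a \<bullet> b\<bar> \<le> (s + norm b)\<^sup>2 + \<mu> x * (s + norm b) powr q"
proof -
  have "\<bar>flux x a \<bullet> b\<bar> \<le> norm a * norm b + \<mu> x * (norm a powr (q - 1) * norm b)"
  proof -
    have "\<bar>flux x a \<bullet> b\<bar> \<le> \<bar>a \<bullet> b\<bar> + \<mu> x * norm a powr (q - 2) * \<bar>a \<bullet> b\<bar>"
      using mu(1)[OF assms(1)] abs_triangle_ineq[of "a \<bullet> b" "\<mu> x * norm a powr (q - 2) * (a \<bullet> b)"]
      by (simp add: flux_eq inner_add_left abs_mult)
    also have "\<dots> \<le> norm a * norm b + \<mu> x * norm a powr (q - 2) * (norm a * norm b)"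
      using mu(1)[OF assms(1)] by (intro add_mono mult_left_mono Cauchy_Schwarz_ineq2) auto
    also have "\<mu> x * norm a powr (q - 2) * (norm a * norm b) = \<mu> x * ((norm a powr (q - 2) * norm a) * norm b)" by simp
    finally show ?thesis unfolding powr_minus_mult_norm(2) .
  qed
  also have "\<dots> \<le> (s + norm b)\<^sup>2 + \<mu> x * (s + norm b) powr q"
  proof (intro add_mono mult_left_mono mu(1) assms(1))
    have "norm a * norm b \<le> (s + norm b) * (s + norm b)" using assms by (intro mult_mono) (auto intro: add_increasing2)
    then show "norm a * norm b \<le> (s + norm b)\<^sup>2" by (simp add: power2_eq_square)
    have "norm a powr (q - 1) * norm b \<le> s powr (q - 1) * norm b"
      using assms q(1) by (intro mult_right_mono powr_mono2) auto
    also have "\<dots> \<le> (s + norm b) powr q" using assms by (intro young_powr) auto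
    finally show "norm a powr (q - 1) * norm b \<le> (s + norm b) powr q" .
  qed
  finally show ?thesis .
qed

section \<open>Solving the problem with a square integrable right-hand side\<close>

lemma flux_measurable [measurable]:
  assumes [measurable]: "g \<in> borel_measurable M"
  shows "(\<lambda>x. flux x (g x)) \<in> borel_measurable M"
  unfolding flux_eq by measurable

text \<open>The sum of the norms is the norm of a sum of multiples of one unit vector, so its integrability is an instance of
  the closure of finite energies under addition.\<close>

lemma flux_dominating:
  assumes "finite_energy u g" "finite_energy v h"
  shows "integrable M (\<lambda>x. (norm (g x) + norm (h x) + norm (h x))\<^sup>2 + \<mu> x * (norm (g x) + norm (h x) + norm (h x)) powr q)"
proof -
  have m[measurable]: "g \<in> borel_measurable M" "h \<in> borel_measurable M" using assms by (auto dest: finite_energyD)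
  define e1 where "e1 = (axis (SOME i. True) 1 :: real^'n)"
  have e1: "norm e1 = 1" by (simp add: e1_def)
  have scal: "finite_energy (\<lambda>_. 0) (\<lambda>x. norm (k x) *\<^sub>R e1)" if "finite_energy w k" for w k
  proof -
    note [measurable] = finite_energyD(1,2)[OF that]
    have "energy (\<lambda>_. 0) (\<lambda>x. norm (k x) *\<^sub>R e1) = (\<lambda>x. (norm (k x))\<^sup>2 + \<mu> x * norm (k x) powr q)"
      by (simp add: energy_def fun_eq_iff e1)
    then show ?thesis using grad_sq_int[OF that] grad_powr_integrable[OF that] by (simp add: finite_energy_def)
  qed
  have "finite_energy (\<lambda>_. 0 + 0 + 0) (\<lambda>x. norm (g x) *\<^sub>R e1 + norm (h x) *\<^sub>R e1 + norm (h x) *\<^sub>R e1)"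
    by (intro finite_energy_add scal[OF assms(1)] scal[OF assms(2)])
  then have "integrable M (energy (\<lambda>_. 0 + 0 + 0) (\<lambda>x. norm (g x) *\<^sub>R e1 + norm (h x) *\<^sub>R e1 + norm (h x) *\<^sub>R e1))"
    by (rule finite_energyD)
  also have "energy (\<lambda>_. 0 + 0 + 0) (\<lambda>x. norm (g x) *\<^sub>R e1 + norm (h x) *\<^sub>R e1 + norm (h x) *\<^sub>R e1)
      = (\<lambda>x. (norm (g x) + norm (h x) + norm (h x))\<^sup>2 + \<mu> x * (norm (g x) + norm (h x) + norm (h x)) powr q)"
    by (simp add: energy_def fun_eq_iff e1 scaleR_add_left[symmetric])
  finally show ?thesis .
qed

lemma flux_inner_bound:
  assumes "x \<in> \<Omega>" "\<bar>t\<bar> \<le> 1"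
  shows "\<bar>flux x (g x + t *\<^sub>R h x) \<bullet> h x\<bar>
    \<le> (norm (g x) + norm (h x) + norm (h x))\<^sup>2 + \<mu> x * (norm (g x) + norm (h x) + norm (h x)) powr q"
proof (rule flux_inner_le[OF assms(1)])
  have "norm (g x + t *\<^sub>R h x) \<le> norm (g x) + \<bar>t\<bar> * norm (h x)" using norm_triangle_ineq[of "g x" "t *\<^sub>R h x"] by simp
  also have "\<dots> \<le> norm (g x) + 1 * norm (h x)" using assms(2) by (intro add_left_mono mult_right_mono) auto
  finally show "norm (g x + t *\<^sub>R h x) \<le> norm (g x) + norm (h x)" by simp
qed simp

lemma flux_integrable:
  assumes "finite_energy u g" "finite_energy v h"
  shows "integrable M (\<lambda>x. flux x (g x) \<bullet> h x)"
proof (rule Bochner_Integration.integrable_bound[OF flux_dominating[OF assms]])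
  note [measurable] = finite_energyD(2)[OF assms(1)] finite_energyD(2)[OF assms(2)]
  show "(\<lambda>x. flux x (g x) \<bullet> h x) \<in> borel_measurable M" by measurable
  show "AE x in M. norm (flux x (g x) \<bullet> h x) \<le> norm ((norm (g x) + norm (h x) + norm (h x))\<^sup>2
      + \<mu> x * (norm (g x) + norm (h x) + norm (h x)) powr q)"
  proof (intro AE_I2)
    fix x assume "x \<in> space M"
    then show "norm (flux x (g x) \<bullet> h x) \<le> norm ((norm (g x) + norm (h x) + norm (h x))\<^sup>2
      + \<mu> x * (norm (g x) + norm (h x) + norm (h x)) powr q)"
      using flux_inner_bound[of x 0 g h] by simp
  qed
qed

lemma potential_integrable:
  assumes "finite_energy u g"
  shows "integrable M (\<lambda>x. potential x (g x))"
  unfolding potential_def using grad_sq_int[OF assms] grad_powr_integrable[OF assms] by auto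

lemma tendsto_flux:
  assumes "t \<longlonglongrightarrow> (0::real)"
  shows "(\<lambda>n. flux x (a + t n *\<^sub>R b)) \<longlonglongrightarrow> flux x a"
proof -
  have l: "(\<lambda>n. a + t n *\<^sub>R b) \<longlonglongrightarrow> a + 0 *\<^sub>R b" by (intro tendsto_intros assms)
  then have l': "(\<lambda>n. a + t n *\<^sub>R b) \<longlonglongrightarrow> a" by simp
  have "(\<lambda>n. norm (a + t n *\<^sub>R b) powr (q - 2)) \<longlonglongrightarrow> norm a powr (q - 2)"
    using q(1) by (intro tendsto_powr2 tendsto_norm l' tendsto_const) auto
  then show ?thesis unfolding flux_eq by (intro tendsto_add tendsto_scaleR tendsto_mult tendsto_const l')
qed

text \<open>The direct method for \<open>J u = \<integral> potential (\<nabla>u) - \<integral> f u\<close>.  Strong convergence of a minimizing sequence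
  comes from Clarkson's inequality, in place of weak compactness.\<close>

theorem ex_solution:
  assumes f[measurable]: "f \<in> borel_measurable M" and f2: "integrable M (\<lambda>x. (f x)\<^sup>2)"
  shows "\<exists>u g. W0 u g \<and> (\<forall>v h. W0 v h \<longrightarrow> (\<integral>x. flux x (g x) \<bullet> h x \<partial>M) = (\<integral>x. f x * v x \<partial>M))"
proof -
  define J where "J u g = (\<integral>x. potential x (g x) \<partial>M) - (\<integral>x. u x * f x \<partial>M)" for u and g :: "real^'n \<Rightarrow> real^'n"
  define m where "m = Inf {J u g |u g. W0 u g}"
  have fu: "integrable M (\<lambda>x. u x * f x)" if "W0 u g" for u g
    using finite_energyD(1)[OF W0_finite_energy[OF that]] sq_integrable[OF W0_finite_energy[OF that]] f2
    by (intro Cauchy_Schwarz_integral(1)) auto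
  have lower: "- (\<integral>x. (f x)\<^sup>2 \<partial>M) / (2 * lam) \<le> J u g" if W: "W0 u g" for u g
  proof -
    note fe = W0_finite_energy[OF W]
    note i = sq_integrable[OF fe] grad_sq_int[OF fe]
    have "u x * f x \<le> lam / 2 * (u x)\<^sup>2 + 1 / (2 * lam) * (f x)\<^sup>2" for x
    proof -
      have "0 \<le> (lam * u x - f x)\<^sup>2 / (2 * lam)" using lam_pos by simp
      also have "\<dots> = lam / 2 * (u x)\<^sup>2 + 1 / (2 * lam) * (f x)\<^sup>2 - u x * f x"
        using lam_pos by (simp add: power2_eq_square field_simps)
      finally show ?thesis by simp
    qed
    then have "(\<integral>x. u x * f x \<partial>M) \<le> (\<integral>x. lam / 2 * (u x)\<^sup>2 + 1 / (2 * lam) * (f x)\<^sup>2 \<partial>M)"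
      using i f2 fu[OF W] by (intro integral_mono) auto
    also have "\<dots> = lam / 2 * (\<integral>x. (u x)\<^sup>2 \<partial>M) + 1 / (2 * lam) * (\<integral>x. (f x)\<^sup>2 \<partial>M)" using i f2 by simp
    also have "lam / 2 * (\<integral>x. (u x)\<^sup>2 \<partial>M) \<le> (\<integral>x. (norm (g x))\<^sup>2 / 2 \<partial>M)" using W0_poincare[OF W] by simp
    also have "\<dots> \<le> (\<integral>x. potential x (g x) \<partial>M)"
      using i mu(1) q(1) by (intro integral_mono_AE potential_integrable[OF fe] AE_I2) (auto simp: potential_def)
    finally show ?thesis by (simp add: J_def)
  qed
  have m_le: "m \<le> J u g" if "W0 u g" for u g
    unfolding m_def using that lower by (intro cInf_lower bdd_belowI[of _ "- (\<integral>x. (f x)\<^sup>2 \<partial>M) / (2 * lam)"]) auto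
  have ne: "{J u g |u g. W0 u g} \<noteq> {}" using W0_test[OF test_function_zero] by blast
  have "\<exists>u g. W0 u g \<and> J u g < m + 1 / real (Suc n)" for n
  proof -
    have "Inf {J u g |u g. W0 u g} < m + 1 / real (Suc n)" unfolding m_def by simp
    from cInf_lessD[OF ne this] show ?thesis by blast
  qed
  then obtain u g where W: "\<And>n. W0 (u n) (g n)" and Jn: "\<And>n. J (u n) (g n) < m + 1 / real (Suc n)" by metis
  note fe = W0_finite_energy[OF W]
  note [measurable] = finite_energyD(1,2)[OF fe]
  have lim0: "(\<lambda>n. 1 / real (Suc n)) \<longlonglongrightarrow> 0" using LIMSEQ_inverse_real_of_nat by (simp add: inverse_eq_divide)
  \<comment> \<open>The midpoint of two almost minimizers cannot lie below the infimum, so Clarkson's inequality makes their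
    distance small.\<close>
  have mid: "(\<integral>x. potential x ((1 / 2) *\<^sub>R (g i x - g j x)) \<partial>M) \<le> 1 / real (Suc i) + 1 / real (Suc j)" for i j
  proof -
    note Wm = W0_cmult[OF W0_add[OF W[of i] W[of j]], of "1 / 2"] and Wd = W0_cmult[OF W0_diff[OF W[of i] W[of j]], of "1 / 2"]
    have pi: "integrable M (\<lambda>x. potential x ((1 / 2) *\<^sub>R (g i x + g j x)))" "integrable M (\<lambda>x. potential x ((1 / 2) *\<^sub>R (g i x - g j x)))"
      "integrable M (\<lambda>x. potential x (g n x))" for n
      using potential_integrable[OF W0_finite_energy[OF Wm]] potential_integrable[OF W0_finite_energy[OF Wd]]
        potential_integrable[OF fe] by auto
    have "(\<integral>x. potential x ((1 / 2) *\<^sub>R (g i x + g j x)) + potential x ((1 / 2) *\<^sub>R (g i x - g j x)) \<partial>M)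
        \<le> (\<integral>x. (potential x (g i x) + potential x (g j x)) / 2 \<partial>M)"
      using pi potential_midpoint by (intro integral_mono_AE AE_I2) auto
    then have "(\<integral>x. potential x ((1 / 2) *\<^sub>R (g i x + g j x)) \<partial>M) + (\<integral>x. potential x ((1 / 2) *\<^sub>R (g i x - g j x)) \<partial>M)
        \<le> ((\<integral>x. potential x (g i x) \<partial>M) + (\<integral>x. potential x (g j x) \<partial>M)) / 2"
      using pi by simp
    moreover have "m \<le> (\<integral>x. potential x ((1 / 2) *\<^sub>R (g i x + g j x)) \<partial>M) - ((\<integral>x. u i x * f x \<partial>M) + (\<integral>x. u j x * f x \<partial>M)) / 2"
    proof -
      have "(\<integral>x. 1 / 2 * (u i x + u j x) * f x \<partial>M) = ((\<integral>x. u i x * f x \<partial>M) + (\<integral>x. u j x * f x \<partial>M)) / 2"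
        using fu[OF W] by (simp add: distrib_right mult.assoc)
      then show ?thesis using m_le[OF Wm] by (simp add: J_def)
    qed
    ultimately have "(\<integral>x. potential x ((1 / 2) *\<^sub>R (g i x - g j x)) \<partial>M) \<le> (J (u i) (g i) + J (u j) (g j)) / 2 - m"
      unfolding J_def by argo
    also have "\<dots> \<le> (1 / real (Suc i) + 1 / real (Suc j)) / 2" using Jn[of i] Jn[of j] by argo
    also have "\<dots> \<le> 1 / real (Suc i) + 1 / real (Suc j)"
    proof -
      have half: "(a + b) / 2 \<le> a + b" if "0 \<le> a" "0 \<le> b" for a b :: real using that by simp
      show ?thesis by (rule half) auto
    qed
    finally show ?thesis .
  qed
  \<comment> \<open>This constant compares the energy of a difference with the potential of half the difference of the gradients.\<close>
  define K where "K = 8 * (1 + 1 / lam) + 2 powr q * q"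
  have K: "K > 0" using lam_pos q(1) by (simp add: K_def add_pos_pos)
  have dist: "energy_dist (u i) (g i) (u j) (g j) \<le> K * (1 / real (Suc i) + 1 / real (Suc j))" for i j
  proof -
    note Wd = W0_diff[OF W[of i] W[of j]]
    note fd = W0_finite_energy[OF Wd]
    let ?G = "\<integral>x. (norm (g i x - g j x))\<^sup>2 \<partial>M" and ?Q = "\<integral>x. \<mu> x * norm (g i x - g j x) powr q \<partial>M"
    have "(\<lambda>x. potential x ((1 / 2) *\<^sub>R (g i x - g j x)))
        = (\<lambda>x. (norm (g i x - g j x))\<^sup>2 / 8 + \<mu> x * norm (g i x - g j x) powr q / (2 powr q * q))"
      by (simp add: potential_def powr_divide power_divide fun_eq_iff)
    then have P: "(\<integral>x. potential x ((1 / 2) *\<^sub>R (g i x - g j x)) \<partial>M) = ?G / 8 + ?Q / (2 powr q * q)"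
      using grad_sq_int[OF fd] grad_powr_integrable[OF fd] by simp
    have pos: "0 \<le> ?G" "0 \<le> ?Q" using mu(1) by (auto intro!: integral_nonneg_AE AE_I2)
    have "energy (\<lambda>x. u i x - u j x) (\<lambda>x. g i x - g j x)
        = (\<lambda>x. ((u i x - u j x)\<^sup>2 + (norm (g i x - g j x))\<^sup>2) + \<mu> x * norm (g i x - g j x) powr q)"
      by (simp add: energy_def fun_eq_iff)
    then have "energy_dist (u i) (g i) (u j) (g j) = (\<integral>x. (u i x - u j x)\<^sup>2 \<partial>M) + ?G + ?Q"
      using sq_integrable[OF fd] grad_sq_int[OF fd] grad_powr_integrable[OF fd] by simp
    also have "(\<integral>x. (u i x - u j x)\<^sup>2 \<partial>M) \<le> 1 / lam * ?G"
      using W0_poincare[OF Wd] lam_pos by (simp add: field_simps)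
    finally have "energy_dist (u i) (g i) (u j) (g j) \<le> 1 / lam * ?G + ?G + ?Q" by simp
    moreover have "8 * (1 + 1 / lam) * (?G / 8) + (2 powr q * q) * (?Q / (2 powr q * q)) = 1 / lam * ?G + ?G + ?Q"
    proof -
      have "8 * (1 + y) * (a / 8) = y * a + a" for y a :: real by (simp add: field_simps)
      moreover have "(2 powr q * q) * (?Q / (2 powr q * q)) = ?Q" using q(1) by simp
      ultimately show ?thesis by presburger
    qed
    ultimately have "energy_dist (u i) (g i) (u j) (g j)
        \<le> 8 * (1 + 1 / lam) * (?G / 8) + (2 powr q * q) * (?Q / (2 powr q * q))" by presburger
    also have "\<dots> \<le> K * (?G / 8) + K * (?Q / (2 powr q * q))"
      using pos q(1) lam_pos by (intro add_mono mult_right_mono) (auto simp: K_def)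
    also have "\<dots> = K * (\<integral>x. potential x ((1 / 2) *\<^sub>R (g i x - g j x)) \<partial>M)" unfolding P by (simp add: distrib_left)
    also have "\<dots> \<le> K * (1 / real (Suc i) + 1 / real (Suc j))" using K mid by (intro mult_left_mono) auto
    finally show ?thesis .
  qed
  have cauchy: "\<exists>N. \<forall>i\<ge>N. \<forall>j\<ge>N. energy_dist (u i) (g i) (u j) (g j) < \<epsilon>" if \<epsilon>: "\<epsilon> > 0" for \<epsilon>
  proof -
    obtain N where N: "1 / real (Suc N) < \<epsilon> / (2 * K)" using nat_approx_posE[of "\<epsilon> / (2 * K)"] \<epsilon> K by auto
    have small: "1 / real (Suc k) < \<epsilon> / (2 * K)" if "k \<ge> N" for k
      using that by (intro le_less_trans[OF divide_left_mono N]) auto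
    have "energy_dist (u i) (g i) (u j) (g j) < \<epsilon>" if "i \<ge> N" "j \<ge> N" for i j
    proof -
      have "K * (1 / real (Suc i) + 1 / real (Suc j)) < K * (\<epsilon> / (2 * K) + \<epsilon> / (2 * K))"
        using small[OF that(1)] small[OF that(2)] K by (intro mult_strict_left_mono) auto
      also have "\<dots> = \<epsilon>" using K by simp
      finally show ?thesis using dist[of i j] by simp
    qed
    then show ?thesis by blast
  qed
  obtain u' g' and s :: "nat \<Rightarrow> nat" where W': "W0 u' g'" and s: "strict_mono s"
    and "AE x in M. (\<lambda>i. u (s i) x) \<longlonglongrightarrow> u' x" and ae: "AE x in M. (\<lambda>i. g (s i) x) \<longlonglongrightarrow> g' x"
    and lim: "(\<lambda>n. energy_dist (u n) (g n) u' g') \<longlonglongrightarrow> 0"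
    by (rule W0_complete[of u g, OF W cauchy])
  note fe' = W0_finite_energy[OF W']
  note [measurable] = finite_energyD(1,2)[OF fe']
  have Jmin: "(\<integral>x. potential x (g' x) \<partial>M) \<le> m + (\<integral>x. u' x * f x \<partial>M)"
  proof (rule field_le_epsilon)
    fix e :: real assume e: "e > 0"
    have "(\<lambda>n. m + 1 / real (Suc n) + (\<integral>x. u n x * f x \<partial>M)) \<longlonglongrightarrow> m + 0 + (\<integral>x. u' x * f x \<partial>M)"
      by (intro tendsto_add tendsto_const lim0 energy_convergenceD(3)[OF fe fe' lim] f f2)
    then have "\<forall>\<^sub>F n in sequentially. m + 1 / real (Suc n) + (\<integral>x. u n x * f x \<partial>M) < m + (\<integral>x. u' x * f x \<partial>M) + e"
      using e by (intro order_tendstoD) auto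
    then obtain N where N: "\<And>n. n \<ge> N \<Longrightarrow> m + 1 / real (Suc n) + (\<integral>x. u n x * f x \<partial>M) < m + (\<integral>x. u' x * f x \<partial>M) + e"
      by (auto simp: eventually_sequentially)
    have a: "integrable M (\<lambda>x. potential x (g (s i) x))" for i by (rule potential_integrable[OF fe])
    have b: "AE x in M. 0 \<le> potential x (g (s i) x)" for i using potential_nonneg by (intro AE_I2) auto
    have c: "(\<lambda>x. potential x (g' x)) \<in> borel_measurable M" using potential_integrable[OF fe'] by auto
    have d: "AE x in M. (\<lambda>i. potential x (g (s i) x)) \<longlonglongrightarrow> potential x (g' x)"
      using ae
    proof eventually_elim
      case (elim x)
      have pw: "(\<lambda>i. norm (g (s i) x) powr q) \<longlonglongrightarrow> norm (g' x) powr q"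
        using q(1) by (intro tendsto_powr2 tendsto_norm elim tendsto_const) auto
      show ?case unfolding potential_def
        using q(1) by (intro tendsto_add tendsto_divide tendsto_mult tendsto_power tendsto_norm tendsto_const elim pw) auto
    qed
    have "(\<integral>x. potential x (g (s i) x) \<partial>M) \<le> m + (\<integral>x. u' x * f x \<partial>M) + e" if "i \<ge> N" for i
      using N[of "s i"] that seq_suble[OF s, of i] Jn[of "s i"] by (simp add: J_def)
    from Fatou_integral(2)[OF a b c d this]
    show "(\<integral>x. potential x (g' x) \<partial>M) \<le> m + (\<integral>x. u' x * f x \<partial>M) + e" .
  qed
  \<comment> \<open>The gradient inequality replaces the differentiation of the functional under the integral sign.\<close>
  have half_eq: "(\<integral>x. v x * f x \<partial>M) \<le> (\<integral>x. flux x (g' x) \<bullet> h x \<partial>M)" if V: "W0 v h" for v h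
  proof -
    note fv = W0_finite_energy[OF V]
    note [measurable] = finite_energyD(1,2)[OF fv]
    have step: "(\<integral>x. v x * f x \<partial>M) \<le> (\<integral>x. flux x (g' x + t *\<^sub>R h x) \<bullet> h x \<partial>M)" if t: "t > 0" for t
    proof -
      note Wt = W0_add[OF W' W0_cmult[OF V, of t]]
      note ft = W0_finite_energy[OF Wt]
      have "m \<le> J (\<lambda>x. u' x + t * v x) (\<lambda>x. g' x + t *\<^sub>R h x)" by (rule m_le[OF Wt])
      also have "\<dots> = (\<integral>x. potential x (g' x + t *\<^sub>R h x) \<partial>M) - (\<integral>x. u' x * f x \<partial>M) - t * (\<integral>x. v x * f x \<partial>M)"
        using fu[OF W'] fu[OF V] by (simp add: J_def distrib_right mult.assoc)
      also have "(\<integral>x. potential x (g' x + t *\<^sub>R h x) \<partial>M) \<le> (\<integral>x. potential x (g' x) + t * (flux x (g' x + t *\<^sub>R h x) \<bullet> h x) \<partial>M)"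
      proof (intro integral_mono_AE AE_I2)
        show "integrable M (\<lambda>x. potential x (g' x + t *\<^sub>R h x))" by (rule potential_integrable[OF ft])
        show "integrable M (\<lambda>x. potential x (g' x) + t * (flux x (g' x + t *\<^sub>R h x) \<bullet> h x))"
          by (intro Bochner_Integration.integrable_add potential_integrable[OF fe'] integrable_mult_right flux_integrable[OF ft fv])
        fix x assume "x \<in> space M"
        then show "potential x (g' x + t *\<^sub>R h x) \<le> potential x (g' x) + t * (flux x (g' x + t *\<^sub>R h x) \<bullet> h x)"
          using potential_gradient_ineq[of x "g' x + t *\<^sub>R h x" "g' x"] by simp
      qed
      also have "\<dots> = (\<integral>x. potential x (g' x) \<partial>M) + t * (\<integral>x. flux x (g' x + t *\<^sub>R h x) \<bullet> h x \<partial>M)"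
        using potential_integrable[OF fe'] flux_integrable[OF ft fv] by simp
      finally have "t * (\<integral>x. v x * f x \<partial>M) \<le> t * (\<integral>x. flux x (g' x + t *\<^sub>R h x) \<bullet> h x \<partial>M)" using Jmin by linarith
      then show ?thesis using t by simp
    qed
    have "(\<lambda>n. \<integral>x. flux x (g' x + (1 / real (Suc n)) *\<^sub>R h x) \<bullet> h x \<partial>M) \<longlonglongrightarrow> (\<integral>x. flux x (g' x) \<bullet> h x \<partial>M)"
    proof (rule integral_dominated_convergence[OF _ _ flux_dominating[OF fe' fv]])
      show "AE x in M. (\<lambda>n. flux x (g' x + (1 / real (Suc n)) *\<^sub>R h x) \<bullet> h x) \<longlonglongrightarrow> flux x (g' x) \<bullet> h x"
        by (intro AE_I2 tendsto_inner tendsto_flux lim0 tendsto_const)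
      show "AE x in M. norm (flux x (g' x + (1 / real (Suc n)) *\<^sub>R h x) \<bullet> h x)
          \<le> (norm (g' x) + norm (h x) + norm (h x))\<^sup>2 + \<mu> x * (norm (g' x) + norm (h x) + norm (h x)) powr q" for n
        using flux_inner_bound[of _ "1 / real (Suc n)" g' h] by (intro AE_I2) auto
    qed measurable
    then show ?thesis by (rule LIMSEQ_le_const) (auto intro!: step)
  qed
  have "(\<integral>x. flux x (g' x) \<bullet> h x \<partial>M) = (\<integral>x. f x * v x \<partial>M)" if V: "W0 v h" for v h
    using half_eq[OF V] half_eq[OF W0_cmult[OF V, of "-1"]] by (simp add: mult.commute)
  then show ?thesis using W' by blast
qed

end

section \<open>Linear convection: existence and uniqueness\<close>

lemma borel_measurable_lebesgue_on_AE:
  fixes f g :: "'a::euclidean_space \<Rightarrow> 'b::euclidean_space"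
  assumes S: "S \<in> sets lebesgue" and f: "f \<in> borel_measurable (lebesgue_on S)" and ae: "AE x in lebesgue_on S. f x = g x"
  shows "g \<in> borel_measurable (lebesgue_on S)"
proof -
  have "(\<lambda>x. if x \<in> S then f x else 0) \<in> borel_measurable lebesgue" by (rule borel_measurable_if_I[OF f S])
  moreover have "AE x in lebesgue. (if x \<in> S then f x else 0) = (if x \<in> S then g x else 0)"
    using ae S by (simp add: AE_restrict_space_iff)
  ultimately have "(\<lambda>x. if x \<in> S then g x else 0) \<in> borel_measurable lebesgue" by (rule borel_measurable_AE)
  then show ?thesis by (rule borel_measurable_if_D)
qed

locale convection_domain = phase_domain \<Omega> q B \<mu> for \<Omega> :: "(real^'n::finite) set" and q B \<mu> +
  fixes c :: "real^'n \<Rightarrow> real^'n" and \<rho> :: "real^'n \<Rightarrow> real" and c2 :: real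
  assumes c_measurable [measurable]: "c \<in> borel_measurable (lebesgue_on \<Omega>)"
    and c_bound: "AE x in lebesgue_on \<Omega>. norm (c x) \<le> c2" and c2: "0 \<le> c2" "c2\<^sup>2 < rayleigh_inf \<Omega>"
    and rho_measurable [measurable]: "\<rho> \<in> borel_measurable (lebesgue_on \<Omega>)"
    and rho: "integrable (lebesgue_on \<Omega>) (\<lambda>x. (\<rho> x)\<^sup>2)"
begin

definition rhs :: "(real^'n \<Rightarrow> real^'n) \<Rightarrow> real^'n \<Rightarrow> real" where
  "rhs g x = \<rho> x + c x \<bullet> g x"

text \<open>The equation whose convection term is frozen at the vector field \<open>k\<close>; a fixed point \<open>k = g\<close> solves the original
  problem.\<close>

definition solves :: "(real^'n \<Rightarrow> real^'n) \<Rightarrow> (real^'n \<Rightarrow> real) \<Rightarrow> (real^'n \<Rightarrow> real^'n) \<Rightarrow> bool" where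
  "solves k u g \<longleftrightarrow> W0 u g \<and> (\<forall>v h. W0 v h \<longrightarrow> (\<integral>x. flux x (g x) \<bullet> h x \<partial>M) = (\<integral>x. rhs k x * v x \<partial>M))"

abbreviation L2 :: "(real^'n \<Rightarrow> real^'n) \<Rightarrow> bool" where
  "L2 g \<equiv> g \<in> borel_measurable M \<and> integrable M (\<lambda>x. (norm (g x))\<^sup>2)"

abbreviation grad_dist :: "(real^'n \<Rightarrow> real^'n) \<Rightarrow> (real^'n \<Rightarrow> real^'n) \<Rightarrow> real" where
  "grad_dist g h \<equiv> (\<integral>x. (norm (g x - h x))\<^sup>2 \<partial>M)"

lemma W0_L2: "W0 u g \<Longrightarrow> L2 g"
  by (auto dest: W0_finite_energy finite_energyD intro: grad_sq_int)

lemma convection_sq: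
  assumes "L2 g"
  shows "integrable M (\<lambda>x. (c x \<bullet> g x)\<^sup>2)" "(\<integral>x. (c x \<bullet> g x)\<^sup>2 \<partial>M) \<le> c2\<^sup>2 * (\<integral>x. (norm (g x))\<^sup>2 \<partial>M)"
proof -
  have [measurable]: "g \<in> borel_measurable M" and i: "integrable M (\<lambda>x. c2\<^sup>2 * (norm (g x))\<^sup>2)" using assms by auto
  have ae: "AE x in M. (c x \<bullet> g x)\<^sup>2 \<le> c2\<^sup>2 * (norm (g x))\<^sup>2"
    using c_bound
  proof eventually_elim
    case (elim x)
    have "\<bar>c x \<bullet> g x\<bar> \<le> norm (c x) * norm (g x)" by (rule Cauchy_Schwarz_ineq2)
    also have "\<dots> \<le> c2 * norm (g x)" using elim by (intro mult_right_mono) auto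
    finally have "\<bar>c x \<bullet> g x\<bar>\<^sup>2 \<le> (c2 * norm (g x))\<^sup>2" by (intro power_mono) auto
    then show ?case by (simp add: power_mult_distrib)
  qed
  show int: "integrable M (\<lambda>x. (c x \<bullet> g x)\<^sup>2)"
    by (rule Bochner_Integration.integrable_bound[OF i]) (use ae in auto)
  have "(\<integral>x. (c x \<bullet> g x)\<^sup>2 \<partial>M) \<le> (\<integral>x. c2\<^sup>2 * (norm (g x))\<^sup>2 \<partial>M)" by (rule integral_mono_AE[OF int i ae])
  then show "(\<integral>x. (c x \<bullet> g x)\<^sup>2 \<partial>M) \<le> c2\<^sup>2 * (\<integral>x. (norm (g x))\<^sup>2 \<partial>M)" by simp
qed

lemma rhs_L2:
  assumes "L2 g"
  shows "rhs g \<in> borel_measurable M" "integrable M (\<lambda>x. (rhs g x)\<^sup>2)"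
proof -
  have [measurable]: "g \<in> borel_measurable M" using assms by auto
  show "rhs g \<in> borel_measurable M" unfolding rhs_def by measurable
  have "integrable M (\<lambda>x. (norm (\<rho> x + c x \<bullet> g x))\<^sup>2)"
    using rho convection_sq(1)[OF assms] by (intro integral_norm_sq_add(1)) auto
  then show "integrable M (\<lambda>x. (rhs g x)\<^sup>2)" by (simp add: rhs_def)
qed

lemma rhs_mult_integrable:
  assumes "L2 g" "W0 v h"
  shows "integrable M (\<lambda>x. rhs g x * v x)"
  using rhs_L2[OF assms(1)] finite_energyD(1)[OF W0_finite_energy[OF assms(2)]] sq_integrable[OF W0_finite_energy[OF assms(2)]]
  by (intro Cauchy_Schwarz_integral(1)) auto

lemma ex_solves: "L2 k \<Longrightarrow> \<exists>u g. solves k u g"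
  unfolding solves_def using ex_solution[OF rhs_L2] by blast

text \<open>Testing the difference of two equations with the difference of the solutions: the flux is strongly monotone
  and Poincare's inequality controls the convection term.\<close>

lemma solves_contraction:
  assumes k1: "L2 k1" and k2: "L2 k2" and s1: "solves k1 u1 g1" and s2: "solves k2 u2 g2"
  shows "grad_dist g1 g2 \<le> c2\<^sup>2 / lam * grad_dist k1 k2"
proof -
  have W: "W0 u1 g1" "W0 u2 g2" using s1 s2 by (auto simp: solves_def)
  note Wd = W0_diff[OF W]
  note fe = W0_finite_energy[OF W(1)] W0_finite_energy[OF W(2)] W0_finite_energy[OF Wd]
  note [measurable] = finite_energyD(1,2)[OF fe(1)] finite_energyD(1,2)[OF fe(2)]
  have [measurable]: "k1 \<in> borel_measurable M" "k2 \<in> borel_measurable M" using k1 k2 by auto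
  have k12: "L2 (\<lambda>x. k1 x - k2 x)" using integral_norm_sq_diff(1)[of k1 M k2] k1 k2 by auto
  let ?X = "grad_dist g1 g2" and ?Y = "grad_dist k1 k2" and ?U = "\<integral>x. (u1 x - u2 x)\<^sup>2 \<partial>M"
  let ?I = "\<integral>x. (c x \<bullet> (k1 x - k2 x)) * (u1 x - u2 x) \<partial>M"
  have eq1: "(\<integral>x. flux x (g1 x) \<bullet> (g1 x - g2 x) \<partial>M) = (\<integral>x. rhs k1 x * (u1 x - u2 x) \<partial>M)"
    using s1 Wd unfolding solves_def by blast
  have eq2: "(\<integral>x. flux x (g2 x) \<bullet> (g1 x - g2 x) \<partial>M) = (\<integral>x. rhs k2 x * (u1 x - u2 x) \<partial>M)"
    using s2 Wd unfolding solves_def by blast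
  note i1 = flux_integrable[OF fe(1,3)] and i2 = flux_integrable[OF fe(2,3)]
  note r1 = rhs_mult_integrable[OF k1 Wd] and r2 = rhs_mult_integrable[OF k2 Wd]
  have "?X \<le> (\<integral>x. flux x (g1 x) \<bullet> (g1 x - g2 x) - flux x (g2 x) \<bullet> (g1 x - g2 x) \<partial>M)"
  proof (intro integral_mono_AE AE_I2)
    fix x assume "x \<in> space M"
    then show "(norm (g1 x - g2 x))\<^sup>2 \<le> flux x (g1 x) \<bullet> (g1 x - g2 x) - flux x (g2 x) \<bullet> (g1 x - g2 x)"
      using flux_strongly_monotone[of x "g1 x" "g2 x"] by (simp add: inner_diff_left)
  qed (use i1 i2 grad_sq_int[OF fe(3)] in auto)
  also have "\<dots> = (\<integral>x. rhs k1 x * (u1 x - u2 x) \<partial>M) - (\<integral>x. rhs k2 x * (u1 x - u2 x) \<partial>M)"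
    unfolding eq1[symmetric] eq2[symmetric] by (rule Bochner_Integration.integral_diff[OF i1 i2])
  also have "\<dots> = (\<integral>x. rhs k1 x * (u1 x - u2 x) - rhs k2 x * (u1 x - u2 x) \<partial>M)"
    by (rule Bochner_Integration.integral_diff[OF r1 r2, symmetric])
  also have "(\<lambda>x. rhs k1 x * (u1 x - u2 x) - rhs k2 x * (u1 x - u2 x)) = (\<lambda>x. (c x \<bullet> (k1 x - k2 x)) * (u1 x - u2 x))"
    by (auto simp: rhs_def algebra_simps inner_diff_right)
  finally have XI: "?X \<le> ?I" .
  have X0: "0 \<le> ?X" and Y0: "0 \<le> ?Y" by auto
  have "?I\<^sup>2 \<le> (\<integral>x. (c x \<bullet> (k1 x - k2 x))\<^sup>2 \<partial>M) * ?U"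
    using convection_sq(1)[OF k12] sq_integrable[OF fe(3)] by (intro Cauchy_Schwarz_integral(2)) auto
  also have "\<dots> \<le> (c2\<^sup>2 * ?Y) * (?X / lam)"
  proof (rule mult_mono)
    show "(\<integral>x. (c x \<bullet> (k1 x - k2 x))\<^sup>2 \<partial>M) \<le> c2\<^sup>2 * ?Y" by (rule convection_sq(2)[OF k12])
    show "?U \<le> ?X / lam" using W0_poincare[OF Wd] lam_pos by (simp add: field_simps)
  qed auto
  finally have "?X\<^sup>2 \<le> (c2\<^sup>2 / lam * ?Y) * ?X" using power_mono[OF XI X0, of 2] by simp
  then have XX: "?X * ?X \<le> (c2\<^sup>2 / lam * ?Y) * ?X" by (simp only: power2_eq_square)
  have cancel: "a \<le> b" if "a * a \<le> b * a" "0 \<le> a" "0 \<le> b" for a b :: real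
    using that by (cases "a = 0") (auto simp: mult_le_cancel_right)
  have "0 \<le> c2\<^sup>2 / lam * ?Y" using lam_pos Y0 by (intro mult_nonneg_nonneg) auto
  then show ?thesis by (rule cancel[OF XX X0])
qed

lemma grad_dist_eq_0D:
  assumes "L2 g" "L2 h" "grad_dist g h \<le> 0"
  shows "AE x in M. g x = h x"
proof -
  have i: "integrable M (\<lambda>x. (norm (g x - h x))\<^sup>2)" using integral_norm_sq_diff(1)[of g M h] assms by auto
  have "0 \<le> grad_dist g h" by simp
  then have "grad_dist g h = 0" using assms(3) by linarith
  then have "AE x in M. (norm (g x - h x))\<^sup>2 = 0"
    by (subst (asm) integral_nonneg_eq_0_iff_AE[OF i]) auto
  then show ?thesis by eventually_elim simp
qed

lemma contraction_factor: "0 \<le> c2\<^sup>2 / lam" "c2\<^sup>2 / lam < 1"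
  using c2 lam_pos by auto

lemma solves_unique:
  assumes s1: "solves g1 u1 g1" and s2: "solves g2 u2 g2"
  shows "AE x in M. u1 x = u2 x"
proof -
  have W: "W0 u1 g1" "W0 u2 g2" using s1 s2 by (auto simp: solves_def)
  note L = W0_L2[OF W(1)] W0_L2[OF W(2)]
  have "grad_dist g1 g2 \<le> c2\<^sup>2 / lam * grad_dist g1 g2" by (rule solves_contraction[OF L s1 s2])
  then have "(1 - c2\<^sup>2 / lam) * grad_dist g1 g2 \<le> 0" by (simp add: algebra_simps)
  then have "grad_dist g1 g2 \<le> 0" using contraction_factor(2) by (simp add: mult_le_0_iff)
  then have "lam * (\<integral>x. (u1 x - u2 x)\<^sup>2 \<partial>M) \<le> 0" using W0_poincare[OF W0_diff[OF W]] by linarith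
  then have "(\<integral>x. (u1 x - u2 x)\<^sup>2 \<partial>M) \<le> 0" using lam_pos by (simp add: mult_le_0_iff)
  moreover have "0 \<le> (\<integral>x. (u1 x - u2 x)\<^sup>2 \<partial>M)" by simp
  ultimately have "(\<integral>x. (u1 x - u2 x)\<^sup>2 \<partial>M) = 0" by linarith
  then have "AE x in M. (u1 x - u2 x)\<^sup>2 = 0"
    by (subst (asm) integral_nonneg_eq_0_iff_AE[OF sq_integrable[OF W0_finite_energy[OF W0_diff[OF W]]]]) auto
  then show ?thesis by eventually_elim simp
qed

lemma solves_cong_AE:
  assumes s: "solves k u g" and ae: "AE x in M. k x = k' x" and "L2 k" "L2 k'"
  shows "solves k' u g"
proof -
  have "(\<integral>x. rhs k' x * v x \<partial>M) = (\<integral>x. rhs k x * v x \<partial>M)" if "W0 v h" for v h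
    using ae rhs_mult_integrable[OF assms(3) that] rhs_mult_integrable[OF assms(4) that]
    by (intro integral_cong_AE) (auto simp: rhs_def)
  then show ?thesis using s by (auto simp: solves_def)
qed

sublocale L: laplace_domain \<Omega> q
  by unfold_locales (use open_Omega bounded_Omega nonempty_Omega q in auto)

lemma W0_imp_laplace:
  assumes W: "W0 u g"
  shows "L.W0 u g"
proof -
  have fe: "L.finite_energy u g" if "finite_energy u g" for u g
    using sq_integrable[OF that] grad_sq_int[OF that] that
    by (auto simp: L.finite_energy_def L.energy_laplace finite_energy_def)
  have le: "L.total_energy u g \<le> total_energy u g" if f: "finite_energy u g" for u g
    using L.finite_energyD(3)[OF fe[OF f]] finite_energyD(3)[OF f] mu(1)
    by (intro integral_mono_AE AE_I2) (auto simp: L.energy_def energy_def)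
  show ?thesis
    unfolding L.W0_def
  proof (intro conjI allI impI)
    show "L.finite_energy u g" by (rule fe[OF W0_finite_energy[OF W]])
    fix \<epsilon> :: real assume "\<epsilon> > 0"
    then obtain \<phi> where \<phi>: "\<phi> \<in> test_functions \<Omega>" "energy_dist u g \<phi> (grad \<phi>) < \<epsilon>"
      using W0_approx[OF W] by blast
    then show "\<exists>\<phi>\<in>test_functions \<Omega>. L.energy_dist u g \<phi> (grad \<phi>) < \<epsilon>"
      using le[OF finite_energy_diff[OF W0_finite_energy[OF W] finite_energy_test[OF \<phi>(1)]]]
      by (intro bexI[of _ \<phi>]) auto
  qed
qed

text \<open>Banach's fixed point theorem for the map sending a gradient to the gradient of the solution with frozen
  convection.  The iterates converge in the space with unweighted energy; solving once more with the limit
  on the right-hand side yields a solution in the weighted space.\<close>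

theorem ex_fixed_point: "\<exists>u g. solves g u g"
proof -
  define T where "T k = (SOME p. solves k (fst p) (snd p))" for k
  have T: "solves k (fst (T k)) (snd (T k))" if k: "L2 k" for k
  proof -
    obtain u g where "solves k (fst (u, g)) (snd (u, g))" using ex_solves[OF k] by auto
    then show ?thesis unfolding T_def by (rule someI[where P = "\<lambda>p. solves k (fst p) (snd p)"])
  qed
  define p where "p = rec_nat ((\<lambda>x. 0), grad (\<lambda>x. 0)) (\<lambda>_ p. T (snd p))"
  define u where "u n = fst (p n)" for n
  define g where "g n = snd (p n)" for n
  have W: "W0 (u n) (g n)" for n
  proof (induction n)
    case 0
    show ?case using W0_test[OF test_function_zero] by (simp add: u_def g_def p_def)
  next
    case (Suc n)
    have "solves (g n) (u (Suc n)) (g (Suc n))" using T[OF W0_L2[OF Suc]] by (simp add: u_def g_def p_def)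
    then show ?case by (simp add: solves_def)
  qed
  have sol: "solves (g n) (u (Suc n)) (g (Suc n))" for n
    using T[OF W0_L2[OF W[of n]]] by (simp add: u_def g_def p_def)
  note L = W0_L2[OF W]
  define d where "d i j = sqrt (grad_dist (g i) (g j))" for i j
  define \<theta> where "\<theta> = sqrt (c2\<^sup>2 / lam)"
  have \<theta>: "0 \<le> \<theta>" "\<theta> < 1" using contraction_factor by (auto simp: \<theta>_def)
  have d0: "0 \<le> d i j" for i j by (simp add: d_def)
  have d_sym: "d i j = d j i" for i j by (simp add: d_def norm_minus_commute)
  have contr: "d (Suc i) (Suc j) \<le> \<theta> * d i j" for i j
    unfolding d_def \<theta>_def real_sqrt_mult[symmetric]
    by (intro real_sqrt_le_mono solves_contraction[OF L L sol sol])
  have tri: "d i k \<le> d i j + d j k" for i j k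
  proof -
    have [measurable]: "g n \<in> borel_measurable M" for n using L by blast
    have ij: "L2 (\<lambda>x. g i x - g j x)" for i j using integral_norm_sq_diff(1)[of "g i" M "g j"] L by auto
    show ?thesis
      unfolding d_def using sqrt_integral_norm_sq_add_le[of "\<lambda>x. g i x - g j x" M "\<lambda>x. g j x - g k x"] ij by auto
  qed
  \<comment> \<open>The sum of the geometric series bounds the distance of every iterate from the first one.\<close>
  define C where "C = d 0 1 / (1 - \<theta>)"
  have C0: "C \<ge> 0" using \<theta> d0 by (simp add: C_def)
  have bound0: "d 0 k \<le> C" for k
  proof (induction k)
    case 0
    then show ?case using C0 by (simp add: d_def)
  next
    case (Suc k)
    have "d 0 (Suc k) \<le> d 0 1 + d (Suc 0) (Suc k)" using tri[of 0 "Suc k" 1] by simp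
    also have "\<dots> \<le> d 0 1 + \<theta> * C"
      using contr[of 0 k] mult_left_mono[OF Suc \<theta>(1)] by linarith
    also have "\<dots> = C"
    proof -
      have "(1 - \<theta>) * C = d 0 1" using \<theta>(2) by (simp add: C_def)
      then show ?thesis by (simp add: algebra_simps)
    qed
    finally show ?case .
  qed
  have geo: "d n (n + k) \<le> \<theta> ^ n * C" for n k
  proof (induction n)
    case 0
    then show ?case using bound0 by simp
  next
    case (Suc n)
    have "d (Suc n) (Suc n + k) \<le> \<theta> * d n (n + k)" using contr[of n "n + k"] by simp
    also have "\<dots> \<le> \<theta> * (\<theta> ^ n * C)" by (rule mult_left_mono[OF Suc \<theta>(1)])
    finally show ?case by simp
  qed
  have dN: "d i j \<le> \<theta> ^ N * C" if "i \<ge> N" "j \<ge> N" for i j N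
  proof -
    have *: "d i j \<le> \<theta> ^ N * C" if "N \<le> i" "i \<le> j" for i j
    proof -
      have "d i j \<le> \<theta> ^ i * C" using geo[of i "j - i"] that by simp
      also have "\<dots> \<le> \<theta> ^ N * C" using that \<theta> C0 by (intro mult_right_mono power_decreasing) auto
      finally show ?thesis .
    qed
    show ?thesis using *[of i j] *[of j i] that d_sym[of i j] by (cases "i \<le> j") auto
  qed
  have LW: "L.W0 (u n) (g n)" for n by (rule W0_imp_laplace[OF W])
  have cauchy: "\<exists>N. \<forall>i\<ge>N. \<forall>j\<ge>N. L.energy_dist (u i) (g i) (u j) (g j) < \<epsilon>" if \<epsilon>: "\<epsilon> > 0" for \<epsilon>
  proof -
    define K where "K = 1 + 1 / lam"
    have K: "K > 0" using lam_pos by (simp add: K_def add_pos_pos)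
    have "(\<lambda>N. K * (\<theta> ^ N * C)\<^sup>2) \<longlonglongrightarrow> K * (0 * C)\<^sup>2"
      using \<theta> by (intro tendsto_mult tendsto_power tendsto_const LIMSEQ_power_zero) auto
    then have "\<forall>\<^sub>F N in sequentially. K * (\<theta> ^ N * C)\<^sup>2 < \<epsilon>" using \<epsilon> by (intro order_tendstoD) auto
    then obtain N where N: "K * (\<theta> ^ N * C)\<^sup>2 < \<epsilon>" by (auto simp: eventually_sequentially)
    have "L.energy_dist (u i) (g i) (u j) (g j) < \<epsilon>" if "i \<ge> N" "j \<ge> N" for i j
    proof -
      note Wd = W0_diff[OF W[of i] W[of j]]
      have "(\<integral>x. (u i x - u j x)\<^sup>2 \<partial>M) \<le> 1 / lam * grad_dist (g i) (g j)"
        using W0_poincare[OF Wd] lam_pos by (simp add: field_simps)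
      then have "L.energy_dist (u i) (g i) (u j) (g j) \<le> K * grad_dist (g i) (g j)"
        unfolding L.total_energy_laplace[OF L.W0_finite_energy[OF W0_imp_laplace[OF Wd]]] by (simp add: K_def distrib_right)
      also have "grad_dist (g i) (g j) = (d i j)\<^sup>2" by (simp add: d_def)
      also have "K * (d i j)\<^sup>2 \<le> K * (\<theta> ^ N * C)\<^sup>2" using K d0 dN[OF that] by (intro mult_left_mono power_mono) auto
      finally show ?thesis using N by simp
    qed
    then show ?thesis by blast
  qed
  obtain u' g' and s :: "nat \<Rightarrow> nat" where W': "L.W0 u' g'" and "strict_mono s"
    "AE x in M. (\<lambda>i. u (s i) x) \<longlonglongrightarrow> u' x" "AE x in M. (\<lambda>i. g (s i) x) \<longlonglongrightarrow> g' x"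
    and lim: "(\<lambda>n. L.energy_dist (u n) (g n) u' g') \<longlonglongrightarrow> 0"
    by (rule L.W0_complete[of u g, OF LW cauchy])
  have L': "L2 g'"
    using L.finite_energyD(2)[OF L.W0_finite_energy[OF W']] L.grad_sq_int[OF L.W0_finite_energy[OF W']] by auto
  have glim: "(\<lambda>n. grad_dist (g n) g') \<longlonglongrightarrow> 0"
    by (rule L.total_energy_tendsto_0D(2)[OF L.finite_energy_diff[OF L.W0_finite_energy[OF LW] L.W0_finite_energy[OF W']] lim])
  obtain u2 g2 where s2: "solves g' u2 g2" using ex_solves[OF L'] by blast
  then have W2: "W0 u2 g2" by (simp add: solves_def)
  note L2' = W0_L2[OF W2]
  have le: "grad_dist g2 g' \<le> 2 * (c2\<^sup>2 / lam * grad_dist (g n) g') + 2 * grad_dist (g (Suc n)) g'" for n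
  proof -
    have [measurable]: "g2 \<in> borel_measurable M" "g' \<in> borel_measurable M" "g n \<in> borel_measurable M" for n
      using L2' L' L by auto
    have i: "integrable M (\<lambda>x. (norm (g (Suc n) x - g2 x))\<^sup>2)" "integrable M (\<lambda>x. (norm (g (Suc n) x - g' x))\<^sup>2)"
      "integrable M (\<lambda>x. (norm (g2 x - g' x))\<^sup>2)"
      using integral_norm_sq_diff(1)[of "g (Suc n)" M g2] integral_norm_sq_diff(1)[of "g (Suc n)" M g']
        integral_norm_sq_diff(1)[of g2 M g'] L L' L2' by auto
    have pt: "(norm (g2 x - g' x))\<^sup>2 \<le> 2 * (norm (g (Suc n) x - g2 x))\<^sup>2 + 2 * (norm (g (Suc n) x - g' x))\<^sup>2" for x
      using norm_sq_add_le[of 1 "g2 x - g (Suc n) x" "g (Suc n) x - g' x"] by (simp add: norm_minus_commute)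
    have "grad_dist g2 g' \<le> (\<integral>x. 2 * (norm (g (Suc n) x - g2 x))\<^sup>2 + 2 * (norm (g (Suc n) x - g' x))\<^sup>2 \<partial>M)"
      using i pt by (intro integral_mono) auto
    also have "\<dots> = 2 * grad_dist (g (Suc n)) g2 + 2 * grad_dist (g (Suc n)) g'" using i by simp
    also have "grad_dist (g (Suc n)) g2 \<le> c2\<^sup>2 / lam * grad_dist (g n) g'"
      by (rule solves_contraction[OF L L' sol s2])
    finally show ?thesis by simp
  qed
  have "(\<lambda>n. 2 * (c2\<^sup>2 / lam * grad_dist (g n) g') + 2 * grad_dist (g (Suc n)) g') \<longlonglongrightarrow> 2 * (c2\<^sup>2 / lam * 0) + 2 * 0"
    by (intro tendsto_add tendsto_mult tendsto_const glim LIMSEQ_Suc[OF glim])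
  then have "grad_dist g2 g' \<le> 2 * (c2\<^sup>2 / lam * 0) + 2 * 0"
    by (rule LIMSEQ_le_const) (use le in auto)
  then have ae: "AE x in M. g' x = g2 x" using grad_dist_eq_0D[OF L2' L'] by (auto elim!: eventually_mono)
  show ?thesis using solves_cong_AE[OF s2 ae L' L2'] by blast
qed

text \<open>Almost everywhere equal gradients give equal integrals, so \<^const>\<open>weak_grad\<close> and the gradient of a pair in
  \<open>W0\<close> are interchangeable; the integrability that the weak formulation demands holds for all pairs of finite
  energy.\<close>

lemma weak_solution_iff:
  assumes f: "AE x in M. \<forall>s \<xi>. f x s \<xi> = \<rho> x + c x \<bullet> \<xi>"
  shows "weak_solution 2 q \<mu> \<Omega> f u \<longleftrightarrow> solves (weak_grad \<Omega> u) u (weak_grad \<Omega> u)"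
proof -
  let ?g = "weak_grad \<Omega> u"
  have rhs_eq: "integrable M (\<lambda>x. f x (u x) (?g x) * v x)"
    "(\<integral>x. f x (u x) (?g x) * v x \<partial>M) = (\<integral>x. rhs ?g x * v x \<partial>M)" if W: "W0 u ?g" and V: "W0 v h" for v h
  proof -
    note i = rhs_mult_integrable[OF W0_L2[OF W] V]
    have ae: "AE x in M. rhs ?g x * v x = f x (u x) (?g x) * v x"
      using f by eventually_elim (simp add: rhs_def)
    have m: "(\<lambda>x. f x (u x) (?g x) * v x) \<in> borel_measurable M"
      by (rule borel_measurable_lebesgue_on_AE[OF Omega_lebesgue _ ae]) (use i in auto)
    show "integrable M (\<lambda>x. f x (u x) (?g x) * v x)" by (rule integrable_cong_AE_imp[OF i m ae])
    show "(\<integral>x. f x (u x) (?g x) * v x \<partial>M) = (\<integral>x. rhs ?g x * v x \<partial>M)"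
      using ae i m by (intro integral_cong_AE) auto
  qed
  show ?thesis
  proof
    assume w: "weak_solution 2 q \<mu> \<Omega> f u"
    then have W: "W0 u ?g" by (intro W0_if_sobolev_space0) (simp add: weak_solution_def)
    show "solves ?g u ?g" unfolding solves_def
    proof (intro conjI W allI impI)
      fix v h assume V: "W0 v h"
      note wg = W0_weak_grad[OF V]
      have "(\<integral>x. flux x (?g x) \<bullet> h x \<partial>M) = (\<integral>x. flux x (?g x) \<bullet> weak_grad \<Omega> v x \<partial>M)"
      proof (rule integral_cong_AE)
        show "AE x in M. flux x (?g x) \<bullet> h x = flux x (?g x) \<bullet> weak_grad \<Omega> v x"
          using wg(1) by eventually_elim (simp)
      qed (use flux_integrable[OF W0_finite_energy[OF W] W0_finite_energy[OF V]]
          flux_integrable[OF W0_finite_energy[OF W] W0_finite_energy[OF wg(3)]] in auto)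
      also have "\<dots> = (\<integral>x. f x (u x) (?g x) * v x \<partial>M)"
        using w sobolev_space0_if_W0[OF V] unfolding weak_solution_def by blast
      also have "\<dots> = (\<integral>x. rhs ?g x * v x \<partial>M)" by (rule rhs_eq(2)[OF W V])
      finally show "(\<integral>x. flux x (?g x) \<bullet> h x \<partial>M) = (\<integral>x. rhs ?g x * v x \<partial>M)" .
    qed
  next
    assume s: "solves ?g u ?g"
    then have W: "W0 u ?g" by (simp add: solves_def)
    show "weak_solution 2 q \<mu> \<Omega> f u" unfolding weak_solution_def
    proof (intro conjI ballI)
      show "u \<in> sobolev_space0 H \<Omega>" by (rule sobolev_space0_if_W0[OF W])
      fix \<phi> assume "\<phi> \<in> sobolev_space0 H \<Omega>"
      then have V: "W0 \<phi> (weak_grad \<Omega> \<phi>)" by (rule W0_if_sobolev_space0)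
      show "integrable M (\<lambda>x. flux x (?g x) \<bullet> weak_grad \<Omega> \<phi> x)"
        by (rule flux_integrable[OF W0_finite_energy[OF W] W0_finite_energy[OF V]])
      show "integrable M (\<lambda>x. f x (u x) (?g x) * \<phi> x)" by (rule rhs_eq(1)[OF W V])
      show "(\<integral>x. flux x (?g x) \<bullet> weak_grad \<Omega> \<phi> x \<partial>M) = (\<integral>x. f x (u x) (?g x) * \<phi> x \<partial>M)"
        using s V unfolding solves_def rhs_eq(2)[OF W V] by blast
    qed
  qed
qed

lemma solves_weak_grad:
  assumes "solves g u g"
  shows "solves (weak_grad \<Omega> u) u (weak_grad \<Omega> u)"
proof -
  have W: "W0 u g" using assms by (simp add: solves_def)
  note wg = W0_weak_grad[OF W]
  have ae: "AE x in M. g x = weak_grad \<Omega> u x" using wg(1) by eventually_elim (simp)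
  have s: "solves (weak_grad \<Omega> u) u g"
    by (rule solves_cong_AE[OF assms ae W0_L2[OF W] W0_L2[OF wg(3)]])
  have "(\<integral>x. flux x (weak_grad \<Omega> u x) \<bullet> h x \<partial>M) = (\<integral>x. flux x (g x) \<bullet> h x \<partial>M)" if V: "W0 v h" for v h
    using wg(1) flux_integrable[OF W0_finite_energy[OF W] W0_finite_energy[OF V]]
      flux_integrable[OF W0_finite_energy[OF wg(3)] W0_finite_energy[OF V]]
    by (intro integral_cong_AE) auto
  then show ?thesis using s wg(3) by (auto simp: solves_def)
qed

theorem ex_unique_weak_solution:
  assumes f: "AE x in M. \<forall>s \<xi>. f x s \<xi> = \<rho> x + c x \<bullet> \<xi>"
  shows "\<exists>u. weak_solution 2 q \<mu> \<Omega> f u \<and> (\<forall>v. weak_solution 2 q \<mu> \<Omega> f v \<longrightarrow> (AE x in M. v x = u x))"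
proof -
  obtain u g where "solves g u g" using ex_fixed_point by blast
  then have s: "solves (weak_grad \<Omega> u) u (weak_grad \<Omega> u)" by (rule solves_weak_grad)
  show ?thesis
    using s solves_unique[OF _ s] unfolding weak_solution_iff[OF f] by blast
qed

end

section \<open>The convection term is linear\<close>

text \<open>Replacing \<open>\<xi>\<close> by \<open>k \<xi>\<close> multiplies the left-hand side of the one-sided Lipschitz condition by \<open>k\<close>, of either
  sign and arbitrarily large, while the right-hand side stays fixed.  So the left-hand side vanishes.\<close>

lemma convection_independent_of_value:
  fixes f :: "real \<Rightarrow> 'b::real_vector \<Rightarrow> real"
  assumes lin: "\<And>s. linear (\<lambda>\<xi>. f s \<xi> - r)"
    and one_sided: "\<And>s t \<xi>. (f s \<xi> - f t \<xi>) * (s - t) \<le> C * \<bar>s - t\<bar>\<^sup>2"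
  shows "f s \<xi> = f t \<xi>"
proof (rule ccontr)
  assume ne: "f s \<xi> \<noteq> f t \<xi>"
  define a where "a = (f s \<xi> - f t \<xi>) * (s - t)"
  have "s \<noteq> t" using ne by auto
  then have a: "a \<noteq> 0" using ne by (simp add: a_def)
  have scale: "f s (k *\<^sub>R \<xi>) - r = k * (f s \<xi> - r)" for s k
    using linear_scale[OF lin[of s], of k \<xi>] by simp
  have "k * a \<le> C * \<bar>s - t\<bar>\<^sup>2" for k
  proof -
    have "f s (k *\<^sub>R \<xi>) - f t (k *\<^sub>R \<xi>) = k * (f s \<xi> - f t \<xi>)"
      using scale[of s k] scale[of t k] by (simp add: algebra_simps)
    then show ?thesis using one_sided[of s "k *\<^sub>R \<xi>" t] by (simp add: a_def mult.assoc)
  qed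
  from this[of "(C * \<bar>s - t\<bar>\<^sup>2 + 1) / a"] show False using a by simp
qed

text \<open>With the dependence on \<open>s\<close> removed, the coefficients in \<open>\<xi>\<close> are read off at the unit vectors.\<close>

lemma linear_convection_representation:
  fixes f :: "real \<Rightarrow> real^'n::finite \<Rightarrow> real"
  assumes lin: "\<And>s. linear (\<lambda>\<xi>. f s \<xi> - r)"
    and bound: "\<And>s \<xi>. \<bar>f s \<xi> - r\<bar> \<le> c2 * norm \<xi>"
    and one_sided: "\<And>s t \<xi>. (f s \<xi> - f t \<xi>) * (s - t) \<le> C * \<bar>s - t\<bar>\<^sup>2"
  shows "f s \<xi> = r + (\<chi> i. f 0 (axis i 1) - r) \<bullet> \<xi>" "norm (\<chi> i. f 0 (axis i 1) - r) \<le> c2"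
proof -
  let ?c = "\<chi> i. f 0 (axis i 1) - r"
  interpret l: linear "\<lambda>\<xi>. f 0 \<xi> - r" by (rule lin)
  have rep: "f 0 \<xi> - r = ?c \<bullet> \<xi>" for \<xi>
  proof -
    have "f 0 \<xi> - r = f 0 (\<Sum>i\<in>UNIV. \<xi> $ i *\<^sub>R axis i 1) - r"
      by (simp add: basis_expansion[where 'a = real, unfolded scalar_mult_eq_scaleR])
    also have "\<dots> = (\<Sum>i\<in>UNIV. \<xi> $ i * (f 0 (axis i 1) - r))"
      by (simp add: l.sum l.scale)
    finally show ?thesis by (simp add: inner_vec_def mult.commute)
  qed
  show "f s \<xi> = r + ?c \<bullet> \<xi>"
    using rep[of \<xi>] convection_independent_of_value[OF lin one_sided, of s \<xi> 0] by simp
  have "norm ?c * norm ?c = ?c \<bullet> ?c" by (simp add: power2_norm_eq_inner[symmetric] power2_eq_square)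
  also have "\<dots> \<le> c2 * norm ?c" using bound[of 0 ?c] rep[of ?c] by simp
  finally show "norm ?c \<le> c2"
  proof (cases "?c = 0")
    case True
    have "0 \<le> c2" using bound[of 0 "axis undefined 1"] order_trans[OF abs_ge_zero] by fastforce
    then show ?thesis using True by simp
  qed (simp add: mult_le_cancel_right)
qed

theorem theorem3p4:
  fixes \<Omega> :: "(real^'n::finite) set"
    and p q q1 r' a1 a2 b1 b2 c1 c2 :: real
    and \<mu> \<alpha> \<omega> \<rho> :: "real^'n \<Rightarrow> real"
    and f :: "real^'n \<Rightarrow> real \<Rightarrow> real^'n \<Rightarrow> real"
  assumes dim: "CARD('n) \<ge> 2"
    and domain: "domain_set \<Omega>" "bounded \<Omega>" "lipschitz_boundary \<Omega>"
    and exponents: "p = 2" "p < q" "q < real CARD('n)" "q / p < 1 + 1 / real CARD('n)"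
    and weight: "\<forall>x\<in>closure \<Omega>. \<mu> x \<ge> 0" "\<exists>L. L-lipschitz_on (closure \<Omega>) \<mu>"
    and carath: "caratheodory \<Omega> f"
    and Hi: "1 < q1" "q1 < sobolev_conjugate (real CARD('n)) p"
      "\<alpha> \<in> Lr_space (q1 / (q1 - 1)) \<Omega>" "a1 \<ge> 0" "a2 \<ge> 0"
      "AE x in lebesgue_on \<Omega>. \<forall>s \<xi>.
         \<bar>f x s \<xi>\<bar> \<le> a1 * norm \<xi> powr (p * ((q1 - 1) / q1)) + a2 * \<bar>s\<bar> powr (q1 - 1) + \<alpha> x"
    and Hii: "\<omega> \<in> Lr_space 1 \<Omega>" "b1 \<ge> 0" "b2 \<ge> 0"
      "AE x in lebesgue_on \<Omega>. \<forall>s \<xi>.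
         f x s \<xi> * s \<le> b1 * norm \<xi> powr p + b2 * \<bar>s\<bar> powr p + \<omega> x"
      "b1 + b2 * inverse (first_eigenvalue 2 \<Omega>) < 1"
    and U1: "c1 \<ge> 0"
      "AE x in lebesgue_on \<Omega>. \<forall>s t \<xi>. (f x s \<xi> - f x t \<xi>) * (s - t) \<le> c1 * \<bar>s - t\<bar>\<^sup>2"
    and U2: "1 < r'" "r' < sobolev_conjugate (real CARD('n)) p" "\<rho> \<in> Lr_space r' \<Omega>" "c2 \<ge> 0"
      "AE x in lebesgue_on \<Omega>. \<forall>s. linear (\<lambda>\<xi>. f x s \<xi> - \<rho> x)"
      "AE x in lebesgue_on \<Omega>. \<forall>s \<xi>. \<bar>f x s \<xi> - \<rho> x\<bar> \<le> c2 * norm \<xi>"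
      "c1 * inverse (first_eigenvalue 2 \<Omega>) + c2 * first_eigenvalue 2 \<Omega> powr (- 1 / 2) < 1"
  shows "\<exists>u. weak_solution p q \<mu> \<Omega> f u \<and>
           (\<forall>v. weak_solution p q \<mu> \<Omega> f v \<longrightarrow> (AE x in lebesgue_on \<Omega>. v x = u x))"
proof -
  let ?N = "real CARD('n)"
  have dom: "open \<Omega>" "\<Omega> \<noteq> {}" using domain(1) by (auto simp: domain_set_def)
  have \<Omega>l: "\<Omega> \<in> sets lebesgue" using dom by simp
  have q: "2 < q" "q < 2 + 4 / ?N"
  proof -
    show "2 < q" using exponents by simp
    have "q < 2 + 2 * (1 / ?N)" using exponents(1,4) by simp
    also have "\<dots> \<le> 2 + 4 / ?N" using dim by (simp add: divide_right_mono)
    finally show "q < 2 + 4 / ?N" .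
  qed
  obtain L where "L-lipschitz_on (closure \<Omega>) \<mu>" using weight(2) by blast
  then have cont: "continuous_on (closure \<Omega>) \<mu>" by (rule lipschitz_on_continuous_on)
  have "compact (closure \<Omega>)" using domain(2) by (simp add: compact_closure)
  then have "bounded (\<mu> ` closure \<Omega>)" using compact_continuous_image[OF cont] compact_imp_bounded by blast
  then obtain B where B: "\<And>x. x \<in> closure \<Omega> \<Longrightarrow> \<bar>\<mu> x\<bar> \<le> B" by (auto simp: bounded_iff)
  have \<mu>m: "\<mu> \<in> borel_measurable (lebesgue_on \<Omega>)"
    using cont closure_subset \<Omega>l by (intro continuous_imp_measurable_on_sets_lebesgue) (auto intro: continuous_on_subset)
  interpret lap: laplace_domain \<Omega> q
    by unfold_locales (use dom domain(2) q in auto)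
  have eig: "first_eigenvalue 2 \<Omega> = rayleigh_inf \<Omega>" by (rule lap.first_eigenvalue_eq)
  have lam: "rayleigh_inf \<Omega> > 0" by (rule lap.lam_pos)
  have c2lam: "c2\<^sup>2 < rayleigh_inf \<Omega>"
  proof -
    have pw: "rayleigh_inf \<Omega> powr (- 1 / 2) = 1 / sqrt (rayleigh_inf \<Omega>)"
      using lam powr_minus_divide[of "rayleigh_inf \<Omega>" "1 / 2"] by (simp add: powr_half_sqrt)
    have "0 \<le> c1 * inverse (rayleigh_inf \<Omega>)" using U1(1) lam by simp
    then have "c2 * (1 / sqrt (rayleigh_inf \<Omega>)) < 1" using U2(7) unfolding eig pw by linarith
    then have "c2 < sqrt (rayleigh_inf \<Omega>)" using lam by (simp add: field_simps)
    then have "c2\<^sup>2 < (sqrt (rayleigh_inf \<Omega>))\<^sup>2" using U2(4) by (intro power_strict_mono) auto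
    then show ?thesis using lam by simp
  qed
  have \<rho>m[measurable]: "\<rho> \<in> borel_measurable (lebesgue_on \<Omega>)" using U2(3) by (simp add: musielak_space_def)
  define c where "c x = (\<chi> i. f x 0 (axis i 1) - \<rho> x)" for x
  have rep: "AE x in lebesgue_on \<Omega>. (\<forall>s \<xi>. f x s \<xi> = \<rho> x + c x \<bullet> \<xi>) \<and> norm (c x) \<le> c2"
    using U1(2) U2(5,6)
  proof eventually_elim
    case (elim x)
    show ?case unfolding c_def
      using linear_convection_representation[of "f x" "\<rho> x" c2 c1] elim by blast
  qed
  have cm: "c \<in> borel_measurable (lebesgue_on \<Omega>)"
    unfolding c_def
  proof (subst borel_measurable_euclidean_space, intro ballI)
    fix b :: "real^'n" assume "b \<in> Basis"
    then obtain i where b: "b = axis i 1" by (auto simp: Basis_vec_def)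
    have [measurable]: "(\<lambda>x. f x 0 (axis i 1)) \<in> borel_measurable (lebesgue_on \<Omega>)"
      using carath by (simp add: caratheodory_def)
    show "(\<lambda>x. (\<chi> i. f x 0 (axis i 1) - \<rho> x) \<bullet> b) \<in> borel_measurable (lebesgue_on \<Omega>)"
      unfolding b by (simp add: inner_axis)
  qed
  \<comment> \<open>At \<open>\<xi> = 0\<close> the growth condition reads \<open>\<rho> s \<le> b2 s\<^sup>2 + \<omega>\<close> for all \<open>s\<close>; optimizing in \<open>s\<close> bounds \<open>\<rho>\<^sup>2\<close> by a
    multiple of \<open>\<omega>\<close>.\<close>
  have \<rho>2: "integrable (lebesgue_on \<Omega>) (\<lambda>x. (\<rho> x)\<^sup>2)"
  proof (rule Bochner_Integration.integrable_bound)
    have [measurable]: "\<omega> \<in> borel_measurable (lebesgue_on \<Omega>)"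
      and fin: "(\<integral>\<^sup>+x. ennreal (\<bar>\<omega> x\<bar> powr 1) \<partial>lebesgue_on \<Omega>) < \<infinity>"
      using Hii(1) by (auto simp: musielak_space_def modular_def pure_power_def)
    then have "integrable (lebesgue_on \<Omega>) \<omega>" by (simp add: integrable_iff_bounded)
    then show "integrable (lebesgue_on \<Omega>) (\<lambda>x. 4 * (b2 + 1) * \<omega> x)" by simp
    show "AE x in lebesgue_on \<Omega>. norm ((\<rho> x)\<^sup>2) \<le> norm (4 * (b2 + 1) * \<omega> x)"
      using Hii(4) rep
    proof eventually_elim
      case (elim x)
      define s where "s = \<rho> x / (2 * (b2 + 1))"
      have b: "b2 + 1 > 0" using Hii(3) by simp
      have "f x s 0 * s \<le> b1 * norm (0::real^'n) powr p + b2 * \<bar>s\<bar> powr p + \<omega> x" using elim by blast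
      moreover have "f x s 0 = \<rho> x" using elim by simp
      ultimately have "\<rho> x * s \<le> b2 * s\<^sup>2 + \<omega> x" using exponents(1) by simp
      also have "\<dots> \<le> (b2 + 1) * s\<^sup>2 + \<omega> x" by (simp add: distrib_right)
      finally have "\<rho> x * s - (b2 + 1) * s\<^sup>2 \<le> \<omega> x" by simp
      moreover have "\<rho> x * s - (b2 + 1) * s\<^sup>2 = (\<rho> x)\<^sup>2 / (4 * (b2 + 1))"
      proof -
        have "r * (r / (2 * b)) - b * (r / (2 * b))\<^sup>2 = r\<^sup>2 / (4 * b)" if "b > 0" for r b :: real
          using that by (simp add: power2_eq_square field_simps)
        from this[OF b] show ?thesis unfolding s_def .
      qed
      ultimately have "(\<rho> x)\<^sup>2 \<le> 4 * (b2 + 1) * \<omega> x" using b by (simp add: pos_divide_le_eq mult.commute)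
      then show ?case by simp
    qed
  qed measurable
  interpret convection_domain \<Omega> q B \<mu> c \<rho> c2
  proof
    show "\<And>x. x \<in> \<Omega> \<Longrightarrow> 0 \<le> \<mu> x" using weight(1) closure_subset by blast
    show "\<mu> x \<le> B" if "x \<in> \<Omega>" for x using B[of x] that closure_subset[of \<Omega>] by auto
    show "AE x in lebesgue_on \<Omega>. norm (c x) \<le> c2" using rep by eventually_elim (simp)
  qed (use dom domain(2) q \<mu>m cm U2(4) c2lam \<rho>m \<rho>2 in auto)
  have "AE x in lebesgue_on \<Omega>. \<forall>s \<xi>. f x s \<xi> = \<rho> x + c x \<bullet> \<xi>" using rep by eventually_elim (simp)
  from ex_unique_weak_solution[OF this] show ?thesis unfolding exponents(1) .
qed

end
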